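(* Let $k$ be a field, $G$ a finite group, $M$ a finite dimensional indecomposable $kG$-module and $S$ a $kG$-module. Then $\dim_{\overline{E}_M}\operatorname{Hom}^{\oplus}_{kG}(M,S)$ is equal to the largest cardinal $r$ such that $M^{(r)}$ is isomorphic to a direct summand of $S$ as a $kG$-module. If $S=\bigoplus_i S_i$ is graded (as a $kG$-module), then for each $i$, $\dim_{\overline{E}_M}\operatorname{Hom}^{\oplus}_{kG}(M,S)_i$ is equal to the largest cardinal $r$ such that $M^{(r)}$ is isomorphic to a direct summand of $S_i$ as a $kG$-module.
   Context: $M^{(r)}$ is the direct sum of $r$ copies of $M$. $E_M=\operatorname{End}_{kG}(M)$ is a local ring and $\overline{E}_M=E_M/\operatorname{rad}(E_M)$ is a division $k$-algebra. For any $kG$-module $X$, let $J_G(M,X)\subseteq \operatorname{Hom}_{kG}(M,X)$ be the set of homomorphisms that are not split injective; it is a subspace, and $\operatorname{Hom}^{\oplus}_{kG}(M,X):=\operatorname{Hom}_{kG}(M,X)/J_G(M,X)$. Composition makes it a right $\overline{E}_M$-module, and $\dim_{\overline{E}_M}$ is its dimension (a cardinal). When $X=\bigoplus_i X_i$ is graded, $\operatorname{Hom}^{\oplus}_{kG}(M,X)=\bigoplus_i \operatorname{Hom}^{\oplus}_{kG}(M,X)_i$ with $\operatorname{Hom}^{\oplus}_{kG}(M,X)_i=\operatorname{Hom}^{\oplus}_{kG}(M,X_i)$. *)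

theory Defs
  imports "Jordan_Normal_Form.Missing_VectorSpace" "HOL-Algebra.QuotRing"
begin

unbundle cardinal_syntax

text \<open>
  The locale \<open>module\<close> of \<open>HOL-Algebra\<close> only covers commutative base rings. Here is the
  same notion over an arbitrary ring, on the same records.
\<close>

locale left_module = R?: ring R + M?: abelian_group M
    for R :: "('r, 'a) ring_scheme" and M :: "('r, 'm, 'c) module_scheme" +
  assumes smult_closed:
      "\<lbrakk>a \<in> carrier R; x \<in> carrier M\<rbrakk> \<Longrightarrow> a \<odot>\<^bsub>M\<^esub> x \<in> carrier M"
    and smult_l_distr:
      "\<lbrakk>a \<in> carrier R; b \<in> carrier R; x \<in> carrier M\<rbrakk> \<Longrightarrow>
        (a \<oplus>\<^bsub>R\<^esub> b) \<odot>\<^bsub>M\<^esub> x = a \<odot>\<^bsub>M\<^esub> x \<oplus>\<^bsub>M\<^esub> b \<odot>\<^bsub>M\<^esub> x"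
    and smult_r_distr:
      "\<lbrakk>a \<in> carrier R; x \<in> carrier M; y \<in> carrier M\<rbrakk> \<Longrightarrow>
        a \<odot>\<^bsub>M\<^esub> (x \<oplus>\<^bsub>M\<^esub> y) = a \<odot>\<^bsub>M\<^esub> x \<oplus>\<^bsub>M\<^esub> a \<odot>\<^bsub>M\<^esub> y"
    and smult_assoc:
      "\<lbrakk>a \<in> carrier R; b \<in> carrier R; x \<in> carrier M\<rbrakk> \<Longrightarrow>
        (a \<otimes>\<^bsub>R\<^esub> b) \<odot>\<^bsub>M\<^esub> x = a \<odot>\<^bsub>M\<^esub> (b \<odot>\<^bsub>M\<^esub> x)"
    and smult_one:
      "x \<in> carrier M \<Longrightarrow> \<one>\<^bsub>R\<^esub> \<odot>\<^bsub>M\<^esub> x = x"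


subsection \<open>The group algebra of a finite group\<close>

text \<open>
  Since \<open>G\<close> is finite, every function \<open>G \<rightarrow> k\<close> is a formal \<open>k\<close>-linear combination of
  group elements; the product is convolution.
\<close>

definition group_algebra ::
    "('k, 'a) ring_scheme \<Rightarrow> ('g, 'b) monoid_scheme \<Rightarrow> ('g \<Rightarrow> 'k) ring" where
  "group_algebra k G =
    \<lparr>carrier = carrier G \<rightarrow>\<^sub>E carrier k,
     mult = (\<lambda>a b. \<lambda>x\<in>carrier G. \<Oplus>\<^bsub>k\<^esub>y\<in>carrier G. a y \<otimes>\<^bsub>k\<^esub> b (inv\<^bsub>G\<^esub> y \<otimes>\<^bsub>G\<^esub> x)),
     one = (\<lambda>x\<in>carrier G. if x = \<one>\<^bsub>G\<^esub> then \<one>\<^bsub>k\<^esub> else \<zero>\<^bsub>k\<^esub>),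
     zero = (\<lambda>x\<in>carrier G. \<zero>\<^bsub>k\<^esub>),
     add = (\<lambda>a b. \<lambda>x\<in>carrier G. a x \<oplus>\<^bsub>k\<^esub> b x)\<rparr>"

definition group_algebra_of_scalar ::
    "('k, 'a) ring_scheme \<Rightarrow> ('g, 'b) monoid_scheme \<Rightarrow> 'k \<Rightarrow> 'g \<Rightarrow> 'k" where
  "group_algebra_of_scalar k G c = (\<lambda>x\<in>carrier G. if x = \<one>\<^bsub>G\<^esub> then c else \<zero>\<^bsub>k\<^esub>)"

definition restrict_scalars ::
    "('k, 'a) ring_scheme \<Rightarrow> ('g, 'b) monoid_scheme \<Rightarrow> ('g \<Rightarrow> 'k, 'm, 'c) module_scheme \<Rightarrow>
      ('k, 'm) module" where
  "restrict_scalars k G M =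
    \<lparr>carrier = carrier M, mult = mult M, one = one M, zero = zero M, add = add M,
     smult = (\<lambda>c. smult M (group_algebra_of_scalar k G c))\<rparr>"

lemma finsum_delta:
  assumes "abelian_monoid k" "finite A" "x \<in> A" "f x \<in> carrier k"
  shows "(\<Oplus>\<^bsub>k\<^esub>y\<in>A. if y = x then f y else \<zero>\<^bsub>k\<^esub>) = f x"
proof -
  interpret abelian_monoid k by fact
  have "(\<Oplus>\<^bsub>k\<^esub>y\<in>A. if x = y then f y else \<zero>\<^bsub>k\<^esub>) = (\<Oplus>\<^bsub>k\<^esub>y\<in>A. if x = y then (\<lambda>_. f x) y else \<zero>\<^bsub>k\<^esub>)"
    by (rule finsum_cong') (use assms in auto)
  also have "\<dots> = f x" using assms add.finprod_singleton[of x A "\<lambda>_. f x"] by (simp add: finsum_def)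
  finally show ?thesis by (simp add: eq_commute)
qed

lemma finsum_swap:
  assumes "abelian_monoid k" "finite A" "finite B" "\<And>x y. x \<in> A \<Longrightarrow> y \<in> B \<Longrightarrow> f x y \<in> carrier k"
  shows "(\<Oplus>\<^bsub>k\<^esub>x\<in>A. \<Oplus>\<^bsub>k\<^esub>y\<in>B. f x y) = (\<Oplus>\<^bsub>k\<^esub>y\<in>B. \<Oplus>\<^bsub>k\<^esub>x\<in>A. f x y)"
proof -
  interpret abelian_monoid k by fact
  show ?thesis using assms(2,4)
  proof (induction A)
    case empty show ?case by (simp add: finsum_zero)
  next
    case (insert a A)
    have "(\<Oplus>\<^bsub>k\<^esub>y\<in>B. \<Oplus>\<^bsub>k\<^esub>x\<in>insert a A. f x y) = (\<Oplus>\<^bsub>k\<^esub>y\<in>B. f a y \<oplus>\<^bsub>k\<^esub> (\<Oplus>\<^bsub>k\<^esub>x\<in>A. f x y))"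
      by (rule finsum_cong') (use insert in \<open>auto intro!: finsum_insert finsum_closed\<close>)
    also have "\<dots> = (\<Oplus>\<^bsub>k\<^esub>y\<in>B. f a y) \<oplus>\<^bsub>k\<^esub> (\<Oplus>\<^bsub>k\<^esub>y\<in>B. (\<Oplus>\<^bsub>k\<^esub>x\<in>A. f x y))"
      by (rule finsum_addf) (use insert in \<open>auto intro!: finsum_closed\<close>)
    also have "\<dots> = (\<Oplus>\<^bsub>k\<^esub>x\<in>insert a A. \<Oplus>\<^bsub>k\<^esub>y\<in>B. f x y)"
      using insert by (subst finsum_insert) (auto intro!: finsum_closed)
    finally show ?case ..
  qed
qed

lemma ring_group_algebra:
  assumes "ring k" "group G" "finite (carrier G)"
  shows "ring (group_algebra k G)"
proof -
  interpret k: ring k by fact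
  interpret G: group G by fact
  note fin = assms(3)
  have am: "abelian_monoid k" by unfold_locales
  let ?A = "group_algebra k G"
  have ab: "abelian_group ?A"
  proof (rule abelian_groupI)
    fix a assume "a \<in> carrier ?A"
    then show "\<exists>b\<in>carrier ?A. b \<oplus>\<^bsub>?A\<^esub> a = \<zero>\<^bsub>?A\<^esub>"
      by (intro bexI[of _ "\<lambda>x\<in>carrier G. \<ominus>\<^bsub>k\<^esub> a x"])
         (auto simp: group_algebra_def k.l_neg fun_eq_iff PiE_iff)
  qed (auto simp: group_algebra_def k.a_ac PiE_iff fun_eq_iff extensional_def)
  have cl: "a \<otimes>\<^bsub>?A\<^esub> b \<in> carrier ?A" if "a \<in> carrier ?A" "b \<in> carrier ?A" for a b
    using that by (auto simp: group_algebra_def intro!: k.finsum_closed)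
  have mo: "monoid ?A"
  proof (rule monoidI)
    fix a b c assume a: "a \<in> carrier ?A" and b: "b \<in> carrier ?A" and c: "c \<in> carrier ?A"
    have [simp]: "x \<in> carrier G \<Longrightarrow> a x \<in> carrier k" "x \<in> carrier G \<Longrightarrow> b x \<in> carrier k"
      "x \<in> carrier G \<Longrightarrow> c x \<in> carrier k" for x
      using a b c by (auto simp: group_algebra_def)
    show "a \<otimes>\<^bsub>?A\<^esub> b \<otimes>\<^bsub>?A\<^esub> c = a \<otimes>\<^bsub>?A\<^esub> (b \<otimes>\<^bsub>?A\<^esub> c)"
    proof
      fix x
      show "(a \<otimes>\<^bsub>?A\<^esub> b \<otimes>\<^bsub>?A\<^esub> c) x = (a \<otimes>\<^bsub>?A\<^esub> (b \<otimes>\<^bsub>?A\<^esub> c)) x"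
      proof (cases "x \<in> carrier G")
        case x: True
        have "(a \<otimes>\<^bsub>?A\<^esub> b \<otimes>\<^bsub>?A\<^esub> c) x =
          (\<Oplus>\<^bsub>k\<^esub>y\<in>carrier G. (\<Oplus>\<^bsub>k\<^esub>z\<in>carrier G. a z \<otimes>\<^bsub>k\<^esub> b (inv\<^bsub>G\<^esub> z \<otimes>\<^bsub>G\<^esub> y)) \<otimes>\<^bsub>k\<^esub> c (inv\<^bsub>G\<^esub> y \<otimes>\<^bsub>G\<^esub> x))"
          using x by (auto simp: group_algebra_def intro!: k.finsum_cong' k.finsum_closed k.m_closed)
        also have "\<dots> = (\<Oplus>\<^bsub>k\<^esub>y\<in>carrier G. \<Oplus>\<^bsub>k\<^esub>z\<in>carrier G. a z \<otimes>\<^bsub>k\<^esub> b (inv\<^bsub>G\<^esub> z \<otimes>\<^bsub>G\<^esub> y) \<otimes>\<^bsub>k\<^esub> c (inv\<^bsub>G\<^esub> y \<otimes>\<^bsub>G\<^esub> x))"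
          using x by (intro k.finsum_cong' k.finsum_ldistr) (auto intro!: k.finsum_closed fin)
        also have "\<dots> = (\<Oplus>\<^bsub>k\<^esub>z\<in>carrier G. \<Oplus>\<^bsub>k\<^esub>y\<in>carrier G. a z \<otimes>\<^bsub>k\<^esub> b (inv\<^bsub>G\<^esub> z \<otimes>\<^bsub>G\<^esub> y) \<otimes>\<^bsub>k\<^esub> c (inv\<^bsub>G\<^esub> y \<otimes>\<^bsub>G\<^esub> x))"
          using x by (intro finsum_swap am fin) auto
        also have "\<dots> = (\<Oplus>\<^bsub>k\<^esub>z\<in>carrier G. a z \<otimes>\<^bsub>k\<^esub> (\<Oplus>\<^bsub>k\<^esub>y\<in>carrier G. b y \<otimes>\<^bsub>k\<^esub> c (inv\<^bsub>G\<^esub> y \<otimes>\<^bsub>G\<^esub> (inv\<^bsub>G\<^esub> z \<otimes>\<^bsub>G\<^esub> x))))"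
        proof (intro k.finsum_cong' refl)
          fix z assume z: "z \<in> carrier G"
          have bij: "(\<lambda>y. z \<otimes>\<^bsub>G\<^esub> y) ` carrier G = carrier G" "inj_on (\<lambda>y. z \<otimes>\<^bsub>G\<^esub> y) (carrier G)"
            using z G.surj_const_mult by (auto simp: inj_on_def)
          have "(\<Oplus>\<^bsub>k\<^esub>y\<in>carrier G. a z \<otimes>\<^bsub>k\<^esub> b (inv\<^bsub>G\<^esub> z \<otimes>\<^bsub>G\<^esub> y) \<otimes>\<^bsub>k\<^esub> c (inv\<^bsub>G\<^esub> y \<otimes>\<^bsub>G\<^esub> x))
            = (\<Oplus>\<^bsub>k\<^esub>y\<in>carrier G. a z \<otimes>\<^bsub>k\<^esub> b (inv\<^bsub>G\<^esub> z \<otimes>\<^bsub>G\<^esub> (z \<otimes>\<^bsub>G\<^esub> y)) \<otimes>\<^bsub>k\<^esub> c (inv\<^bsub>G\<^esub> (z \<otimes>\<^bsub>G\<^esub> y) \<otimes>\<^bsub>G\<^esub> x))"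
            using k.finsum_reindex[of "\<lambda>y. a z \<otimes>\<^bsub>k\<^esub> b (inv\<^bsub>G\<^esub> z \<otimes>\<^bsub>G\<^esub> y) \<otimes>\<^bsub>k\<^esub> c (inv\<^bsub>G\<^esub> y \<otimes>\<^bsub>G\<^esub> x)" "\<lambda>y. z \<otimes>\<^bsub>G\<^esub> y" "carrier G"]
              bij z x by auto
          also have "\<dots> = (\<Oplus>\<^bsub>k\<^esub>y\<in>carrier G. a z \<otimes>\<^bsub>k\<^esub> (b y \<otimes>\<^bsub>k\<^esub> c (inv\<^bsub>G\<^esub> y \<otimes>\<^bsub>G\<^esub> (inv\<^bsub>G\<^esub> z \<otimes>\<^bsub>G\<^esub> x))))"
            using x z by (intro k.finsum_cong') (auto simp: G.inv_mult_group G.m_assoc[symmetric] k.m_assoc)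
          also have "\<dots> = a z \<otimes>\<^bsub>k\<^esub> (\<Oplus>\<^bsub>k\<^esub>y\<in>carrier G. b y \<otimes>\<^bsub>k\<^esub> c (inv\<^bsub>G\<^esub> y \<otimes>\<^bsub>G\<^esub> (inv\<^bsub>G\<^esub> z \<otimes>\<^bsub>G\<^esub> x)))"
            using x z by (intro k.finsum_rdistr[symmetric]) (auto intro: fin)
          finally show "(\<Oplus>\<^bsub>k\<^esub>y\<in>carrier G. a z \<otimes>\<^bsub>k\<^esub> b (inv\<^bsub>G\<^esub> z \<otimes>\<^bsub>G\<^esub> y) \<otimes>\<^bsub>k\<^esub> c (inv\<^bsub>G\<^esub> y \<otimes>\<^bsub>G\<^esub> x)) = a z \<otimes>\<^bsub>k\<^esub> (\<Oplus>\<^bsub>k\<^esub>y\<in>carrier G. b y \<otimes>\<^bsub>k\<^esub> c (inv\<^bsub>G\<^esub> y \<otimes>\<^bsub>G\<^esub> (inv\<^bsub>G\<^esub> z \<otimes>\<^bsub>G\<^esub> x)))" .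
        qed (use x in \<open>auto intro!: k.finsum_closed k.m_closed\<close>)
        also have "\<dots> = (a \<otimes>\<^bsub>?A\<^esub> (b \<otimes>\<^bsub>?A\<^esub> c)) x"
          using x by (auto simp: group_algebra_def intro!: k.finsum_cong' k.finsum_closed k.m_closed)
        finally show ?thesis .
      qed (auto simp: group_algebra_def)
    qed
    show "\<one>\<^bsub>?A\<^esub> \<otimes>\<^bsub>?A\<^esub> a = a"
    proof
      fix x
      show "(\<one>\<^bsub>?A\<^esub> \<otimes>\<^bsub>?A\<^esub> a) x = a x"
      proof (cases "x \<in> carrier G")
        case x: True
        then have "(\<one>\<^bsub>?A\<^esub> \<otimes>\<^bsub>?A\<^esub> a) x = (\<Oplus>\<^bsub>k\<^esub>y\<in>carrier G. if y = \<one>\<^bsub>G\<^esub> then a (inv\<^bsub>G\<^esub> y \<otimes>\<^bsub>G\<^esub> x) else \<zero>\<^bsub>k\<^esub>)"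
          by (auto simp: group_algebra_def intro!: k.finsum_cong')
        with x show ?thesis using finsum_delta[OF am fin, of "\<one>\<^bsub>G\<^esub>" "\<lambda>y. a (inv\<^bsub>G\<^esub> y \<otimes>\<^bsub>G\<^esub> x)"] by simp
      qed (use a in \<open>auto simp: group_algebra_def\<close>)
    qed
    show "a \<otimes>\<^bsub>?A\<^esub> \<one>\<^bsub>?A\<^esub> = a"
    proof
      fix x
      show "(a \<otimes>\<^bsub>?A\<^esub> \<one>\<^bsub>?A\<^esub>) x = a x"
      proof (cases "x \<in> carrier G")
        case x: True
        have e: "inv\<^bsub>G\<^esub> y \<otimes>\<^bsub>G\<^esub> x = \<one>\<^bsub>G\<^esub> \<longleftrightarrow> y = x" if "y \<in> carrier G" for y
          using x that by (metis G.inv_closed G.inv_equality G.inv_inv G.l_inv)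
        from x have "(a \<otimes>\<^bsub>?A\<^esub> \<one>\<^bsub>?A\<^esub>) x = (\<Oplus>\<^bsub>k\<^esub>y\<in>carrier G. if y = x then a y else \<zero>\<^bsub>k\<^esub>)"
          by (auto simp: group_algebra_def e intro!: k.finsum_cong')
        with x show ?thesis using finsum_delta[OF am fin, of x a] by simp
      qed (use a in \<open>auto simp: group_algebra_def\<close>)
    qed
  next
    show "\<one>\<^bsub>?A\<^esub> \<in> carrier ?A" by (auto simp: group_algebra_def)
  qed (rule cl)
  show ?thesis
  proof (rule ringI[OF ab mo])
    fix a b c assume a: "a \<in> carrier ?A" and b: "b \<in> carrier ?A" and c: "c \<in> carrier ?A"
    have [simp]: "x \<in> carrier G \<Longrightarrow> a x \<in> carrier k" "x \<in> carrier G \<Longrightarrow> b x \<in> carrier k"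
      "x \<in> carrier G \<Longrightarrow> c x \<in> carrier k" for x
      using a b c by (auto simp: group_algebra_def)
    show "(a \<oplus>\<^bsub>?A\<^esub> b) \<otimes>\<^bsub>?A\<^esub> c = a \<otimes>\<^bsub>?A\<^esub> c \<oplus>\<^bsub>?A\<^esub> b \<otimes>\<^bsub>?A\<^esub> c"
    proof
      fix x
      show "((a \<oplus>\<^bsub>?A\<^esub> b) \<otimes>\<^bsub>?A\<^esub> c) x = (a \<otimes>\<^bsub>?A\<^esub> c \<oplus>\<^bsub>?A\<^esub> b \<otimes>\<^bsub>?A\<^esub> c) x"
      proof (cases "x \<in> carrier G")
        case x: True
        have "((a \<oplus>\<^bsub>?A\<^esub> b) \<otimes>\<^bsub>?A\<^esub> c) x = (\<Oplus>\<^bsub>k\<^esub>y\<in>carrier G. a y \<otimes>\<^bsub>k\<^esub> c (inv\<^bsub>G\<^esub> y \<otimes>\<^bsub>G\<^esub> x) \<oplus>\<^bsub>k\<^esub> b y \<otimes>\<^bsub>k\<^esub> c (inv\<^bsub>G\<^esub> y \<otimes>\<^bsub>G\<^esub> x))"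
          using x by (auto simp: group_algebra_def k.l_distr simp del: k.finsum_addf intro!: k.finsum_cong')
        also have "\<dots> = (\<Oplus>\<^bsub>k\<^esub>y\<in>carrier G. a y \<otimes>\<^bsub>k\<^esub> c (inv\<^bsub>G\<^esub> y \<otimes>\<^bsub>G\<^esub> x)) \<oplus>\<^bsub>k\<^esub> (\<Oplus>\<^bsub>k\<^esub>y\<in>carrier G. b y \<otimes>\<^bsub>k\<^esub> c (inv\<^bsub>G\<^esub> y \<otimes>\<^bsub>G\<^esub> x))"
          using x by (intro k.finsum_addf) auto
        also have "\<dots> = (a \<otimes>\<^bsub>?A\<^esub> c \<oplus>\<^bsub>?A\<^esub> b \<otimes>\<^bsub>?A\<^esub> c) x"
          using x by (simp add: group_algebra_def)
        finally show ?thesis .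
      qed (simp add: group_algebra_def)
    qed
    show "c \<otimes>\<^bsub>?A\<^esub> (a \<oplus>\<^bsub>?A\<^esub> b) = c \<otimes>\<^bsub>?A\<^esub> a \<oplus>\<^bsub>?A\<^esub> c \<otimes>\<^bsub>?A\<^esub> b"
    proof
      fix x
      show "(c \<otimes>\<^bsub>?A\<^esub> (a \<oplus>\<^bsub>?A\<^esub> b)) x = (c \<otimes>\<^bsub>?A\<^esub> a \<oplus>\<^bsub>?A\<^esub> c \<otimes>\<^bsub>?A\<^esub> b) x"
      proof (cases "x \<in> carrier G")
        case x: True
        have "(c \<otimes>\<^bsub>?A\<^esub> (a \<oplus>\<^bsub>?A\<^esub> b)) x = (\<Oplus>\<^bsub>k\<^esub>y\<in>carrier G. c y \<otimes>\<^bsub>k\<^esub> a (inv\<^bsub>G\<^esub> y \<otimes>\<^bsub>G\<^esub> x) \<oplus>\<^bsub>k\<^esub> c y \<otimes>\<^bsub>k\<^esub> b (inv\<^bsub>G\<^esub> y \<otimes>\<^bsub>G\<^esub> x))"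
          using x by (auto simp: group_algebra_def k.r_distr simp del: k.finsum_addf intro!: k.finsum_cong')
        also have "\<dots> = (\<Oplus>\<^bsub>k\<^esub>y\<in>carrier G. c y \<otimes>\<^bsub>k\<^esub> a (inv\<^bsub>G\<^esub> y \<otimes>\<^bsub>G\<^esub> x)) \<oplus>\<^bsub>k\<^esub> (\<Oplus>\<^bsub>k\<^esub>y\<in>carrier G. c y \<otimes>\<^bsub>k\<^esub> b (inv\<^bsub>G\<^esub> y \<otimes>\<^bsub>G\<^esub> x))"
          using x by (intro k.finsum_addf) auto
        also have "\<dots> = (c \<otimes>\<^bsub>?A\<^esub> a \<oplus>\<^bsub>?A\<^esub> c \<otimes>\<^bsub>?A\<^esub> b) x"
          using x by (simp add: group_algebra_def)
        finally show ?thesis .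
      qed (simp add: group_algebra_def)
    qed
  qed
qed

lemma vectorspace_restrict_scalars:
  assumes k: "field k" and G: "group G" "finite (carrier G)" and M: "left_module (group_algebra k G) M"
  shows "vectorspace k (restrict_scalars k G M)"
proof -
  interpret k: field k by fact
  interpret G: group G by fact
  interpret M: left_module "group_algebra k G" M by fact
  let ?A = "group_algebra k G" and ?e = "group_algebra_of_scalar k G"
  have am: "abelian_monoid k" by unfold_locales
  have e: "c \<in> carrier k \<Longrightarrow> ?e c \<in> carrier ?A" for c
    by (auto simp: group_algebra_def group_algebra_of_scalar_def)
  have e1: "?e \<one>\<^bsub>k\<^esub> = \<one>\<^bsub>?A\<^esub>" by (simp add: group_algebra_def group_algebra_of_scalar_def)
  have ea: "?e (c \<oplus>\<^bsub>k\<^esub> d) = ?e c \<oplus>\<^bsub>?A\<^esub> ?e d" if "c \<in> carrier k" "d \<in> carrier k" for c d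
    using that by (auto simp: group_algebra_def group_algebra_of_scalar_def fun_eq_iff)
  have em: "?e (c \<otimes>\<^bsub>k\<^esub> d) = ?e c \<otimes>\<^bsub>?A\<^esub> ?e d" if cd: "c \<in> carrier k" "d \<in> carrier k" for c d
  proof
    fix x
    show "?e (c \<otimes>\<^bsub>k\<^esub> d) x = (?e c \<otimes>\<^bsub>?A\<^esub> ?e d) x"
    proof (cases "x \<in> carrier G")
      case x: True
      have "(?e c \<otimes>\<^bsub>?A\<^esub> ?e d) x = (\<Oplus>\<^bsub>k\<^esub>y\<in>carrier G. if y = \<one>\<^bsub>G\<^esub> then c \<otimes>\<^bsub>k\<^esub> ?e d (inv\<^bsub>G\<^esub> y \<otimes>\<^bsub>G\<^esub> x) else \<zero>\<^bsub>k\<^esub>)"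
        using x cd by (auto simp: group_algebra_def group_algebra_of_scalar_def intro!: k.finsum_cong')
      also have "\<dots> = ?e (c \<otimes>\<^bsub>k\<^esub> d) x"
        using x cd finsum_delta[OF am G(2), of "\<one>\<^bsub>G\<^esub>" "\<lambda>y. c \<otimes>\<^bsub>k\<^esub> ?e d (inv\<^bsub>G\<^esub> y \<otimes>\<^bsub>G\<^esub> x)"]
        by (auto simp: group_algebra_of_scalar_def)
      finally show ?thesis ..
    qed (auto simp: group_algebra_def group_algebra_of_scalar_def)
  qed
  have ag: "abelian_group (restrict_scalars k G M)"
  proof (rule abelian_groupI)
    fix x assume "x \<in> carrier (restrict_scalars k G M)"
    then show "\<exists>y\<in>carrier (restrict_scalars k G M).
        y \<oplus>\<^bsub>restrict_scalars k G M\<^esub> x = \<zero>\<^bsub>restrict_scalars k G M\<^esub>"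
      by (intro bexI[of _ "\<ominus>\<^bsub>M\<^esub> x"]) (simp_all add: restrict_scalars_def M.M.l_neg)
  qed (simp_all add: restrict_scalars_def M.M.a_ac)
  have "module k (restrict_scalars k G M)"
    by (rule moduleI[OF k.is_cring ag])
       (auto simp: restrict_scalars_def e ea em e1 M.smult_closed M.smult_l_distr M.smult_r_distr M.smult_assoc M.smult_one)
  then show ?thesis by (simp add: vectorspace_def k)
qed



subsection \<open>Submodules, direct summands and direct sums\<close>

definition direct_summand ::
    "('r, 'a) ring_scheme \<Rightarrow> 'm set \<Rightarrow> ('r, 'm, 'c) module_scheme \<Rightarrow> bool" where
  "direct_summand R T X \<longleftrightarrow> Module.submodule T R X \<and>
    (\<exists>U. Module.submodule U R X \<and> T \<inter> U = {\<zero>\<^bsub>X\<^esub>} \<and> T <+>\<^bsub>X\<^esub> U = carrier X)"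

definition indecomposable ::
    "('r, 'a) ring_scheme \<Rightarrow> ('r, 'm, 'c) module_scheme \<Rightarrow> bool" where
  "indecomposable R M \<longleftrightarrow> carrier M \<noteq> {\<zero>\<^bsub>M\<^esub>} \<and>
    (\<forall>T U. Module.submodule T R M \<longrightarrow> Module.submodule U R M \<longrightarrow>
      T \<inter> U = {\<zero>\<^bsub>M\<^esub>} \<longrightarrow> T <+>\<^bsub>M\<^esub> U = carrier M \<longrightarrow> T = {\<zero>\<^bsub>M\<^esub>} \<or> U = {\<zero>\<^bsub>M\<^esub>})"

definition internal_direct_sum ::
    "('r, 'a) ring_scheme \<Rightarrow> ('r, 'm, 'c) module_scheme \<Rightarrow> 'i set \<Rightarrow> ('i \<Rightarrow> 'm set) \<Rightarrow> bool" where
  "internal_direct_sum R X I T \<longleftrightarrow> (\<forall>i\<in>I. Module.submodule (T i) R X) \<and>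
    (\<forall>x\<in>carrier X. \<exists>!c. c \<in> (\<Pi>\<^sub>E i\<in>I. T i) \<and> finite {i\<in>I. c i \<noteq> \<zero>\<^bsub>X\<^esub>} \<and>
      x = (\<Oplus>\<^bsub>X\<^esub>i\<in>{i\<in>I. c i \<noteq> \<zero>\<^bsub>X\<^esub>}. c i))"

text \<open>
  \<open>copower M I\<close> is the direct sum of copies of \<open>M\<close> indexed by \<open>I\<close>. The direct sum of \<open>r\<close>
  copies, for a cardinal \<open>r\<close> (a relation with \<open>Card_order r\<close>), is \<open>copower M (Field r)\<close>.
  The multiplicative fields of a module record carry no information.
\<close>

definition copower ::
    "('r, 'm, 'c) module_scheme \<Rightarrow> 'i set \<Rightarrow> ('r, 'i \<Rightarrow> 'm) module" where
  "copower M I =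
    \<lparr>carrier = {f \<in> I \<rightarrow>\<^sub>E carrier M. finite {i\<in>I. f i \<noteq> \<zero>\<^bsub>M\<^esub>}},
     mult = (\<lambda>f g. \<lambda>i\<in>I. \<zero>\<^bsub>M\<^esub>),
     one = (\<lambda>i\<in>I. \<zero>\<^bsub>M\<^esub>),
     zero = (\<lambda>i\<in>I. \<zero>\<^bsub>M\<^esub>),
     add = (\<lambda>f g. \<lambda>i\<in>I. f i \<oplus>\<^bsub>M\<^esub> g i),
     smult = (\<lambda>a f. \<lambda>i\<in>I. a \<odot>\<^bsub>M\<^esub> f i)\<rparr>"

definition iso_to_summand ::
    "('r, 'a) ring_scheme \<Rightarrow> ('r, 'n, 'c) module_scheme \<Rightarrow> ('r, 'm, 'd) module_scheme \<Rightarrow> bool" where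
  "iso_to_summand R N X \<longleftrightarrow> (\<exists>T. direct_summand R T X \<and>
    (\<exists>\<phi>\<in>module_hom R N (X\<lparr>carrier := T\<rparr>). bij_betw \<phi> (carrier N) T))"

definition copies_in_summand ::
    "('r, 'a) ring_scheme \<Rightarrow> ('r, 'm, 'c) module_scheme \<Rightarrow> ('r, 'n, 'd) module_scheme \<Rightarrow>
      'i rel \<Rightarrow> bool" where
  "copies_in_summand R M X r \<longleftrightarrow> iso_to_summand R (copower M (Field r)) X"


subsection \<open>Homomorphisms and the endomorphism ring\<close>

text \<open>
  Homomorphisms are taken extensional (equal to \<open>undefined\<close> outside the carrier), so that
  equal maps are equal functions.
\<close>

definition hom_group ::
    "('r, 'a) ring_scheme \<Rightarrow> ('r, 'm, 'c) module_scheme \<Rightarrow> ('r, 'n, 'd) module_scheme \<Rightarrow>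
      ('m \<Rightarrow> 'n) ring" where
  "hom_group R M X =
    \<lparr>carrier = module_hom R M X \<inter> extensional (carrier M),
     mult = (\<lambda>f g. \<lambda>x\<in>carrier M. \<zero>\<^bsub>X\<^esub>),
     one = (\<lambda>x\<in>carrier M. \<zero>\<^bsub>X\<^esub>),
     zero = (\<lambda>x\<in>carrier M. \<zero>\<^bsub>X\<^esub>),
     add = (\<lambda>f g. \<lambda>x\<in>carrier M. f x \<oplus>\<^bsub>X\<^esub> g x)\<rparr>"

definition endo_ring ::
    "('r, 'a) ring_scheme \<Rightarrow> ('r, 'm, 'c) module_scheme \<Rightarrow> ('m \<Rightarrow> 'm) ring" where
  "endo_ring R M =
    (hom_group R M M)\<lparr>mult := compose (carrier M), one := (\<lambda>x\<in>carrier M. x)\<rparr>"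


subsection \<open>The Jacobson radical\<close>

definition left_ideal :: "'r set \<Rightarrow> ('r, 'a) ring_scheme \<Rightarrow> bool" where
  "left_ideal I R \<longleftrightarrow> additive_subgroup I R \<and>
    (\<forall>a\<in>carrier R. \<forall>x\<in>I. a \<otimes>\<^bsub>R\<^esub> x \<in> I)"

definition maximal_left_ideal :: "'r set \<Rightarrow> ('r, 'a) ring_scheme \<Rightarrow> bool" where
  "maximal_left_ideal I R \<longleftrightarrow> left_ideal I R \<and> I \<noteq> carrier R \<and>
    (\<forall>J. left_ideal J R \<longrightarrow> I \<subseteq> J \<longrightarrow> J = I \<or> J = carrier R)"

definition jacobson_radical :: "('r, 'a) ring_scheme \<Rightarrow> 'r set" where
  "jacobson_radical R = {x \<in> carrier R. \<forall>I. maximal_left_ideal I R \<longrightarrow> x \<in> I}"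

definition residue_ring_End ::
    "('r, 'a) ring_scheme \<Rightarrow> ('r, 'm, 'c) module_scheme \<Rightarrow> ('m \<Rightarrow> 'm) set ring" where
  "residue_ring_End R M = endo_ring R M Quot jacobson_radical (endo_ring R M)"


subsection \<open>Homomorphisms modulo those that are not split injective\<close>

definition non_split_homs ::
    "('r, 'a) ring_scheme \<Rightarrow> ('r, 'm, 'c) module_scheme \<Rightarrow> ('r, 'n, 'd) module_scheme \<Rightarrow>
      ('m \<Rightarrow> 'n) set" where
  "non_split_homs R M X = {f \<in> carrier (hom_group R M X).
    \<not> (\<exists>g\<in>carrier (hom_group R X M). compose (carrier M) g f = (\<lambda>x\<in>carrier M. x))}"

text \<open>
  The quotient \<open>Hom(M, X) / J(M, X)\<close> as a \<^emph>\<open>right\<close> module over \<open>End(M) / rad\<close>: the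
  field \<open>smult\<close> takes the scalar first, so \<open>E \<odot> F\<close> stands for \<open>F \<cdot> E\<close>, the class of
  \<open>f \<circ> e\<close> for representatives \<open>f \<in> F\<close> and \<open>e \<in> E\<close> (compare \<open>rcoset_mult\<close>).
\<close>

definition split_hom ::
    "('r, 'a) ring_scheme \<Rightarrow> ('r, 'm, 'c) module_scheme \<Rightarrow> ('r, 'n, 'd) module_scheme \<Rightarrow>
      (('m \<Rightarrow> 'm) set, ('m \<Rightarrow> 'n) set) module" where
  "split_hom R M X =
    (let H = hom_group R M X; J = non_split_homs R M X in
    \<lparr>carrier = a_rcosets\<^bsub>H\<^esub> J,
     mult = (\<lambda>F F'. J),
     one = J,
     zero = J,
     add = set_add H,
     smult = (\<lambda>E F. \<Union>f\<in>F. \<Union>e\<in>E. J +>\<^bsub>H\<^esub> compose (carrier M) f e)\<rparr>)"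

text \<open>The degree \<open>i\<close> part of \<open>split_hom R M X\<close> when \<open>X\<close> is graded with components \<open>T i\<close>.\<close>

definition split_hom_component ::
    "('r, 'a) ring_scheme \<Rightarrow> ('r, 'm, 'c) module_scheme \<Rightarrow> ('r, 'n, 'd) module_scheme \<Rightarrow>
      ('i \<Rightarrow> 'n set) \<Rightarrow> 'i \<Rightarrow> (('m \<Rightarrow> 'm) set, ('m \<Rightarrow> 'n) set) module" where
  "split_hom_component R M X T i = split_hom R M (X\<lparr>carrier := T i\<rparr>)"


subsection \<open>Dimension over a division ring\<close>

text \<open>
  Bases of a right module \<open>V\<close> over a possibly noncommutative ring \<open>D\<close>, where
  \<open>c \<odot>\<^bsub>V\<^esub> v\<close> stands for \<open>v \<cdot> c\<close> as above.
\<close>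

definition right_basis ::
    "('d, 'a) ring_scheme \<Rightarrow> ('d, 'v, 'c) module_scheme \<Rightarrow> 'v set \<Rightarrow> bool" where
  "right_basis D V B \<longleftrightarrow> B \<subseteq> carrier V \<and>
    (\<forall>A c. finite A \<longrightarrow> A \<subseteq> B \<longrightarrow> c \<in> A \<rightarrow> carrier D \<longrightarrow>
      (\<Oplus>\<^bsub>V\<^esub>v\<in>A. c v \<odot>\<^bsub>V\<^esub> v) = \<zero>\<^bsub>V\<^esub> \<longrightarrow> (\<forall>v\<in>A. c v = \<zero>\<^bsub>D\<^esub>)) \<and>
    (\<forall>x\<in>carrier V. \<exists>A c. finite A \<and> A \<subseteq> B \<and> c \<in> A \<rightarrow> carrier D \<and>
      x = (\<Oplus>\<^bsub>V\<^esub>v\<in>A. c v \<odot>\<^bsub>V\<^esub> v))"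

text \<open>
  Over a division ring a basis exists and any two bases are equipotent, so up to \<open>=o\<close> the
  cardinal below does not depend on the choice.
\<close>

definition right_dim ::
    "('d, 'a) ring_scheme \<Rightarrow> ('d, 'v, 'c) module_scheme \<Rightarrow> 'v rel" where
  "right_dim D V = |SOME B. right_basis D V B|"

end

theory Submission
  imports Defs
begin

text \<open>
  Write \<open>E\<close> for the endomorphism ring of \<open>M\<close>, \<open>D\<close> for \<open>E\<close> modulo its radical and \<open>V\<close> for
  \<open>Hom(M, S)\<close> modulo the subgroup \<open>J\<close> of homomorphisms that are not split injective.

  By Fitting's lemma (\<open>indecomposable_endo_unit_or_nilpotent\<close>) every element of \<open>E\<close> is a unit or
  nilpotent. In such a ring the non-units form an ideal, which is the radical, so \<open>D\<close> is a division
  ring. A homomorphism \<open>f\<close> lies in \<open>J\<close> if and only if \<open>g \<circ> f\<close> is a non-unit for every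
  \<open>g : S \<rightarrow> M\<close> (\<open>non_split_iff\<close>), which makes \<open>V\<close> a right vector space over \<open>D\<close>. Let \<open>B\<close> be a
  basis of \<open>V\<close> and choose a representative \<open>f b\<close> of each \<open>b\<close> in \<open>B\<close>.

  Every finite subfamily of the \<open>f b\<close> has a common retraction, by an orthogonalisation argument
  (\<open>independent_finite_retraction\<close>). Hence the sum \<open>\<phi>\<close> of all the \<open>f b\<close>, from the direct sum of
  copies of \<open>M\<close> indexed by \<open>B\<close> to \<open>S\<close>, splits on every finite subsum. For infinite \<open>B\<close> these
  retractions need not fit together, and this is where finite dimension enters: \<open>M\<close> is
  \<open>\<Sigma>\<close>-pure-injective. Concretely, a partial inverse of \<open>\<phi>\<close> is enlarged one element of \<open>S\<close> at a time,
  keeping it extendable over every finite dimensional submodule of \<open>S\<close>. Each step succeeds because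
  the possible corrections of the value at the new element form a subspace of \<open>M\<close> that shrinks as the
  finite dimensional submodule grows, and so becomes stationary (\<open>partial_hom_extend\<close>). Zorn's lemma
  gives a retraction of \<open>\<phi>\<close> (\<open>locally_split_imp_split\<close>).

  Conversely, inclusions and projections of a summand isomorphic to a direct sum of copies of \<open>M\<close> give
  homomorphisms \<open>f i : M \<rightarrow> S\<close> and \<open>h i : S \<rightarrow> M\<close> with \<open>h i \<circ> f j\<close> equal to \<open>1\<close> or \<open>0\<close>. The classes \<open>u\<close>
  for which \<open>h i \<circ> u\<close> is a non-unit form a subspace of \<open>V\<close> containing every \<open>f j\<close> but \<open>f i\<close>, so the
  classes of the \<open>f i\<close> are distinct and independent (\<open>copies_le_basis\<close>). The Steinitz exchange lemma,
  for sets of any cardinality (\<open>indep_card_le_spanning\<close>), bounds the number of copies by \<open>B\<close>.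

  In the graded case each component is a submodule, to which the ungraded statement applies.
\<close>

section \<open>Independence and cardinality in pregeometries\<close>

text \<open>
  Linear span over a division ring is the only instance used below: over \<open>k\<close> for dimension counts,
  and over the opposite ring of \<open>D\<close>.
\<close>

locale pregeometry =
  fixes V :: "'a set" and cl :: "'a set \<Rightarrow> 'a set"
  assumes cl_superset: "A \<subseteq> V \<Longrightarrow> A \<subseteq> cl A"
    and cl_closed: "A \<subseteq> V \<Longrightarrow> cl A \<subseteq> V"
    and cl_mono: "A \<subseteq> B \<Longrightarrow> B \<subseteq> V \<Longrightarrow> cl A \<subseteq> cl B"
    and cl_idem: "A \<subseteq> V \<Longrightarrow> cl (cl A) = cl A"
    and cl_finitary: "A \<subseteq> V \<Longrightarrow> x \<in> cl A \<Longrightarrow> \<exists>F. finite F \<and> F \<subseteq> A \<and> x \<in> cl F"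
    and cl_exchange:
      "A \<subseteq> V \<Longrightarrow> y \<in> V \<Longrightarrow> x \<in> cl (insert y A) \<Longrightarrow> x \<notin> cl A \<Longrightarrow> y \<in> cl (insert x A)"
begin

definition indep :: "'a set \<Rightarrow> bool" where
  "indep C \<longleftrightarrow> C \<subseteq> V \<and> (\<forall>c\<in>C. c \<notin> cl (C - {c}))"

lemma indep_empty: "indep {}"
  by (simp add: indep_def)

lemma indep_subset_carrier: "indep C \<Longrightarrow> C \<subseteq> V"
  by (simp add: indep_def)

lemma indep_subset:
  assumes "indep C" "C' \<subseteq> C"
  shows "indep C'"
  unfolding indep_def
proof (intro conjI ballI)
  show "C' \<subseteq> V" using assms by (auto simp: indep_def)
  fix c assume "c \<in> C'"
  moreover have "cl (C' - {c}) \<subseteq> cl (C - {c})"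
    using assms by (intro cl_mono) (auto simp: indep_def)
  ultimately show "c \<notin> cl (C' - {c})" using assms by (auto simp: indep_def)
qed

lemma cl_least: "A \<subseteq> cl B \<Longrightarrow> B \<subseteq> V \<Longrightarrow> cl A \<subseteq> cl B"
  using cl_mono[of A "cl B"] cl_idem[of B] cl_closed[of B] by auto

lemma indep_insert:
  assumes C: "indep C" and x: "x \<in> V" "x \<notin> cl C"
  shows "indep (insert x C)"
  unfolding indep_def
proof (intro conjI ballI)
  have CV: "C \<subseteq> V" using C by (simp add: indep_def)
  have xC: "x \<notin> C" using x cl_superset[OF CV] by auto
  show "insert x C \<subseteq> V" using CV x by simp
  fix c assume c: "c \<in> insert x C"
  show "c \<notin> cl (insert x C - {c})"
  proof (cases "c = x")
    case True
    then show ?thesis using x xC by simp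
  next
    case False
    with c have cC: "c \<in> C" by simp
    show ?thesis
    proof
      assume "c \<in> cl (insert x C - {c})"
      moreover have "insert x C - {c} = insert x (C - {c})" using False by auto
      ultimately have "x \<in> cl (insert c (C - {c}))"
        using cl_exchange[of "C - {c}" x c] CV x C cC by (auto simp: indep_def)
      then show False using x cC by (simp add: insert_absorb)
    qed
  qed
qed

lemma indep_finite_character:
  assumes "\<And>F. finite F \<Longrightarrow> F \<subseteq> C \<Longrightarrow> indep F"
  shows "indep C"
  unfolding indep_def
proof (intro conjI ballI)
  show CV: "C \<subseteq> V"
  proof
    fix c assume "c \<in> C"
    then show "c \<in> V" using assms[of "{c}"] by (simp add: indep_def)
  qed
  fix c assume c: "c \<in> C"
  show "c \<notin> cl (C - {c})"
  proof
    assume "c \<in> cl (C - {c})"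
    then obtain F where F: "finite F" "F \<subseteq> C - {c}" "c \<in> cl F"
      using cl_finitary[of "C - {c}" c] CV by auto
    then have "indep (insert c F)" using c by (intro assms) auto
    moreover have "insert c F - {c} = F" using F by auto
    ultimately show False using F by (auto simp: indep_def)
  qed
qed

lemma indep_chain_Union:
  assumes "subset.chain {C. indep C} \<C>" "\<C> \<noteq> {}"
  shows "indep (\<Union>\<C>)"
proof (rule indep_finite_character)
  fix F assume F: "finite F" "F \<subseteq> \<Union>\<C>"
  then obtain C where C: "C \<in> \<C>" "F \<subseteq> C"
    using finite_subset_Union_chain[OF F assms(2,1)] by auto
  have "indep C" using assms(1) C(1) by (auto simp: subset.chain_def)
  then show "indep F" using C(2) by (rule indep_subset)
qed

text \<open>
  An independent subset of \<open>P\<close> that is maximal among those containing \<open>C\<close> spans \<open>P\<close>, since any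
  element outside its closure could be added to it.
\<close>

lemma indep_extend_maximal:
  assumes C: "indep C" "C \<subseteq> P" and P: "P \<subseteq> V"
  shows "\<exists>B. indep B \<and> C \<subseteq> B \<and> B \<subseteq> P \<and> P \<subseteq> cl B"
proof -
  let ?A = "{B. indep B \<and> C \<subseteq> B \<and> B \<subseteq> P}"
  have "\<exists>B\<in>?A. \<forall>X\<in>?A. B \<subseteq> X \<longrightarrow> X = B"
  proof (rule subset_Zorn_nonempty)
    show "?A \<noteq> {}" using C by auto
    fix \<C> assume ne: "\<C> \<noteq> {}" and ch: "subset.chain ?A \<C>"
    then have "subset.chain {C. indep C} \<C>" by (auto simp: subset.chain_def)
    then have "indep (\<Union>\<C>)" using ne by (rule indep_chain_Union)
    moreover have "C \<subseteq> \<Union>\<C>" using ne ch unfolding subset.chain_def by blast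
    moreover have "\<Union>\<C> \<subseteq> P" using ch unfolding subset.chain_def by blast
    ultimately show "\<Union>\<C> \<in> ?A" by simp
  qed
  then obtain B where "B \<in> ?A" and "\<forall>X\<in>?A. B \<subseteq> X \<longrightarrow> X = B" by (elim bexE)
  then have B: "indep B" "C \<subseteq> B" "B \<subseteq> P"
    and max: "\<And>X. indep X \<Longrightarrow> C \<subseteq> X \<Longrightarrow> X \<subseteq> P \<Longrightarrow> B \<subseteq> X \<Longrightarrow> X = B" by simp_all
  have "P \<subseteq> cl B"
  proof
    fix x assume x: "x \<in> P"
    show "x \<in> cl B"
    proof (rule ccontr)
      assume nx: "x \<notin> cl B"
      then have "insert x B = B"
        using B x P by (intro max) (auto intro!: indep_insert)
      then show False using nx cl_superset[of B] B P by auto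
    qed
  qed
  with B show ?thesis by (intro exI[of _ B] conjI)
qed

lemma basis_exists: obtains B where "indep B" "cl B = V"
proof -
  obtain B where B: "indep B" "B \<subseteq> V" "V \<subseteq> cl B"
    using indep_extend_maximal[OF indep_empty empty_subsetI order_refl] by auto
  have "cl B = V" using B(3) cl_closed[OF B(2)] by (rule equalityI[rotated])
  with B(1) show ?thesis by (rule that)
qed

text \<open>
  The graph of a partial injection \<open>h\<close> from \<open>C\<close> to \<open>B\<close> such that \<open>C\<close> stays independent when each
  \<open>x\<close> in the domain is replaced by \<open>h x\<close>, and no \<open>h x\<close> is an element of \<open>C\<close> that is still in place.
  Graphs, unlike functions, have unions along chains.
\<close>

definition exchange_graph :: "'a set \<Rightarrow> 'a set \<Rightarrow> ('a \<times> 'a) set \<Rightarrow> bool" where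
  "exchange_graph C B h \<longleftrightarrow> h \<subseteq> C \<times> B \<and> single_valued h \<and> single_valued (h\<inverse>) \<and>
    Range h \<inter> (C - Domain h) = {} \<and> indep (Range h \<union> (C - Domain h))"

lemma exchange_graph_Union:
  assumes ch: "subset.chain {h. exchange_graph C B h} \<H>" and ne: "\<H> \<noteq> {}"
  shows "exchange_graph C B (\<Union>\<H>)"
proof -
  have mem: "exchange_graph C B h" if "h \<in> \<H>" for h
    using ch that by (auto simp: subset.chain_def)
  have two: "\<exists>h\<in>\<H>. p \<in> h \<and> q \<in> h" if "p \<in> \<Union>\<H>" "q \<in> \<Union>\<H>" for p q
    using finite_subset_Union_chain[of "{p, q}" \<H>, OF _ _ ne ch] that by auto
  have sub: "\<Union>\<H> \<subseteq> C \<times> B" using mem unfolding exchange_graph_def by blast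
  have sv: "single_valued (\<Union>\<H>)" "single_valued ((\<Union>\<H>)\<inverse>)"
    using two mem unfolding exchange_graph_def single_valued_def converse_iff by meson+
  have disj: "Range (\<Union>\<H>) \<inter> (C - Domain (\<Union>\<H>)) = {}"
  proof -
    have "y \<notin> C - Domain (\<Union>\<H>)" if "(x, y) \<in> h" "h \<in> \<H>" for x y h
      using mem[OF that(2)] that unfolding exchange_graph_def by blast
    then show ?thesis by blast
  qed
  have "indep (Range (\<Union>\<H>) \<union> (C - Domain (\<Union>\<H>)))"
  proof (rule indep_finite_character)
    fix F assume F: "finite F" "F \<subseteq> Range (\<Union>\<H>) \<union> (C - Domain (\<Union>\<H>))"
    have "\<exists>h\<in>\<H>. F \<inter> Range (\<Union>\<H>) \<subseteq> Range h"
    proof -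
      have "\<forall>y\<in>F \<inter> Range (\<Union>\<H>). \<exists>x. (x, y) \<in> \<Union>\<H>" by auto
      then obtain g where g: "\<forall>y\<in>F \<inter> Range (\<Union>\<H>). (g y, y) \<in> \<Union>\<H>" by metis
      then have "(\<lambda>y. (g y, y)) ` (F \<inter> Range (\<Union>\<H>)) \<subseteq> \<Union>\<H>" by blast
      then obtain h where "h \<in> \<H>" "(\<lambda>y. (g y, y)) ` (F \<inter> Range (\<Union>\<H>)) \<subseteq> h"
        using finite_subset_Union_chain[OF finite_imageI[OF finite_Int] _ ne ch] F(1) by metis
      then have "\<forall>y\<in>F \<inter> Range (\<Union>\<H>). (g y, y) \<in> h" by (simp only: image_subset_iff)
      then have "F \<inter> Range (\<Union>\<H>) \<subseteq> Range h" by (meson RangeI subsetI)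
      with \<open>h \<in> \<H>\<close> show ?thesis by blast
    qed
    then obtain h where h: "h \<in> \<H>" "F \<inter> Range (\<Union>\<H>) \<subseteq> Range h" by auto
    then have "F \<subseteq> Range h \<union> (C - Domain h)" using F by blast
    then show "indep F" using mem[OF h(1)] indep_subset by (auto simp: exchange_graph_def)
  qed
  with sub sv disj show ?thesis by (simp add: exchange_graph_def)
qed

text \<open>
  The Steinitz exchange lemma without any finiteness. A maximal partial exchange is defined on all of
  \<open>C\<close>: if \<open>x\<close> were left, then the rest of the exchanged set would not span \<open>x\<close>, so it could not span
  \<open>B\<close> either, and some \<open>b\<close> in \<open>B\<close> could take the place of \<open>x\<close>.
\<close>

lemma indep_card_le_spanning:
  assumes C: "indep C" and B: "B \<subseteq> V" "C \<subseteq> cl B"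
  shows "|C| \<le>o |B|"
proof -
  let ?A = "{h. exchange_graph C B h}"
  have "\<exists>h\<in>?A. \<forall>X\<in>?A. h \<subseteq> X \<longrightarrow> X = h"
  proof (rule subset_Zorn_nonempty)
    have "exchange_graph C B {}" using C by (simp add: exchange_graph_def)
    then show "?A \<noteq> {}" by blast
  qed (simp add: exchange_graph_Union)
  then obtain h where h: "exchange_graph C B h"
    and max: "\<And>X. exchange_graph C B X \<Longrightarrow> h \<subseteq> X \<Longrightarrow> X = h" by auto
  have "Domain h = C"
  proof (rule ccontr)
    assume "Domain h \<noteq> C"
    then obtain x where x: "x \<in> C" "x \<notin> Domain h" using h by (auto simp: exchange_graph_def)
    let ?D = "Range h \<union> (C - Domain h)" and ?D' = "Range h \<union> (C - Domain h - {x})"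
    have iD: "indep ?D" using h by (simp add: exchange_graph_def)
    have "?D - {x} = ?D'" using h x by (auto simp: exchange_graph_def)
    moreover have "x \<notin> cl (?D - {x})" using iD x by (auto simp: indep_def)
    ultimately have xD': "x \<notin> cl ?D'" by simp
    have D': "?D' \<subseteq> V" "indep ?D'"
      using indep_subset[OF iD, of ?D'] by (auto simp: indep_def)
    have "\<not> B \<subseteq> cl ?D'"
    proof
      assume "B \<subseteq> cl ?D'"
      then have "cl B \<subseteq> cl ?D'" using D'(1) by (rule cl_least)
      then show False using xD' x B by auto
    qed
    then obtain b where b: "b \<in> B" "b \<notin> cl ?D'" by auto
    then have bD': "b \<notin> ?D'" using cl_superset[OF D'(1)] by auto
    have "indep (insert b ?D')" using D'(2) b B by (intro indep_insert) auto
    moreover have "Range (insert (x, b) h) \<union> (C - Domain (insert (x, b) h)) = insert b ?D'"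
      by auto
    ultimately have "exchange_graph C B (insert (x, b) h)"
      using h x b(1) bD' by (simp add: exchange_graph_def single_valued_def) blast
    then have "insert (x, b) h = h" by (intro max) auto
    then show False using x by auto
  qed
  then have "\<forall>x\<in>C. \<exists>y. (x, y) \<in> h" by auto
  then obtain f where f: "\<forall>x\<in>C. (x, f x) \<in> h" by metis
  have "inj_on f C" "f ` C \<subseteq> B"
  proof -
    show "inj_on f C"
    proof (rule inj_onI)
      fix x y assume "x \<in> C" "y \<in> C" "f x = f y"
      then have "(f x, x) \<in> h\<inverse>" "(f x, y) \<in> h\<inverse>" using f by auto
      then show "x = y" using h unfolding exchange_graph_def by (meson single_valuedD)
    qed
    show "f ` C \<subseteq> B" using f h by (auto simp: exchange_graph_def)
  qed
  then show ?thesis using card_of_ordLeq by blast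
qed

lemma indep_finite:
  assumes "indep C" "T \<subseteq> V" "finite T" "C \<subseteq> cl T"
  shows "finite C" "card C \<le> card T"
proof -
  have le: "|C| \<le>o |T|" using assms by (intro indep_card_le_spanning)
  then show "finite C" using assms(3) card_of_ordLeq_finite by blast
  obtain f where "inj_on f C" "f ` C \<subseteq> T" using le card_of_ordLeq by metis
  then show "card C \<le> card T" using assms(3) by (intro card_inj_on_le)
qed

text \<open>
  The noetherian property of finite dimensional spaces: a maximal independent subset of \<open>P\<close> is
  finite by the exchange lemma.
\<close>

lemma finite_subset_spans:
  assumes "T \<subseteq> V" "finite T" "P \<subseteq> cl T"
  obtains F where "finite F" "F \<subseteq> P" "P \<subseteq> cl F"
proof -
  have PV: "P \<subseteq> V" using assms cl_closed by blast
  obtain F where F: "indep F" "F \<subseteq> P" "P \<subseteq> cl F"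
    using indep_extend_maximal[OF indep_empty empty_subsetI PV] by auto
  have "finite F" using F(1) assms(1,2) by (rule indep_finite(1)) (rule order_trans[OF F(2) assms(3)])
  from this F(2,3) show ?thesis by (rule that)
qed

text \<open>
  The rank of \<open>U\<close> is the size of a maximal independent subset. It is strictly monotone on closed sets
  because such a subset extends to a maximal one of any larger set.
\<close>

lemma rank_function:
  assumes T: "T \<subseteq> V" "finite T"
  shows "\<exists>\<rho> :: 'a set \<Rightarrow> nat. \<forall>U W. cl U = U \<longrightarrow> U \<subseteq> W \<longrightarrow> W \<subseteq> cl T \<longrightarrow>
    \<rho> U \<le> \<rho> W \<and> (\<rho> U = \<rho> W \<longrightarrow> U = W)"
proof -
  define b where "b U = (SOME B. indep B \<and> B \<subseteq> U \<and> U \<subseteq> cl B)" for U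
  have b: "indep (b U)" "b U \<subseteq> U" "U \<subseteq> cl (b U)" if "U \<subseteq> cl T" for U
  proof -
    have "U \<subseteq> V" using that T cl_closed by blast
    then have "\<exists>B. indep B \<and> B \<subseteq> U \<and> U \<subseteq> cl B"
      using indep_extend_maximal[OF indep_empty empty_subsetI] by auto
    from someI_ex[OF this] show "indep (b U)" "b U \<subseteq> U" "U \<subseteq> cl (b U)" by (auto simp: b_def)
  qed
  have fin: "finite (b U)" if "U \<subseteq> cl T" for U
    by (rule indep_finite(1)[OF b(1)[OF that] T order_trans[OF b(2)[OF that] that]])
  have key: "card (b U) \<le> card (b W) \<and> (card (b U) = card (b W) \<longrightarrow> U = W)"
    if U: "cl U = U" "U \<subseteq> W" and W: "W \<subseteq> cl T" for U W
  proof -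
    have UT: "U \<subseteq> cl T" and WV: "W \<subseteq> V" using U W cl_closed[OF T(1)] by auto
    obtain B where B: "indep B" "b U \<subseteq> B" "B \<subseteq> W" "W \<subseteq> cl B"
      using indep_extend_maximal[OF b(1)[OF UT] order_trans[OF b(2)[OF UT] U(2)] WV] by metis
    have "b W \<subseteq> V" using b(2)[OF W] WV by (rule order_trans)
    moreover have "B \<subseteq> cl (b W)" using B(3) b(3)[OF W] by (rule order_trans)
    ultimately have BW: "finite B" "card B \<le> card (b W)"
      using indep_finite[OF B(1) _ fin[OF W]] by metis+
    have le: "card (b U) \<le> card B" using BW(1) B(2) by (rule card_mono)
    moreover have "U = W" if "card (b U) = card (b W)"
    proof -
      have "b U = B" using BW B(2) le that by (intro card_subset_eq) auto
      then have "W \<subseteq> cl (b U)" using B(4) by simp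
      also have "cl (b U) \<subseteq> cl U" using b(2)[OF UT] U WV by (intro cl_mono) auto
      finally show "U = W" using U by auto
    qed
    ultimately show ?thesis using BW by auto
  qed
  show ?thesis
    by (intro exI[of _ "\<lambda>U. card (b U)"] allI impI key)
qed

end

section \<open>Linear span over division rings\<close>

locale left_vector_space = left_module D V
  for D :: "('d, 'a) ring_scheme" and V :: "('d, 'v, 'c) module_scheme" +
  assumes one_not_zero: "\<one>\<^bsub>D\<^esub> \<noteq> \<zero>\<^bsub>D\<^esub>"
    and left_inverse: "\<lbrakk>c \<in> carrier D; c \<noteq> \<zero>\<^bsub>D\<^esub>\<rbrakk> \<Longrightarrow> \<exists>d\<in>carrier D. d \<otimes>\<^bsub>D\<^esub> c = \<one>\<^bsub>D\<^esub>"

context left_module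
begin

lemma smult_zero_left [simp]: "x \<in> carrier M \<Longrightarrow> \<zero>\<^bsub>R\<^esub> \<odot>\<^bsub>M\<^esub> x = \<zero>\<^bsub>M\<^esub>"
  using smult_l_distr[of "\<zero>\<^bsub>R\<^esub>" "\<zero>\<^bsub>R\<^esub>" x] smult_closed[of "\<zero>\<^bsub>R\<^esub>" x] by simp

lemma smult_zero_right [simp]: "a \<in> carrier R \<Longrightarrow> a \<odot>\<^bsub>M\<^esub> \<zero>\<^bsub>M\<^esub> = \<zero>\<^bsub>M\<^esub>"
  using smult_r_distr[of a "\<zero>\<^bsub>M\<^esub>" "\<zero>\<^bsub>M\<^esub>"] smult_closed[of a "\<zero>\<^bsub>M\<^esub>"] by simp

lemma smult_minus_right:
  assumes "a \<in> carrier R" "x \<in> carrier M"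
  shows "a \<odot>\<^bsub>M\<^esub> (\<ominus>\<^bsub>M\<^esub> x) = \<ominus>\<^bsub>M\<^esub> (a \<odot>\<^bsub>M\<^esub> x)"
proof (rule M.minus_equality[symmetric])
  show "a \<odot>\<^bsub>M\<^esub> (\<ominus>\<^bsub>M\<^esub> x) \<oplus>\<^bsub>M\<^esub> a \<odot>\<^bsub>M\<^esub> x = \<zero>\<^bsub>M\<^esub>"
    using assms smult_r_distr[of a "\<ominus>\<^bsub>M\<^esub> x" x] by (simp add: M.l_neg)
qed (use assms in \<open>auto intro: smult_closed\<close>)

lemma minus_one_closed: "\<ominus>\<^bsub>R\<^esub> \<one>\<^bsub>R\<^esub> \<in> carrier R"
  by simp

lemma smult_minus_one:
  "x \<in> carrier M \<Longrightarrow> (\<ominus>\<^bsub>R\<^esub> \<one>\<^bsub>R\<^esub>) \<odot>\<^bsub>M\<^esub> x = \<ominus>\<^bsub>M\<^esub> x"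
  using smult_l_distr[OF minus_one_closed R.one_closed, of x] smult_closed[OF minus_one_closed, of x]
  by (intro M.minus_equality[symmetric]) (simp_all add: R.l_neg smult_one)

lemma submoduleI:
  assumes "W \<subseteq> carrier M" "\<zero>\<^bsub>M\<^esub> \<in> W"
    and "\<And>x y. x \<in> W \<Longrightarrow> y \<in> W \<Longrightarrow> x \<oplus>\<^bsub>M\<^esub> y \<in> W"
    and "\<And>a x. a \<in> carrier R \<Longrightarrow> x \<in> W \<Longrightarrow> a \<odot>\<^bsub>M\<^esub> x \<in> W"
  shows "Module.submodule W R M"
proof (intro Module.submodule.intro Module.submodule_axioms.intro subgroup.intro)
  fix x assume x: "x \<in> W"
  have "inv\<^bsub>add_monoid M\<^esub> x = \<ominus>\<^bsub>M\<^esub> x" by (simp add: a_inv_def)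
  then show "inv\<^bsub>add_monoid M\<^esub> x \<in> W"
    using assms(4)[OF minus_one_closed x] smult_minus_one[of x] assms(1) x by (simp add: subset_iff)
qed (use assms in auto)

lemma submoduleD:
  assumes "Module.submodule W R M"
  shows "W \<subseteq> carrier M" "\<zero>\<^bsub>M\<^esub> \<in> W"
    and "\<And>x y. x \<in> W \<Longrightarrow> y \<in> W \<Longrightarrow> x \<oplus>\<^bsub>M\<^esub> y \<in> W"
    and "\<And>a x. a \<in> carrier R \<Longrightarrow> x \<in> W \<Longrightarrow> a \<odot>\<^bsub>M\<^esub> x \<in> W"
    and "\<And>x. x \<in> W \<Longrightarrow> \<ominus>\<^bsub>M\<^esub> x \<in> W"
proof -
  interpret W: Module.submodule W R M by fact
  show sub: "W \<subseteq> carrier M" "\<zero>\<^bsub>M\<^esub> \<in> W"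
    "\<And>x y. x \<in> W \<Longrightarrow> y \<in> W \<Longrightarrow> x \<oplus>\<^bsub>M\<^esub> y \<in> W"
    "\<And>a x. a \<in> carrier R \<Longrightarrow> x \<in> W \<Longrightarrow> a \<odot>\<^bsub>M\<^esub> x \<in> W"
    using W.subset W.one_closed W.m_closed W.smult_closed by auto
  show "\<ominus>\<^bsub>M\<^esub> x \<in> W" if "x \<in> W" for x
    using sub(4)[OF minus_one_closed that] smult_minus_one[of x] sub(1) that by (metis subsetD)
qed

lemma submodule_left_module:
  assumes "Module.submodule W R M"
  shows "left_module R (M\<lparr>carrier := W\<rparr>)"
proof -
  note W = submoduleD[OF assms]
  have W1: "x \<in> W \<Longrightarrow> x \<in> carrier M" for x using W(1) by auto
  have "abelian_group (M\<lparr>carrier := W\<rparr>)"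
  proof (rule abelian_groupI)
    fix x assume "x \<in> carrier (M\<lparr>carrier := W\<rparr>)"
    then show "\<exists>y\<in>carrier (M\<lparr>carrier := W\<rparr>). y \<oplus>\<^bsub>M\<lparr>carrier := W\<rparr>\<^esub> x = \<zero>\<^bsub>M\<lparr>carrier := W\<rparr>\<^esub>"
      using W W1 by (intro bexI[of _ "\<ominus>\<^bsub>M\<^esub> x"]) (auto simp: M.l_neg)
  qed (use W W1 in \<open>auto simp: M.a_ac\<close>)
  then show ?thesis
    by (intro left_module.intro left_module_axioms.intro R.ring_axioms)
       (use W W1 in \<open>auto simp: smult_l_distr smult_r_distr smult_assoc smult_one\<close>)
qed

inductive_set lin_span :: "'m set \<Rightarrow> 'm set" for A where
  lin_span_zero: "\<zero>\<^bsub>M\<^esub> \<in> lin_span A"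
| lin_span_step: "v \<in> A \<Longrightarrow> c \<in> carrier R \<Longrightarrow> w \<in> lin_span A \<Longrightarrow> c \<odot>\<^bsub>M\<^esub> v \<oplus>\<^bsub>M\<^esub> w \<in> lin_span A"

lemma lin_span_closed:
  assumes "A \<subseteq> carrier M" shows "lin_span A \<subseteq> carrier M"
proof
  fix x assume "x \<in> lin_span A"
  then show "x \<in> carrier M"
    by induction (use assms in \<open>auto intro!: smult_closed\<close>)
qed

lemma lin_span_mono: "A \<subseteq> B \<Longrightarrow> lin_span A \<subseteq> lin_span B"
proof
  fix x assume "A \<subseteq> B" "x \<in> lin_span A"
  from this(2,1) show "x \<in> lin_span B"
    by induction (auto intro: lin_span.intros)
qed

lemma lin_span_superset:
  assumes "A \<subseteq> carrier M" shows "A \<subseteq> lin_span A"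
proof
  fix x assume x: "x \<in> A"
  then have "\<one>\<^bsub>R\<^esub> \<odot>\<^bsub>M\<^esub> x \<oplus>\<^bsub>M\<^esub> \<zero>\<^bsub>M\<^esub> \<in> lin_span A" by (intro lin_span.intros) auto
  then show "x \<in> lin_span A" using x assms by (auto simp: smult_one)
qed

lemma lin_span_add:
  assumes "A \<subseteq> carrier M" "x \<in> lin_span A" "y \<in> lin_span A"
  shows "x \<oplus>\<^bsub>M\<^esub> y \<in> lin_span A"
  using assms(2)
proof induction
  case lin_span_zero
  have "y \<in> carrier M" using assms lin_span_closed by blast
  then show ?case using assms(3) by simp
next
  case (lin_span_step v c w)
  then have "c \<odot>\<^bsub>M\<^esub> v \<oplus>\<^bsub>M\<^esub> (w \<oplus>\<^bsub>M\<^esub> y) \<in> lin_span A" by (intro lin_span.intros)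
  moreover have "v \<in> carrier M" "w \<in> carrier M" "y \<in> carrier M"
    using lin_span_step assms lin_span_closed by auto
  ultimately show ?case using lin_span_step by (simp add: M.a_assoc smult_closed)
qed

lemma lin_span_smult:
  assumes "A \<subseteq> carrier M" "x \<in> lin_span A" "a \<in> carrier R"
  shows "a \<odot>\<^bsub>M\<^esub> x \<in> lin_span A"
  using assms(2)
proof induction
  case lin_span_zero
  then show ?case using assms by (simp add: lin_span.intros)
next
  case (lin_span_step v c w)
  then have "(a \<otimes>\<^bsub>R\<^esub> c) \<odot>\<^bsub>M\<^esub> v \<oplus>\<^bsub>M\<^esub> a \<odot>\<^bsub>M\<^esub> w \<in> lin_span A"
    using assms by (intro lin_span.intros) auto
  moreover have "v \<in> carrier M" "w \<in> carrier M"
    using lin_span_step assms lin_span_closed by auto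
  ultimately show ?case using lin_span_step assms by (simp add: smult_r_distr smult_assoc smult_closed)
qed

lemma lin_span_submodule: "A \<subseteq> carrier M \<Longrightarrow> Module.submodule (lin_span A) R M"
  by (intro submoduleI lin_span_closed lin_span_zero lin_span_add lin_span_smult)

lemma lin_span_least:
  assumes "A \<subseteq> W" "Module.submodule W R M"
  shows "lin_span A \<subseteq> W"
proof
  fix x assume "x \<in> lin_span A"
  then show "x \<in> W"
    by induction (use assms submoduleD[OF assms(2)] in auto)
qed

lemma lin_span_submodule_eq: "Module.submodule W R M \<Longrightarrow> lin_span W = W"
  using lin_span_least[of W W] lin_span_superset[of W] submoduleD(1)[of W] by auto

lemma lin_span_finitary:
  assumes "x \<in> lin_span A"
  shows "\<exists>F. finite F \<and> F \<subseteq> A \<and> x \<in> lin_span F"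
  using assms
proof induction
  case lin_span_zero
  show ?case by (intro exI[of _ "{}"]) (auto intro: lin_span.intros)
next
  case (lin_span_step v c w)
  then obtain F where "finite F" "F \<subseteq> A" "w \<in> lin_span F" by auto
  then have "c \<odot>\<^bsub>M\<^esub> v \<oplus>\<^bsub>M\<^esub> w \<in> lin_span (insert v F)"
    using lin_span_step lin_span_mono[of F "insert v F"] by (intro lin_span.intros) auto
  then show ?case using \<open>finite F\<close> \<open>F \<subseteq> A\<close> lin_span_step by (intro exI[of _ "insert v F"]) auto
qed

lemma lin_span_insert:
  assumes "A \<subseteq> carrier M" "y \<in> carrier M" "x \<in> lin_span (insert y A)"
  shows "\<exists>c\<in>carrier R. \<exists>z\<in>lin_span A. x = c \<odot>\<^bsub>M\<^esub> y \<oplus>\<^bsub>M\<^esub> z"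
  using assms(3)
proof induction
  case lin_span_zero
  then show ?case using assms lin_span.lin_span_zero[of A] by (intro bexI[of _ "\<zero>\<^bsub>R\<^esub>"] bexI[of _ "\<zero>\<^bsub>M\<^esub>"]) auto
next
  case (lin_span_step v d w)
  then obtain c z where c: "c \<in> carrier R" and z: "z \<in> lin_span A" and w: "w = c \<odot>\<^bsub>M\<^esub> y \<oplus>\<^bsub>M\<^esub> z" by auto
  have cz: "z \<in> carrier M" "v \<in> carrier M" using z lin_span_closed[OF assms(1)] lin_span_step assms by auto
  note cl = cz c \<open>d \<in> carrier R\<close> assms(2) smult_closed
  show ?case
  proof (cases "v = y")
    case True
    have "d \<odot>\<^bsub>M\<^esub> v \<oplus>\<^bsub>M\<^esub> w = (d \<oplus>\<^bsub>R\<^esub> c) \<odot>\<^bsub>M\<^esub> y \<oplus>\<^bsub>M\<^esub> z"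
      using cl by (simp add: True w smult_l_distr M.a_assoc)
    then show ?thesis using z c \<open>d \<in> carrier R\<close> by (intro bexI[of _ "d \<oplus>\<^bsub>R\<^esub> c"] bexI[of _ z]) auto
  next
    case False
    then have "d \<odot>\<^bsub>M\<^esub> v \<oplus>\<^bsub>M\<^esub> z \<in> lin_span A" using lin_span_step z by (intro lin_span.intros) auto
    moreover have "d \<odot>\<^bsub>M\<^esub> v \<oplus>\<^bsub>M\<^esub> w = c \<odot>\<^bsub>M\<^esub> y \<oplus>\<^bsub>M\<^esub> (d \<odot>\<^bsub>M\<^esub> v \<oplus>\<^bsub>M\<^esub> z)"
      using cl by (simp add: w M.a_lcomm)
    ultimately show ?thesis using c by blast
  qed
qed

text \<open>
  The inductive \<open>lin_span\<close> is convenient for closure arguments; this is its description by linear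
  combinations, in the form that occurs in the definition of a basis.
\<close>

lemma lin_span_eq_finsum:
  assumes B: "B \<subseteq> carrier M"
  shows "x \<in> lin_span B \<longleftrightarrow>
    (\<exists>A c. finite A \<and> A \<subseteq> B \<and> c \<in> A \<rightarrow> carrier R \<and> x = (\<Oplus>\<^bsub>M\<^esub>v\<in>A. c v \<odot>\<^bsub>M\<^esub> v))"
proof
  assume "x \<in> lin_span B"
  then show "\<exists>A c. finite A \<and> A \<subseteq> B \<and> c \<in> A \<rightarrow> carrier R \<and> x = (\<Oplus>\<^bsub>M\<^esub>v\<in>A. c v \<odot>\<^bsub>M\<^esub> v)"
  proof induction
    case lin_span_zero
    show ?case by (intro exI[of _ "{}"]) auto
  next
    case (lin_span_step u d w)
    then obtain A c where A: "finite A" "A \<subseteq> B" and c: "c \<in> A \<rightarrow> carrier R"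
      and w: "w = (\<Oplus>\<^bsub>M\<^esub>v\<in>A. c v \<odot>\<^bsub>M\<^esub> v)" by blast
    define c' where "c' v = (if v \<in> A then c v else \<zero>\<^bsub>R\<^esub>)" for v
    have c': "c' v \<in> carrier R" for v using c by (simp add: c'_def Pi_iff)
    have Bc: "v \<in> A - {u} \<Longrightarrow> v \<in> carrier M" for v using A B by auto
    have u: "u \<in> carrier M" using lin_span_step B by auto
    have fs: "(\<Oplus>\<^bsub>M\<^esub>v\<in>insert u (A - {u}). g v \<odot>\<^bsub>M\<^esub> v) = g u \<odot>\<^bsub>M\<^esub> u \<oplus>\<^bsub>M\<^esub> (\<Oplus>\<^bsub>M\<^esub>v\<in>A - {u}. g v \<odot>\<^bsub>M\<^esub> v)"
      if "\<And>v. g v \<in> carrier R" for g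
      by (rule M.finsum_insert) (use A u Bc that in \<open>auto intro!: smult_closed\<close>)
    have w': "w = c' u \<odot>\<^bsub>M\<^esub> u \<oplus>\<^bsub>M\<^esub> (\<Oplus>\<^bsub>M\<^esub>v\<in>A - {u}. c' v \<odot>\<^bsub>M\<^esub> v)"
    proof (cases "u \<in> A")
      case True
      have "w = (\<Oplus>\<^bsub>M\<^esub>v\<in>insert u (A - {u}). c' v \<odot>\<^bsub>M\<^esub> v)"
        unfolding w using True A B c by (intro M.finsum_cong') (auto simp: c'_def intro!: smult_closed)
      then show ?thesis by (simp only: fs[OF c'])
    next
      case False
      have "w = (\<Oplus>\<^bsub>M\<^esub>v\<in>A - {u}. c' v \<odot>\<^bsub>M\<^esub> v)"
        unfolding w using False A B c by (intro M.finsum_cong') (auto simp: c'_def intro!: smult_closed)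
      moreover have "w \<in> carrier M" using lin_span_step lin_span_closed[OF B] by auto
      ultimately show ?thesis using False u by (simp add: c'_def)
    qed
    define e where "e = c'(u := d \<oplus>\<^bsub>R\<^esub> c' u)"
    have e: "e v \<in> carrier R" for v using c' lin_span_step by (auto simp: e_def)
    have "(\<Oplus>\<^bsub>M\<^esub>v\<in>A - {u}. e v \<odot>\<^bsub>M\<^esub> v) = (\<Oplus>\<^bsub>M\<^esub>v\<in>A - {u}. c' v \<odot>\<^bsub>M\<^esub> v)"
      using Bc c' by (intro M.finsum_cong') (auto simp: e_def intro!: smult_closed)
    moreover have "(\<Oplus>\<^bsub>M\<^esub>v\<in>A - {u}. c' v \<odot>\<^bsub>M\<^esub> v) \<in> carrier M"
      using Bc c' by (intro M.finsum_closed) (auto intro!: smult_closed)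
    ultimately have "d \<odot>\<^bsub>M\<^esub> u \<oplus>\<^bsub>M\<^esub> w = (\<Oplus>\<^bsub>M\<^esub>v\<in>insert u (A - {u}). e v \<odot>\<^bsub>M\<^esub> v)"
      using u c' lin_span_step by (simp only: fs[OF e] w') (simp add: e_def smult_l_distr smult_closed M.a_assoc)
    then show ?case using A lin_span_step e by (intro exI[of _ "insert u (A - {u})"] exI[of _ e]) auto
  qed
next
  assume "\<exists>A c. finite A \<and> A \<subseteq> B \<and> c \<in> A \<rightarrow> carrier R \<and> x = (\<Oplus>\<^bsub>M\<^esub>v\<in>A. c v \<odot>\<^bsub>M\<^esub> v)"
  then obtain A c where A: "finite A" "A \<subseteq> B" "c \<in> A \<rightarrow> carrier R" and x: "x = (\<Oplus>\<^bsub>M\<^esub>v\<in>A. c v \<odot>\<^bsub>M\<^esub> v)"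
    by blast
  have "(\<Oplus>\<^bsub>M\<^esub>v\<in>A. c v \<odot>\<^bsub>M\<^esub> v) \<in> lin_span B" using A
  proof (induction A)
    case empty
    then show ?case by (simp add: lin_span.intros)
  next
    case (insert u A)
    have "(\<Oplus>\<^bsub>M\<^esub>v\<in>insert u A. c v \<odot>\<^bsub>M\<^esub> v) = c u \<odot>\<^bsub>M\<^esub> u \<oplus>\<^bsub>M\<^esub> (\<Oplus>\<^bsub>M\<^esub>v\<in>A. c v \<odot>\<^bsub>M\<^esub> v)"
      by (rule M.finsum_insert) (use insert B in \<open>auto intro!: smult_closed\<close>)
    then show ?case using insert by (auto intro!: lin_span.intros)
  qed
  then show "x \<in> lin_span B" by (simp add: x)
qed

end

sublocale left_vector_space \<subseteq> pregeometry "carrier V" lin_span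
proof
  fix A x y assume A: "A \<subseteq> carrier V" and y: "y \<in> carrier V"
    and x: "x \<in> lin_span (insert y A)" "x \<notin> lin_span A"
  obtain c z where c: "c \<in> carrier D" and z: "z \<in> lin_span A" and eq: "x = c \<odot>\<^bsub>V\<^esub> y \<oplus>\<^bsub>V\<^esub> z"
    using lin_span_insert[OF A y x(1)] by auto
  have zV: "z \<in> carrier V" using z lin_span_closed[OF A] by auto
  have "c \<noteq> \<zero>\<^bsub>D\<^esub>" using eq x(2) z zV y by auto
  then obtain d where d: "d \<in> carrier D" "d \<otimes>\<^bsub>D\<^esub> c = \<one>\<^bsub>D\<^esub>" using left_inverse c by auto
  have xV: "x \<in> carrier V" using eq c y zV by (simp add: smult_closed)
  have "d \<odot>\<^bsub>V\<^esub> x = y \<oplus>\<^bsub>V\<^esub> d \<odot>\<^bsub>V\<^esub> z"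
    using c d y zV by (simp add: eq smult_r_distr smult_closed smult_assoc[symmetric] smult_one)
  then have "y = d \<odot>\<^bsub>V\<^esub> x \<oplus>\<^bsub>V\<^esub> \<ominus>\<^bsub>V\<^esub> (d \<odot>\<^bsub>V\<^esub> z)"
    using d y zV by (simp add: M.a_assoc M.r_neg smult_closed)
  moreover have "\<ominus>\<^bsub>V\<^esub> (d \<odot>\<^bsub>V\<^esub> z) \<in> lin_span (insert x A)"
    using submoduleD(4,5)[OF lin_span_submodule[OF A]] z d lin_span_mono[of A "insert x A"] by blast
  ultimately show "y \<in> lin_span (insert x A)"
    using lin_span_step[of x "insert x A" d] d by auto
qed (use lin_span_superset lin_span_closed lin_span_mono lin_span_finitary in \<open>auto simp: lin_span_submodule_eq lin_span_submodule\<close>)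

context left_vector_space
begin

text \<open>
  The definition of \<^const>\<open>right_basis\<close> uses only the carrier and the zero of the ring of
  scalars and the scalar multiplication of the space. It is therefore the same over a ring and over its
  opposite, and for a left vector space it describes bases in the usual sense.
\<close>

lemma right_basis_iff: "right_basis D V B \<longleftrightarrow> indep B \<and> lin_span B = carrier V"
proof -
  have span: "(\<forall>x\<in>carrier V. \<exists>A c. finite A \<and> A \<subseteq> B \<and> c \<in> A \<rightarrow> carrier D \<and>
      x = (\<Oplus>\<^bsub>V\<^esub>v\<in>A. c v \<odot>\<^bsub>V\<^esub> v)) \<longleftrightarrow> lin_span B = carrier V" if B: "B \<subseteq> carrier V"
    unfolding lin_span_eq_finsum[OF B, symmetric] using lin_span_closed[OF B] by auto
  have "(\<forall>A c. finite A \<longrightarrow> A \<subseteq> B \<longrightarrow> c \<in> A \<rightarrow> carrier D \<longrightarrow>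
      (\<Oplus>\<^bsub>V\<^esub>v\<in>A. c v \<odot>\<^bsub>V\<^esub> v) = \<zero>\<^bsub>V\<^esub> \<longrightarrow> (\<forall>v\<in>A. c v = \<zero>\<^bsub>D\<^esub>)) \<longleftrightarrow> indep B" (is "?L \<longleftrightarrow> _")
    if B: "B \<subseteq> carrier V"
  proof
    assume L: ?L
    show "indep B" unfolding indep_def
    proof (intro conjI ballI notI)
      fix u assume u: "u \<in> B" "u \<in> lin_span (B - {u})"
      then obtain A c where A: "finite A" "A \<subseteq> B - {u}" and c: "c \<in> A \<rightarrow> carrier D"
        and eq: "u = (\<Oplus>\<^bsub>V\<^esub>v\<in>A. c v \<odot>\<^bsub>V\<^esub> v)"
        using lin_span_eq_finsum[of "B - {u}" u] B by auto
      define e where "e = c(u := \<ominus>\<^bsub>D\<^esub> \<one>\<^bsub>D\<^esub>)"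
      have uV: "u \<in> carrier V" using u B by auto
      have e: "e \<in> insert u A \<rightarrow> carrier D" using c by (auto simp: e_def)
      have "(\<Oplus>\<^bsub>V\<^esub>v\<in>insert u A. e v \<odot>\<^bsub>V\<^esub> v) = e u \<odot>\<^bsub>V\<^esub> u \<oplus>\<^bsub>V\<^esub> (\<Oplus>\<^bsub>V\<^esub>v\<in>A. e v \<odot>\<^bsub>V\<^esub> v)"
        by (rule M.finsum_insert) (use A B e uV in \<open>auto intro!: smult_closed\<close>)
      also have "(\<Oplus>\<^bsub>V\<^esub>v\<in>A. e v \<odot>\<^bsub>V\<^esub> v) = u"
        unfolding eq by (rule M.finsum_cong') (use A B c in \<open>auto simp: e_def intro!: smult_closed\<close>)
      also have "e u \<odot>\<^bsub>V\<^esub> u = \<ominus>\<^bsub>V\<^esub> u" using uV by (simp add: e_def smult_minus_one)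
      also have "\<ominus>\<^bsub>V\<^esub> u \<oplus>\<^bsub>V\<^esub> u = \<zero>\<^bsub>V\<^esub>" using uV by (rule M.l_neg)
      finally have sum0: "(\<Oplus>\<^bsub>V\<^esub>v\<in>insert u A. e v \<odot>\<^bsub>V\<^esub> v) = \<zero>\<^bsub>V\<^esub>" .
      have "finite (insert u A)" "insert u A \<subseteq> B" using A u by auto
      then have "\<forall>v\<in>insert u A. e v = \<zero>\<^bsub>D\<^esub>" using L e sum0 by presburger
      then have "e u = \<zero>\<^bsub>D\<^esub>" by simp
      then have "\<one>\<^bsub>D\<^esub> = \<zero>\<^bsub>D\<^esub>" by (simp add: e_def R.add.inv_eq_1_iff)
      then show False using one_not_zero by simp
    qed (rule B)
  next
    assume ind: "indep B"
    show ?L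
    proof (intro allI impI ballI, rule ccontr)
      fix A c u assume A: "finite A" "A \<subseteq> B" and c: "c \<in> A \<rightarrow> carrier D"
        and zero: "(\<Oplus>\<^bsub>V\<^esub>v\<in>A. c v \<odot>\<^bsub>V\<^esub> v) = \<zero>\<^bsub>V\<^esub>" and u: "u \<in> A" and nz: "c u \<noteq> \<zero>\<^bsub>D\<^esub>"
      have uV: "u \<in> carrier V" and cu: "c u \<in> carrier D" using A B u c by auto
      let ?w = "\<Oplus>\<^bsub>V\<^esub>v\<in>A - {u}. c v \<odot>\<^bsub>V\<^esub> v"
      have BV: "B - {u} \<subseteq> carrier V" using B by auto
      have w: "?w \<in> lin_span (B - {u})"
        unfolding lin_span_eq_finsum[OF BV] using A c by (intro exI[of _ "A - {u}"] exI[of _ c]) auto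
      have wV: "?w \<in> carrier V" using w lin_span_closed[OF BV] by auto
      have "(\<Oplus>\<^bsub>V\<^esub>v\<in>insert u (A - {u}). c v \<odot>\<^bsub>V\<^esub> v) = c u \<odot>\<^bsub>V\<^esub> u \<oplus>\<^bsub>V\<^esub> ?w"
        by (rule M.finsum_insert) (use A B c u in \<open>auto intro!: smult_closed\<close>)
      then have "c u \<odot>\<^bsub>V\<^esub> u \<oplus>\<^bsub>V\<^esub> ?w = \<zero>\<^bsub>V\<^esub>" using zero u by (simp add: insert_absorb)
      then have "c u \<odot>\<^bsub>V\<^esub> u = \<ominus>\<^bsub>V\<^esub> ?w"
        using uV cu wV by (intro M.minus_equality[symmetric]) (auto intro: smult_closed)
      moreover obtain d where d: "d \<in> carrier D" "d \<otimes>\<^bsub>D\<^esub> c u = \<one>\<^bsub>D\<^esub>" using left_inverse[OF cu nz] by auto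
      ultimately have "u = d \<odot>\<^bsub>V\<^esub> (\<ominus>\<^bsub>V\<^esub> ?w)"
        using uV cu smult_assoc[of d "c u" u] by (simp add: smult_one)
      also have "\<dots> \<in> lin_span (B - {u})"
        using submoduleD(4,5)[OF lin_span_submodule[OF BV]] w d by simp
      finally show False using ind A u by (auto simp: indep_def)
    qed
  qed
  with span show ?thesis
    by (cases "B \<subseteq> carrier V") (simp_all add: right_basis_def, simp add: indep_def)
qed

end

section \<open>Homomorphisms, copowers and retracts\<close>

lemma (in abelian_group) minus_eq_zero_iff:
  assumes "x \<in> carrier G" "y \<in> carrier G"
  shows "x \<ominus> y = \<zero> \<longleftrightarrow> x = y"
  using assms minus_equality[of x "\<ominus> y"] by (auto simp: a_minus_def r_neg)

lemma module_homI:
  assumes "\<And>x. x \<in> carrier M \<Longrightarrow> f x \<in> carrier N"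
    and "\<And>x y. x \<in> carrier M \<Longrightarrow> y \<in> carrier M \<Longrightarrow> f (x \<oplus>\<^bsub>M\<^esub> y) = f x \<oplus>\<^bsub>N\<^esub> f y"
    and "\<And>a x. a \<in> carrier R \<Longrightarrow> x \<in> carrier M \<Longrightarrow> f (a \<odot>\<^bsub>M\<^esub> x) = a \<odot>\<^bsub>N\<^esub> f x"
  shows "f \<in> module_hom R M N"
  using assms by (auto simp: module_hom_def)

lemma module_hom_mem: "f \<in> module_hom R M N \<Longrightarrow> x \<in> carrier M \<Longrightarrow> f x \<in> carrier N"
  by (auto simp: module_hom_def)

lemma module_hom_comp:
  "f \<in> module_hom R M N \<Longrightarrow> g \<in> module_hom R N P \<Longrightarrow> (\<lambda>x. g (f x)) \<in> module_hom R M P"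
  by (auto simp: module_hom_def Pi_iff)

lemma module_hom_id: "(\<lambda>x. x) \<in> module_hom R M M"
  by (auto simp: module_hom_def)

lemma carrier_hom_group: "carrier (hom_group R M N) = module_hom R M N \<inter> extensional (carrier M)"
  by (simp add: hom_group_def)

lemma hom_groupD: "f \<in> carrier (hom_group R M N) \<Longrightarrow> f \<in> module_hom R M N"
  by (simp add: carrier_hom_group)

lemma hom_group_ext:
  assumes "f \<in> carrier (hom_group R M N)" "g \<in> carrier (hom_group R M N)"
    and "\<And>x. x \<in> carrier M \<Longrightarrow> f x = g x"
  shows "f = g"
  using assms by (auto simp: carrier_hom_group intro: extensionalityI)

lemma hom_group_add_apply: "x \<in> carrier M \<Longrightarrow> (f \<oplus>\<^bsub>hom_group R M N\<^esub> g) x = f x \<oplus>\<^bsub>N\<^esub> g x"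
  by (simp add: hom_group_def)

lemma hom_group_zero_apply: "x \<in> carrier M \<Longrightarrow> \<zero>\<^bsub>hom_group R M N\<^esub> x = \<zero>\<^bsub>N\<^esub>"
  by (simp add: hom_group_def)

locale module_pair = M: left_module R M + N: left_module R N
  for R :: "('r, 'a) ring_scheme"
    and M :: "('r, 'm, 'c) module_scheme" and N :: "('r, 'n, 'd) module_scheme"
begin

lemma hom_closed: "f \<in> module_hom R M N \<Longrightarrow> x \<in> carrier M \<Longrightarrow> f x \<in> carrier N"
  by (rule module_hom_mem)

lemma hom_group_closed: "f \<in> carrier (hom_group R M N) \<Longrightarrow> x \<in> carrier M \<Longrightarrow> f x \<in> carrier N"
  by (rule hom_closed[OF hom_groupD])

lemma hom_zero: "f \<in> module_hom R M N \<Longrightarrow> f \<zero>\<^bsub>M\<^esub> = \<zero>\<^bsub>N\<^esub>"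
  using module_hom_add[of f R M N "\<zero>\<^bsub>M\<^esub>" "\<zero>\<^bsub>M\<^esub>"] module_hom_mem[of f R M N "\<zero>\<^bsub>M\<^esub>"] by simp

lemma hom_minus:
  assumes "f \<in> module_hom R M N" "x \<in> carrier M"
  shows "f (\<ominus>\<^bsub>M\<^esub> x) = \<ominus>\<^bsub>N\<^esub> f x"
  using module_hom_smult[OF assms(1) M.minus_one_closed assms(2)] assms module_hom_mem[OF assms]
  by (simp add: M.smult_minus_one N.smult_minus_one)

lemma hom_diff:
  assumes "f \<in> module_hom R M N" "x \<in> carrier M" "y \<in> carrier M"
  shows "f (x \<ominus>\<^bsub>M\<^esub> y) = f x \<ominus>\<^bsub>N\<^esub> f y"
  using assms by (simp add: a_minus_def module_hom_add hom_minus)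

lemma restrict_module_hom:
  assumes "f \<in> module_hom R M N"
  shows "(\<lambda>x\<in>carrier M. f x) \<in> carrier (hom_group R M N)"
  using assms by (auto simp: carrier_hom_group module_hom_def Pi_iff M.smult_closed)

lemma module_hom_zero_map: "(\<lambda>x. \<zero>\<^bsub>N\<^esub>) \<in> module_hom R M N"
  by (rule module_homI) auto

lemma module_hom_add_map:
  assumes "f \<in> module_hom R M N" "g \<in> module_hom R M N"
  shows "(\<lambda>x. f x \<oplus>\<^bsub>N\<^esub> g x) \<in> module_hom R M N"
proof (rule module_homI)
  fix x y assume "x \<in> carrier M" "y \<in> carrier M"
  then show "f (x \<oplus>\<^bsub>M\<^esub> y) \<oplus>\<^bsub>N\<^esub> g (x \<oplus>\<^bsub>M\<^esub> y) = f x \<oplus>\<^bsub>N\<^esub> g x \<oplus>\<^bsub>N\<^esub> (f y \<oplus>\<^bsub>N\<^esub> g y)"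
    using assms by (simp add: module_hom_add module_hom_mem N.a_ac)
qed (use assms in \<open>simp_all add: module_hom_mem module_hom_smult N.smult_r_distr\<close>)

lemma module_hom_minus_map:
  assumes "f \<in> module_hom R M N"
  shows "(\<lambda>x. \<ominus>\<^bsub>N\<^esub> f x) \<in> module_hom R M N"
proof (rule module_homI)
  fix x y assume "x \<in> carrier M" "y \<in> carrier M"
  then show "\<ominus>\<^bsub>N\<^esub> f (x \<oplus>\<^bsub>M\<^esub> y) = \<ominus>\<^bsub>N\<^esub> f x \<oplus>\<^bsub>N\<^esub> \<ominus>\<^bsub>N\<^esub> f y"
    using assms by (simp add: module_hom_add module_hom_mem N.minus_add)
qed (use assms in \<open>simp_all add: module_hom_mem module_hom_smult N.smult_minus_right\<close>)

lemma module_hom_diff_map: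
  assumes "f \<in> module_hom R M N" "g \<in> module_hom R M N"
  shows "(\<lambda>x. f x \<ominus>\<^bsub>N\<^esub> g x) \<in> module_hom R M N"
  unfolding a_minus_def using assms by (intro module_hom_add_map module_hom_minus_map)

lemma kernel_submodule:
  assumes "f \<in> module_hom R M N"
  shows "Module.submodule {x \<in> carrier M. f x = \<zero>\<^bsub>N\<^esub>} R M"
  by (rule M.submoduleI)
     (use assms in \<open>auto simp: hom_zero module_hom_add[OF assms] module_hom_smult[OF assms] M.smult_closed\<close>)

lemma image_submodule:
  assumes f: "f \<in> module_hom R M N" and W: "Module.submodule W R M"
  shows "Module.submodule (f ` W) R N"
proof (rule N.submoduleI)
  note W' = M.submoduleD[OF W]
  show "f ` W \<subseteq> carrier N" using module_hom_mem[OF f] W'(1) by auto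
  show "\<zero>\<^bsub>N\<^esub> \<in> f ` W" using hom_zero[OF f] W'(2) by force
  fix x y assume "x \<in> f ` W" "y \<in> f ` W"
  then obtain u v where "u \<in> W" "v \<in> W" "x = f u" "y = f v" by auto
  then show "x \<oplus>\<^bsub>N\<^esub> y \<in> f ` W"
    using W' module_hom_add[OF f, of u v] by (intro image_eqI[of _ _ "u \<oplus>\<^bsub>M\<^esub> v"]) (simp_all add: subset_iff)
next
  note W' = M.submoduleD[OF W]
  fix a x assume "a \<in> carrier R" "x \<in> f ` W"
  then obtain u where "u \<in> W" "x = f u" by auto
  then show "a \<odot>\<^bsub>N\<^esub> x \<in> f ` W"
    using W' module_hom_smult[OF f, of a u] \<open>a \<in> carrier R\<close>
    by (intro image_eqI[of _ _ "a \<odot>\<^bsub>M\<^esub> u"]) (simp_all add: subset_iff)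
qed

lemma hom_group_abelian: "abelian_group (hom_group R M N)"
proof (rule abelian_groupI)
  let ?H = "hom_group R M N"
  have add: "f \<oplus>\<^bsub>?H\<^esub> g \<in> carrier ?H" if "f \<in> carrier ?H" "g \<in> carrier ?H" for f g
    using restrict_module_hom[OF module_hom_add_map[of f g]] that by (simp add: hom_group_def)
  show zero: "\<zero>\<^bsub>?H\<^esub> \<in> carrier ?H"
    using restrict_module_hom[OF module_hom_zero_map] by (simp add: hom_group_def)
  note ap = hom_group_add_apply hom_group_zero_apply hom_group_closed
  fix f assume f: "f \<in> carrier ?H"
  show "\<zero>\<^bsub>?H\<^esub> \<oplus>\<^bsub>?H\<^esub> f = f"
    using f zero by (intro hom_group_ext[of _ R M N] add) (auto simp: ap)
  have m: "(\<lambda>x\<in>carrier M. \<ominus>\<^bsub>N\<^esub> f x) \<in> carrier ?H"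
    using restrict_module_hom[OF module_hom_minus_map[of f]] f by (simp add: hom_groupD)
  show "\<exists>g\<in>carrier ?H. g \<oplus>\<^bsub>?H\<^esub> f = \<zero>\<^bsub>?H\<^esub>"
    using f m zero
    by (intro bexI[of _ "\<lambda>x\<in>carrier M. \<ominus>\<^bsub>N\<^esub> f x"] hom_group_ext[of _ R M N] add) (auto simp: ap N.l_neg)
  fix g assume g: "g \<in> carrier ?H"
  show "f \<oplus>\<^bsub>?H\<^esub> g \<in> carrier ?H" using f g by (rule add)
  show "f \<oplus>\<^bsub>?H\<^esub> g = g \<oplus>\<^bsub>?H\<^esub> f"
    using f g by (intro hom_group_ext[of _ R M N] add) (auto simp: ap N.a_comm)
  fix h assume h: "h \<in> carrier ?H"
  show "f \<oplus>\<^bsub>?H\<^esub> g \<oplus>\<^bsub>?H\<^esub> h = f \<oplus>\<^bsub>?H\<^esub> (g \<oplus>\<^bsub>?H\<^esub> h)"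
    using f g h by (intro hom_group_ext[of _ R M N] add) (auto simp: ap N.a_assoc)
qed

sublocale H: abelian_group "hom_group R M N"
  by (rule hom_group_abelian)

lemma hom_group_minus_apply:
  assumes "f \<in> carrier (hom_group R M N)" "x \<in> carrier M"
  shows "(\<ominus>\<^bsub>hom_group R M N\<^esub> f) x = \<ominus>\<^bsub>N\<^esub> f x"
proof -
  have "(\<ominus>\<^bsub>hom_group R M N\<^esub> f \<oplus>\<^bsub>hom_group R M N\<^esub> f) x = \<zero>\<^bsub>N\<^esub>"
    using assms by (simp add: H.l_neg hom_group_zero_apply)
  then have "(\<ominus>\<^bsub>hom_group R M N\<^esub> f) x \<oplus>\<^bsub>N\<^esub> f x = \<zero>\<^bsub>N\<^esub>"
    using assms by (simp add: hom_group_add_apply)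
  then show ?thesis
    using assms H.a_inv_closed[OF assms(1)]
    by (intro N.minus_equality[symmetric]) (auto intro: hom_group_closed)
qed

lemma hom_group_diff_apply:
  assumes "f \<in> carrier (hom_group R M N)" "g \<in> carrier (hom_group R M N)" "x \<in> carrier M"
  shows "(f \<ominus>\<^bsub>hom_group R M N\<^esub> g) x = f x \<ominus>\<^bsub>N\<^esub> g x"
  using assms by (simp add: a_minus_def hom_group_add_apply hom_group_minus_apply)

text \<open>
  The kernel of a retraction is a complement of the image of \<open>\<phi>\<close>; conversely, the projection along a
  complement of a summand is a retraction.
\<close>

lemma iso_to_summand_iff_retract:
  "iso_to_summand R M N \<longleftrightarrow> (\<exists>\<phi>\<in>module_hom R M N. \<exists>\<rho>\<in>module_hom R N M. \<forall>v\<in>carrier M. \<rho> (\<phi> v) = v)"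
proof
  assume "iso_to_summand R M N"
  then obtain T U \<phi> where T: "Module.submodule T R N" and U: "Module.submodule U R N"
    and TU: "T \<inter> U = {\<zero>\<^bsub>N\<^esub>}" "T <+>\<^bsub>N\<^esub> U = carrier N"
    and \<phi>: "\<phi> \<in> module_hom R M (N\<lparr>carrier := T\<rparr>)" and bij: "bij_betw \<phi> (carrier M) T"
    unfolding iso_to_summand_def direct_summand_def by auto
  note T' = N.submoduleD[OF T] and U' = N.submoduleD[OF U]
  have \<phi>N: "\<phi> \<in> module_hom R M N"
    using \<phi> T'(1) by (auto simp: module_hom_def Pi_iff)
  have dec: "\<exists>v\<in>carrier M. \<exists>u\<in>U. x = \<phi> v \<oplus>\<^bsub>N\<^esub> u" if x: "x \<in> carrier N" for x
  proof -
    obtain t u where "t \<in> T" "u \<in> U" "x = t \<oplus>\<^bsub>N\<^esub> u"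
      using x unfolding TU(2)[symmetric] set_add_def' by blast
    then show ?thesis using bij unfolding bij_betw_def by blast
  qed
  have uniq: "v = v'" if v: "v \<in> carrier M" "v' \<in> carrier M" and u: "u \<in> U" "u' \<in> U"
    and eq: "\<phi> v \<oplus>\<^bsub>N\<^esub> u = \<phi> v' \<oplus>\<^bsub>N\<^esub> u'" for v v' u u'
  proof -
    have cl: "\<phi> v \<in> carrier N" "\<phi> v' \<in> carrier N" "u \<in> carrier N" "u' \<in> carrier N"
      using v u U'(1) module_hom_mem[OF \<phi>N] by auto
    have tt: "\<phi> v \<in> T" "\<phi> v' \<in> T" using v bij by (auto simp: bij_betw_def)
    have "\<phi> v \<ominus>\<^bsub>N\<^esub> \<phi> v' = u' \<ominus>\<^bsub>N\<^esub> u"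
    proof -
      have "\<phi> v = \<phi> v' \<oplus>\<^bsub>N\<^esub> u' \<ominus>\<^bsub>N\<^esub> u"
        using eq[symmetric] cl by (simp add: a_minus_def N.a_assoc N.r_neg)
      then have "\<phi> v \<ominus>\<^bsub>N\<^esub> \<phi> v' = (\<phi> v' \<oplus>\<^bsub>N\<^esub> u' \<ominus>\<^bsub>N\<^esub> u) \<ominus>\<^bsub>N\<^esub> \<phi> v'" by simp
      also have "\<dots> = (u' \<ominus>\<^bsub>N\<^esub> u) \<oplus>\<^bsub>N\<^esub> (\<phi> v' \<ominus>\<^bsub>N\<^esub> \<phi> v')"
        using cl by (simp add: a_minus_def N.a_ac)
      finally show ?thesis using cl by (simp add: a_minus_def N.r_neg)
    qed
    moreover have "\<phi> v \<ominus>\<^bsub>N\<^esub> \<phi> v' \<in> T" using tt T' by (simp add: a_minus_def)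
    moreover have "u' \<ominus>\<^bsub>N\<^esub> u \<in> U" using u U' by (simp add: a_minus_def)
    ultimately have "\<phi> v \<ominus>\<^bsub>N\<^esub> \<phi> v' = \<zero>\<^bsub>N\<^esub>" using TU(1) by auto
    then have "\<phi> v = \<phi> v'" using cl by (simp add: N.minus_eq_zero_iff)
    then show ?thesis using v bij by (auto simp: bij_betw_def inj_on_def)
  qed
  \<comment> \<open>the projection along \<open>U\<close>, followed by the inverse of \<open>\<phi>\<close>\<close>
  define \<rho> where "\<rho> x = (SOME v. v \<in> carrier M \<and> (\<exists>u\<in>U. x = \<phi> v \<oplus>\<^bsub>N\<^esub> u))" for x
  have \<rho>: "\<rho> x \<in> carrier M \<and> (\<exists>u\<in>U. x = \<phi> (\<rho> x) \<oplus>\<^bsub>N\<^esub> u)" if "x \<in> carrier N" for x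
    unfolding \<rho>_def using someI_ex[of "\<lambda>v. v \<in> carrier M \<and> (\<exists>u\<in>U. x = \<phi> v \<oplus>\<^bsub>N\<^esub> u)"] dec[OF that] by auto
  have \<rho>I: "\<rho> (\<phi> v \<oplus>\<^bsub>N\<^esub> u) = v" if "v \<in> carrier M" "u \<in> U" for v u
  proof -
    have x: "\<phi> v \<oplus>\<^bsub>N\<^esub> u \<in> carrier N" using that U'(1) module_hom_mem[OF \<phi>N] by auto
    then obtain u' where "u' \<in> U" "\<phi> v \<oplus>\<^bsub>N\<^esub> u = \<phi> (\<rho> (\<phi> v \<oplus>\<^bsub>N\<^esub> u)) \<oplus>\<^bsub>N\<^esub> u'" using \<rho> by blast
    then show ?thesis using uniq[of v "\<rho> (\<phi> v \<oplus>\<^bsub>N\<^esub> u)" u u'] \<rho>[OF x] that by simp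
  qed
  have "\<rho> \<in> module_hom R N M"
  proof (rule module_homI)
    fix x y assume xy: "x \<in> carrier N" "y \<in> carrier N"
    obtain u where u: "u \<in> U" "x = \<phi> (\<rho> x) \<oplus>\<^bsub>N\<^esub> u" using \<rho>[OF xy(1)] by auto
    obtain w where w: "w \<in> U" "y = \<phi> (\<rho> y) \<oplus>\<^bsub>N\<^esub> w" using \<rho>[OF xy(2)] by auto
    have cl: "\<rho> x \<in> carrier M" "\<rho> y \<in> carrier M" "u \<in> carrier N" "w \<in> carrier N"
      "\<phi> (\<rho> x) \<in> carrier N" "\<phi> (\<rho> y) \<in> carrier N"
      using \<rho> xy u w U'(1) module_hom_mem[OF \<phi>N] by auto
    have "x \<oplus>\<^bsub>N\<^esub> y = (\<phi> (\<rho> x) \<oplus>\<^bsub>N\<^esub> u) \<oplus>\<^bsub>N\<^esub> (\<phi> (\<rho> y) \<oplus>\<^bsub>N\<^esub> w)" using u(2) w(2) by simp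
    also have "\<dots> = \<phi> (\<rho> x \<oplus>\<^bsub>M\<^esub> \<rho> y) \<oplus>\<^bsub>N\<^esub> (u \<oplus>\<^bsub>N\<^esub> w)"
      using cl by (simp add: module_hom_add[OF \<phi>N] N.a_ac)
    finally show "\<rho> (x \<oplus>\<^bsub>N\<^esub> y) = \<rho> x \<oplus>\<^bsub>M\<^esub> \<rho> y" using \<rho>I cl u w U'(3) by simp
  next
    fix a x assume ax: "a \<in> carrier R" "x \<in> carrier N"
    obtain u where u: "u \<in> U" "x = \<phi> (\<rho> x) \<oplus>\<^bsub>N\<^esub> u" using \<rho>[OF ax(2)] by auto
    have cl: "\<rho> x \<in> carrier M" "u \<in> carrier N" "\<phi> (\<rho> x) \<in> carrier N"
      using \<rho> ax u U'(1) module_hom_mem[OF \<phi>N] by auto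
    have "a \<odot>\<^bsub>N\<^esub> x = a \<odot>\<^bsub>N\<^esub> (\<phi> (\<rho> x) \<oplus>\<^bsub>N\<^esub> u)" using u(2) by simp
    also have "\<dots> = \<phi> (a \<odot>\<^bsub>M\<^esub> \<rho> x) \<oplus>\<^bsub>N\<^esub> a \<odot>\<^bsub>N\<^esub> u"
      using cl ax by (simp add: module_hom_smult[OF \<phi>N] N.smult_r_distr)
    finally show "\<rho> (a \<odot>\<^bsub>N\<^esub> x) = a \<odot>\<^bsub>M\<^esub> \<rho> x" using \<rho>I cl u ax U'(4) by (simp add: M.smult_closed)
  qed (use \<rho> in auto)
  moreover have "\<rho> (\<phi> v) = v" if "v \<in> carrier M" for v
    using \<rho>I[OF that U'(2)] module_hom_mem[OF \<phi>N that] by simp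
  ultimately show "\<exists>\<phi>\<in>module_hom R M N. \<exists>\<rho>\<in>module_hom R N M. \<forall>v\<in>carrier M. \<rho> (\<phi> v) = v"
    using \<phi>N by blast
next
  assume "\<exists>\<phi>\<in>module_hom R M N. \<exists>\<rho>\<in>module_hom R N M. \<forall>v\<in>carrier M. \<rho> (\<phi> v) = v"
  then obtain \<phi> \<rho> where \<phi>: "\<phi> \<in> module_hom R M N" and \<rho>: "\<rho> \<in> module_hom R N M"
    and ret: "\<And>v. v \<in> carrier M \<Longrightarrow> \<rho> (\<phi> v) = v" by auto
  interpret NM: module_pair R N M by unfold_locales
  let ?T = "\<phi> ` carrier M" and ?U = "{x \<in> carrier N. \<rho> x = \<zero>\<^bsub>M\<^esub>}"
  have cM: "Module.submodule (carrier M) R M" by (rule M.submoduleI) (auto intro: M.smult_closed)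
  have T: "Module.submodule ?T R N" by (rule image_submodule[OF \<phi> cM])
  have U: "Module.submodule ?U R N" by (rule NM.kernel_submodule[OF \<rho>])
  note cl = module_hom_mem[OF \<phi>] module_hom_mem[OF \<rho>]
  have "?T \<inter> ?U = {\<zero>\<^bsub>N\<^esub>}"
    using ret hom_zero[OF \<phi>] NM.hom_zero[OF \<rho>] cl by (auto intro!: image_eqI[of _ _ "\<zero>\<^bsub>M\<^esub>"])
  moreover have "?T <+>\<^bsub>N\<^esub> ?U = carrier N"
  proof
    show "?T <+>\<^bsub>N\<^esub> ?U \<subseteq> carrier N" using cl by (auto simp: set_add_def')
    show "carrier N \<subseteq> ?T <+>\<^bsub>N\<^esub> ?U"
    proof
      fix x assume x: "x \<in> carrier N"
      have "x \<ominus>\<^bsub>N\<^esub> \<phi> (\<rho> x) \<in> ?U"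
        using x cl ret by (auto simp: NM.hom_diff[OF \<rho>] M.minus_eq_zero_iff)
      moreover have "x = \<phi> (\<rho> x) \<oplus>\<^bsub>N\<^esub> (x \<ominus>\<^bsub>N\<^esub> \<phi> (\<rho> x))"
      proof -
        have "\<phi> (\<rho> x) \<oplus>\<^bsub>N\<^esub> (x \<ominus>\<^bsub>N\<^esub> \<phi> (\<rho> x)) = x \<oplus>\<^bsub>N\<^esub> (\<phi> (\<rho> x) \<ominus>\<^bsub>N\<^esub> \<phi> (\<rho> x))"
          using x cl by (simp add: a_minus_def N.a_lcomm)
        then show ?thesis using x cl by (simp add: a_minus_def N.r_neg)
      qed
      ultimately show "x \<in> ?T <+>\<^bsub>N\<^esub> ?U" using x cl unfolding set_add_def' by blast
    qed
  qed
  moreover have "\<phi> \<in> module_hom R M (N\<lparr>carrier := ?T\<rparr>)" using \<phi> by (auto simp: module_hom_def)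
  moreover have "bij_betw \<phi> (carrier M) ?T" using ret by (auto simp: bij_betw_def intro: inj_on_inverseI)
  ultimately show "iso_to_summand R M N"
    unfolding iso_to_summand_def direct_summand_def using T U by blast
qed

end

context left_module
begin

lemma copower_mem_iff:
  "f \<in> carrier (copower M I) \<longleftrightarrow>
    f \<in> extensional I \<and> (\<forall>i\<in>I. f i \<in> carrier M) \<and> finite {i \<in> I. f i \<noteq> \<zero>\<^bsub>M\<^esub>}"
  by (auto simp: copower_def PiE_iff)

lemma copower_closed: "f \<in> carrier (copower M I) \<Longrightarrow> i \<in> I \<Longrightarrow> f i \<in> carrier M"
  by (simp add: copower_mem_iff)

lemma copower_ext:
  "f \<in> carrier (copower M I) \<Longrightarrow> g \<in> carrier (copower M I) \<Longrightarrow> (\<And>i. i \<in> I \<Longrightarrow> f i = g i) \<Longrightarrow> f = g"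
  by (auto simp: copower_mem_iff intro: extensionalityI)

lemma copower_apply:
  "i \<in> I \<Longrightarrow> (f \<oplus>\<^bsub>copower M I\<^esub> g) i = f i \<oplus>\<^bsub>M\<^esub> g i"
  "i \<in> I \<Longrightarrow> (a \<odot>\<^bsub>copower M I\<^esub> f) i = a \<odot>\<^bsub>M\<^esub> f i"
  "i \<in> I \<Longrightarrow> \<zero>\<^bsub>copower M I\<^esub> i = \<zero>\<^bsub>M\<^esub>"
  by (simp_all add: copower_def)

lemma copower_left_module: "left_module R (copower M I)"
proof -
  let ?N = "copower M I"
  have add: "f \<oplus>\<^bsub>?N\<^esub> g \<in> carrier ?N" if f: "f \<in> carrier ?N" and g: "g \<in> carrier ?N" for f g
  proof -
    have "{i \<in> I. (f \<oplus>\<^bsub>?N\<^esub> g) i \<noteq> \<zero>\<^bsub>M\<^esub>} \<subseteq> {i \<in> I. f i \<noteq> \<zero>\<^bsub>M\<^esub>} \<union> {i \<in> I. g i \<noteq> \<zero>\<^bsub>M\<^esub>}"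
      by (auto simp: copower_apply)
    then have "finite {i \<in> I. (f \<oplus>\<^bsub>?N\<^esub> g) i \<noteq> \<zero>\<^bsub>M\<^esub>}"
      by (rule finite_subset) (use f g in \<open>simp add: copower_mem_iff\<close>)
    moreover have "f \<oplus>\<^bsub>?N\<^esub> g \<in> extensional I" by (simp add: copower_def)
    ultimately show ?thesis using f g unfolding copower_mem_iff by (simp add: copower_apply)
  qed
  have smult: "a \<odot>\<^bsub>?N\<^esub> f \<in> carrier ?N" if a: "a \<in> carrier R" and f: "f \<in> carrier ?N" for a f
  proof -
    have "{i \<in> I. (a \<odot>\<^bsub>?N\<^esub> f) i \<noteq> \<zero>\<^bsub>M\<^esub>} \<subseteq> {i \<in> I. f i \<noteq> \<zero>\<^bsub>M\<^esub>}"
      using a by (auto simp: copower_apply)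
    then have "finite {i \<in> I. (a \<odot>\<^bsub>?N\<^esub> f) i \<noteq> \<zero>\<^bsub>M\<^esub>}"
      by (rule finite_subset) (use f in \<open>simp add: copower_mem_iff\<close>)
    moreover have "a \<odot>\<^bsub>?N\<^esub> f \<in> extensional I" by (simp add: copower_def)
    ultimately show ?thesis using a f unfolding copower_mem_iff by (simp add: copower_apply smult_closed)
  qed
  have zero: "\<zero>\<^bsub>?N\<^esub> \<in> carrier ?N"
  proof -
    have "{i \<in> I. \<zero>\<^bsub>?N\<^esub> i \<noteq> \<zero>\<^bsub>M\<^esub>} = {}" by (auto simp: copower_apply)
    moreover have "\<zero>\<^bsub>?N\<^esub> \<in> extensional I" by (simp add: copower_def)
    ultimately show ?thesis unfolding copower_mem_iff by (simp only: copower_apply finite.emptyI) simp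
  qed
  note ap = copower_apply copower_closed
  have "abelian_group ?N"
  proof (rule abelian_groupI)
    fix f assume f: "f \<in> carrier ?N"
    show "\<zero>\<^bsub>?N\<^esub> \<oplus>\<^bsub>?N\<^esub> f = f" using f zero by (intro copower_ext[where I = I] add) (simp_all add: ap)
    have m: "(\<ominus>\<^bsub>R\<^esub> \<one>\<^bsub>R\<^esub>) \<odot>\<^bsub>?N\<^esub> f \<in> carrier ?N" using smult[OF minus_one_closed f] .
    have "((\<ominus>\<^bsub>R\<^esub> \<one>\<^bsub>R\<^esub>) \<odot>\<^bsub>?N\<^esub> f) \<oplus>\<^bsub>?N\<^esub> f = \<zero>\<^bsub>?N\<^esub>"
      using m f zero by (intro copower_ext[where I = I] add) (simp_all add: ap smult_minus_one M.l_neg)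
    then show "\<exists>g\<in>carrier ?N. g \<oplus>\<^bsub>?N\<^esub> f = \<zero>\<^bsub>?N\<^esub>" using m by blast
    fix g assume g: "g \<in> carrier ?N"
    show "f \<oplus>\<^bsub>?N\<^esub> g = g \<oplus>\<^bsub>?N\<^esub> f"
      using f g by (intro copower_ext[where I = I] add) (simp_all add: ap M.a_comm)
    fix h assume h: "h \<in> carrier ?N"
    show "f \<oplus>\<^bsub>?N\<^esub> g \<oplus>\<^bsub>?N\<^esub> h = f \<oplus>\<^bsub>?N\<^esub> (g \<oplus>\<^bsub>?N\<^esub> h)"
      using f g h by (intro copower_ext[where I = I] add) (simp_all add: ap M.a_assoc)
  qed (use add zero in auto)
  then show ?thesis
  proof (intro left_module.intro left_module_axioms.intro R.ring_axioms)
    fix a f assume a: "a \<in> carrier R" and f: "f \<in> carrier ?N"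
    show "a \<odot>\<^bsub>?N\<^esub> f \<in> carrier ?N" by (rule smult[OF a f])
  next
    fix f assume f: "f \<in> carrier ?N"
    show "\<one>\<^bsub>R\<^esub> \<odot>\<^bsub>?N\<^esub> f = f"
      using f by (intro copower_ext[where I = I] smult) (simp_all add: ap smult_one)
  next
    fix a b f assume a: "a \<in> carrier R" "b \<in> carrier R" and f: "f \<in> carrier ?N"
    show "(a \<oplus>\<^bsub>R\<^esub> b) \<odot>\<^bsub>?N\<^esub> f = a \<odot>\<^bsub>?N\<^esub> f \<oplus>\<^bsub>?N\<^esub> b \<odot>\<^bsub>?N\<^esub> f"
      using a f by (intro copower_ext[where I = I] add smult) (simp_all add: ap smult_l_distr)
    show "(a \<otimes>\<^bsub>R\<^esub> b) \<odot>\<^bsub>?N\<^esub> f = a \<odot>\<^bsub>?N\<^esub> (b \<odot>\<^bsub>?N\<^esub> f)"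
      using a f by (intro copower_ext[where I = I] smult) (simp_all add: ap smult_assoc)
  next
    fix a f g assume a: "a \<in> carrier R" and f: "f \<in> carrier ?N" "g \<in> carrier ?N"
    show "a \<odot>\<^bsub>?N\<^esub> (f \<oplus>\<^bsub>?N\<^esub> g) = a \<odot>\<^bsub>?N\<^esub> f \<oplus>\<^bsub>?N\<^esub> a \<odot>\<^bsub>?N\<^esub> g"
      using a f by (intro copower_ext[where I = I] add smult) (simp_all add: ap smult_r_distr)
  qed
qed

abbreviation "End \<equiv> endo_ring R M"

lemma carrier_endo_ring: "carrier End = carrier (hom_group R M M)"
  by (simp add: endo_ring_def)

lemma endo_module_hom: "e \<in> carrier End \<Longrightarrow> e \<in> module_hom R M M"
  by (simp add: carrier_endo_ring hom_groupD)

lemma endo_closed: "e \<in> carrier End \<Longrightarrow> x \<in> carrier M \<Longrightarrow> e x \<in> carrier M"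
  by (rule module_hom_mem[OF endo_module_hom])

lemma endo_apply:
  "x \<in> carrier M \<Longrightarrow> (e \<oplus>\<^bsub>End\<^esub> e') x = e x \<oplus>\<^bsub>M\<^esub> e' x"
  "x \<in> carrier M \<Longrightarrow> (e \<otimes>\<^bsub>End\<^esub> e') x = e (e' x)"
  "x \<in> carrier M \<Longrightarrow> \<one>\<^bsub>End\<^esub> x = x"
  "x \<in> carrier M \<Longrightarrow> \<zero>\<^bsub>End\<^esub> x = \<zero>\<^bsub>M\<^esub>"
  by (simp_all add: endo_ring_def hom_group_def compose_def)

lemma endo_ext:
  "e \<in> carrier End \<Longrightarrow> e' \<in> carrier End \<Longrightarrow>
    (\<And>x. x \<in> carrier M \<Longrightarrow> e x = e' x) \<Longrightarrow> e = e'"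
  by (rule hom_group_ext[of e R M M e']) (simp_all add: carrier_endo_ring)

lemma endo_ring_ring: "ring End"
proof -
  interpret MM: module_pair R M M by unfold_locales
  let ?E = End and ?H = "hom_group R M M"
  have car: "carrier ?E = carrier ?H" by (simp add: endo_ring_def)
  have add: "f \<oplus>\<^bsub>?E\<^esub> g = f \<oplus>\<^bsub>?H\<^esub> g" for f g by (simp add: endo_ring_def)
  have comp: "compose (carrier M) f g \<in> carrier ?H" if "f \<in> carrier ?H" "g \<in> carrier ?H" for f g
    using MM.restrict_module_hom[OF module_hom_comp[of g R M M f M]] that
    by (simp add: hom_groupD compose_def)
  have "abelian_group ?E"
  proof (rule abelian_groupI)
    fix f assume "f \<in> carrier ?E"
    then show "\<exists>g\<in>carrier ?E. g \<oplus>\<^bsub>?E\<^esub> f = \<zero>\<^bsub>?E\<^esub>"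
      using MM.H.l_neg[of f] MM.H.a_inv_closed[of f] by (auto simp: endo_ring_def)
  qed (auto simp: endo_ring_def MM.H.a_ac)
  moreover have "Group.monoid ?E"
  proof (rule monoidI)
    show "\<one>\<^bsub>?E\<^esub> \<in> carrier ?E"
      using MM.restrict_module_hom[OF module_hom_id] by (simp add: endo_ring_def)
  qed (use comp in \<open>auto simp: endo_ring_def compose_def fun_eq_iff carrier_hom_group
         extensional_def module_hom_mem\<close>)
  moreover have "(f \<oplus>\<^bsub>?E\<^esub> g) \<otimes>\<^bsub>?E\<^esub> h = f \<otimes>\<^bsub>?E\<^esub> h \<oplus>\<^bsub>?E\<^esub> g \<otimes>\<^bsub>?E\<^esub> h"
    "h \<otimes>\<^bsub>?E\<^esub> (f \<oplus>\<^bsub>?E\<^esub> g) = h \<otimes>\<^bsub>?E\<^esub> f \<oplus>\<^bsub>?E\<^esub> h \<otimes>\<^bsub>?E\<^esub> g"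
    if "f \<in> carrier ?E" "g \<in> carrier ?E" "h \<in> carrier ?E" for f g h
    using that by (auto simp: endo_ring_def hom_group_def compose_def fun_eq_iff
      module_hom_mem module_hom_add)
  ultimately show ?thesis by (intro ringI) auto
qed

end

section \<open>Rings in which every element is a unit or nilpotent\<close>

locale fitting_ring = ring E for E (structure) +
  assumes one_neq_zero: "\<one> \<noteq> \<zero>"
    and unit_or_nilpotent: "x \<in> carrier E \<Longrightarrow> x \<in> Units E \<or> (\<exists>n::nat. x [^] n = \<zero>)"
begin

abbreviation nonunits :: "'a set" where
  "nonunits \<equiv> carrier E - Units E"

text \<open>
  An element with a one-sided inverse cannot be nilpotent, because its powers have one-sided inverses
  too. Hence one-sided inverses are two-sided, as in a finite dimensional algebra.
\<close>

lemma one_sided_inverse_units: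
  assumes x: "x \<in> carrier E" and y: "y \<in> carrier E" and xy: "x \<otimes> y = \<one>"
  shows "x \<in> Units E" "y \<in> Units E"
proof -
  have pow: "x [^] n \<otimes> y [^] n = \<one>" for n :: nat
  proof (induction n)
    case (Suc n)
    have "x [^] Suc n \<otimes> y [^] Suc n = (x [^] n \<otimes> x) \<otimes> (y \<otimes> y [^] n)"
      using nat_pow_Suc2[OF y, of n] by (simp only: nat_pow_Suc)
    also have "\<dots> = x [^] n \<otimes> (x \<otimes> y) \<otimes> y [^] n" using x y by (simp add: m_assoc)
    finally show ?case using x Suc xy by simp
  qed simp
  have "x [^] n \<noteq> \<zero>" "y [^] n \<noteq> \<zero>" for n :: nat
    using pow[of n] x y one_neq_zero by auto
  then show "x \<in> Units E" "y \<in> Units E" using unit_or_nilpotent x y by blast+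
qed

lemma mult_nonunit:
  assumes "x \<in> nonunits" "y \<in> carrier E"
  shows "x \<otimes> y \<in> nonunits" "y \<otimes> x \<in> nonunits"
proof -
  have x: "x \<in> carrier E" using assms by simp
  have "x \<in> Units E" if u: "x \<otimes> y \<in> Units E"
  proof (rule one_sided_inverse_units(1)[OF x])
    show "y \<otimes> inv (x \<otimes> y) \<in> carrier E" using assms u by simp
    show "x \<otimes> (y \<otimes> inv (x \<otimes> y)) = \<one>"
      using x assms(2) u Units_r_inv[OF u] by (simp add: m_assoc[symmetric])
  qed
  moreover have "x \<in> Units E" if u: "y \<otimes> x \<in> Units E"
  proof (rule one_sided_inverse_units(2)[OF _ x])
    show "inv (y \<otimes> x) \<otimes> y \<in> carrier E" using assms u by simp
    show "inv (y \<otimes> x) \<otimes> y \<otimes> x = \<one>"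
      using x assms(2) u Units_l_inv[OF u] by (simp add: m_assoc)
  qed
  ultimately show "x \<otimes> y \<in> nonunits" "y \<otimes> x \<in> nonunits" using assms by auto
qed

lemma one_minus_nonunit:
  assumes "x \<in> nonunits"
  shows "\<one> \<ominus> x \<in> Units E"
proof -
  have x: "x \<in> carrier E" using assms by simp
  obtain n :: nat where n: "x [^] n = \<zero>" using unit_or_nilpotent assms by blast
  \<comment> \<open>\<open>s\<close> is the geometric sum \<open>1 + x + \<dots> + x ^ (n - 1)\<close>\<close>
  have "\<exists>s\<in>carrier E. (\<one> \<ominus> x) \<otimes> s = \<one> \<ominus> x [^] n" for n :: nat
  proof (induction n)
    case 0
    then show ?case using x by (intro bexI[of _ \<zero>]) (simp_all add: a_minus_def r_neg)
  next
    case (Suc n)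
    then obtain s where s: "s \<in> carrier E" "(\<one> \<ominus> x) \<otimes> s = \<one> \<ominus> x [^] n" by auto
    have "(\<one> \<ominus> x) \<otimes> (s \<oplus> x [^] n) = (\<one> \<ominus> x [^] n) \<oplus> (x [^] n \<ominus> x \<otimes> x [^] n)"
      using x s by (simp add: r_distr l_distr a_minus_def l_minus)
    also have "\<dots> = (\<one> \<oplus> (\<ominus> (x [^] n) \<oplus> x [^] n)) \<ominus> x \<otimes> x [^] n"
      using x by (simp only: a_minus_def a_assoc nat_pow_closed a_inv_closed one_closed a_closed m_closed)
    also have "\<dots> = \<one> \<ominus> x [^] Suc n"
      using x nat_pow_Suc2[OF x, of n] by (simp add: l_neg)
    finally show ?case using x s by (intro bexI[of _ "s \<oplus> x [^] n"]) auto
  qed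
  from this[of n] obtain s where "s \<in> carrier E" "(\<one> \<ominus> x) \<otimes> s = \<one>"
    using n by (auto simp: a_minus_def)
  then show ?thesis using x by (intro one_sided_inverse_units(1)) auto
qed

text \<open>
  If \<open>x + y\<close> were a unit \<open>u\<close>, then \<open>1 - inv u * x\<close> would equal the non-unit \<open>inv u * y\<close>,
  although it is a unit because \<open>inv u * x\<close> is nilpotent.
\<close>

lemma add_nonunit:
  assumes "x \<in> nonunits" "y \<in> nonunits"
  shows "x \<oplus> y \<in> nonunits"
proof -
  have xy: "x \<in> carrier E" "y \<in> carrier E" using assms by auto
  have False if u: "x \<oplus> y \<in> Units E"
  proof -
    let ?u = "inv (x \<oplus> y)"
    have uc: "?u \<in> carrier E" using u by simp
    have "?u \<otimes> x \<oplus> ?u \<otimes> y = \<one>" using xy uc Units_l_inv[OF u] by (simp add: r_distr[symmetric])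
    then have "\<one> \<ominus> ?u \<otimes> x = ?u \<otimes> x \<oplus> ?u \<otimes> y \<ominus> ?u \<otimes> x" by simp
    also have "\<dots> = ?u \<otimes> y \<oplus> (?u \<otimes> x \<ominus> ?u \<otimes> x)" using xy uc by (simp add: a_minus_def a_ac)
    also have "\<dots> = ?u \<otimes> y" using xy uc by (simp add: a_minus_def r_neg)
    finally have "?u \<otimes> y \<in> Units E" using one_minus_nonunit[OF mult_nonunit(2)[OF assms(1) uc]] by simp
    then show False using mult_nonunit(2)[OF assms(2) uc] by simp
  qed
  then show ?thesis using xy by auto
qed

lemma zero_nonunit: "\<zero> \<in> nonunits"
  using one_neq_zero by (auto simp: Units_def)

lemma minus_nonunit: "x \<in> nonunits \<Longrightarrow> \<ominus> x \<in> nonunits"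
  using mult_nonunit(1)[of x "\<ominus> \<one>"] by (simp add: r_minus)

lemma nonunits_ideal: "ideal nonunits E"
proof (intro idealI ring_axioms)
  show "subgroup nonunits (add_monoid E)"
    using add_nonunit zero_nonunit minus_nonunit
    by (intro subgroup.intro) (auto simp: a_inv_def[symmetric])
qed (use mult_nonunit in auto)

sublocale nonunits: ideal nonunits E
  by (rule nonunits_ideal)

lemma proper_left_ideal_nonunits:
  assumes I: "left_ideal I E" and ne: "I \<noteq> carrier E"
  shows "I \<subseteq> nonunits"
proof
  fix x assume x: "x \<in> I"
  have sub: "I \<subseteq> carrier E"
    using I by (auto simp: left_ideal_def dest: additive_subgroup.a_subset)
  have "False" if u: "x \<in> Units E"
  proof -
    have "inv x \<otimes> x \<in> I" using I x Units_inv_closed[OF u] unfolding left_ideal_def by blast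
    then have "\<one> \<in> I" using Units_l_inv[OF u] by simp
    then have "y \<in> I" if "y \<in> carrier E" for y
      using I that r_one[of y] unfolding left_ideal_def by metis
    then show False using sub ne by auto
  qed
  then show "x \<in> nonunits" using x sub by auto
qed

text \<open>
  A proper left ideal contains no unit, so the non-units form the only maximal left ideal.
\<close>

lemma jacobson_radical_eq_nonunits: "jacobson_radical E = nonunits"
proof -
  have li: "left_ideal nonunits E"
    using mult_nonunit nonunits.additive_subgroup_axioms by (simp add: left_ideal_def)
  have ne: "nonunits \<noteq> carrier E" using Units_one_closed one_closed by blast
  have mx: "maximal_left_ideal nonunits E"
    unfolding maximal_left_ideal_def using li ne proper_left_ideal_nonunits by blast
  have "I = nonunits" if "maximal_left_ideal I E" for I
    using that li ne proper_left_ideal_nonunits[of I] unfolding maximal_left_ideal_def by blast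
  then show ?thesis using mx unfolding jacobson_radical_def by blast
qed

lemma nonunits_coset_eq_zero_iff:
  assumes "x \<in> carrier E"
  shows "nonunits +> x = nonunits \<longleftrightarrow> x \<in> nonunits"
  using nonunits.a_rcos_const[of x] nonunits.a_rcos_self[OF assms] by blast

lemma quotient_one_neq_zero: "\<one>\<^bsub>E Quot nonunits\<^esub> \<noteq> \<zero>\<^bsub>E Quot nonunits\<^esub>"
  using nonunits_coset_eq_zero_iff[OF one_closed] by (simp add: FactRing_def)

lemma quotient_inverse:
  assumes c: "c \<in> carrier (E Quot nonunits)" "c \<noteq> \<zero>\<^bsub>E Quot nonunits\<^esub>"
  shows "\<exists>d\<in>carrier (E Quot nonunits). c \<otimes>\<^bsub>E Quot nonunits\<^esub> d = \<one>\<^bsub>E Quot nonunits\<^esub>"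
proof -
  obtain x where x: "x \<in> carrier E" "c = nonunits +> x"
    using c(1) by (auto simp: FactRing_def A_RCOSETS_def')
  then have u: "x \<in> Units E" using c(2) nonunits_coset_eq_zero_iff[of x] by (auto simp: FactRing_def)
  then show ?thesis using x nonunits.rcoset_mult_add[of x "inv x"] Units_r_inv[OF u]
    by (intro bexI[of _ "nonunits +> inv x"]) (auto simp: FactRing_def A_RCOSETS_def')
qed

end

section \<open>Fitting's lemma\<close>

text \<open>
  For a module over a group algebra over \<open>k\<close> that is finite dimensional over \<open>k\<close>, \<open>subsp\<close> holds of the
  \<open>k\<close>-subspaces and \<open>rk\<close> is the dimension. Two kinds of subspaces matter: submodules, in
  Fitting's lemma, and subgroups stable under all endomorphisms, in the extension of partial
  homomorphisms.
\<close>

locale finite_rank_module = left_module R M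
  for R :: "('r, 'a) ring_scheme" and M :: "('r, 'm, 'c) module_scheme" +
  fixes subsp :: "'m set \<Rightarrow> bool" and rk :: "'m set \<Rightarrow> nat"
  assumes subsp_submodule: "Module.submodule W R M \<Longrightarrow> subsp W"
    and subsp_endo: "\<lbrakk>W \<subseteq> carrier M; \<zero>\<^bsub>M\<^esub> \<in> W; \<And>x y. x \<in> W \<Longrightarrow> y \<in> W \<Longrightarrow> x \<oplus>\<^bsub>M\<^esub> y \<in> W;
        \<And>e x. e \<in> module_hom R M M \<Longrightarrow> x \<in> W \<Longrightarrow> e x \<in> W\<rbrakk> \<Longrightarrow> subsp W"
    and rk_mono: "\<lbrakk>subsp U; subsp W; U \<subseteq> W\<rbrakk> \<Longrightarrow> rk U \<le> rk W"
    and rk_strict: "\<lbrakk>subsp U; subsp W; U \<subseteq> W; rk U = rk W\<rbrakk> \<Longrightarrow> U = W"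
begin

sublocale MM: module_pair R M M by unfold_locales

lemma carrier_submodule: "Module.submodule (carrier M) R M"
  by (rule submoduleI) (auto intro: smult_closed)

sublocale E: ring End
  by (rule endo_ring_ring)

lemma bij_endo_unit:
  assumes e: "e \<in> carrier End" and bij: "bij_betw e (carrier M) (carrier M)"
  shows "e \<in> Units End"
proof -
  let ?g = "\<lambda>x\<in>carrier M. inv_into (carrier M) e x"
  note eh = endo_module_hom[OF e]
  have inj: "inj_on e (carrier M)" and img: "e ` carrier M = carrier M"
    using bij by (auto simp: bij_betw_def)
  have ge: "inv_into (carrier M) e (e x) = x" if "x \<in> carrier M" for x
    using inj that by simp
  have eg: "e (inv_into (carrier M) e x) = x" "inv_into (carrier M) e x \<in> carrier M"
    if "x \<in> carrier M" for x
    using that f_inv_into_f[of x e "carrier M"] inv_into_into[of x e "carrier M"] img by auto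
  have "inv_into (carrier M) e \<in> module_hom R M M"
  proof (rule module_homI)
    fix x y assume xy: "x \<in> carrier M" "y \<in> carrier M"
    let ?x = "inv_into (carrier M) e x" and ?y = "inv_into (carrier M) e y"
    have "e (?x \<oplus>\<^bsub>M\<^esub> ?y) = x \<oplus>\<^bsub>M\<^esub> y" using eg xy by (simp add: module_hom_add[OF eh])
    then show "inv_into (carrier M) e (x \<oplus>\<^bsub>M\<^esub> y) = ?x \<oplus>\<^bsub>M\<^esub> ?y"
      using ge[of "?x \<oplus>\<^bsub>M\<^esub> ?y"] eg xy by simp
  next
    fix a x assume ax: "a \<in> carrier R" "x \<in> carrier M"
    let ?x = "inv_into (carrier M) e x"
    have "e (a \<odot>\<^bsub>M\<^esub> ?x) = a \<odot>\<^bsub>M\<^esub> x" using eg ax by (simp add: module_hom_smult[OF eh])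
    then show "inv_into (carrier M) e (a \<odot>\<^bsub>M\<^esub> x) = a \<odot>\<^bsub>M\<^esub> ?x"
      using ge[of "a \<odot>\<^bsub>M\<^esub> ?x"] eg ax by (simp add: smult_closed)
  qed (use eg in auto)
  then have g: "?g \<in> carrier End"
    using MM.restrict_module_hom by (simp add: carrier_endo_ring)
  have "?g \<otimes>\<^bsub>End\<^esub> e = \<one>\<^bsub>End\<^esub>" "e \<otimes>\<^bsub>End\<^esub> ?g = \<one>\<^bsub>End\<^esub>"
    using e g ge eg MM.hom_closed[OF eh]
    by (auto intro!: endo_ext E.m_closed simp: endo_apply)
  then show ?thesis using e g by (auto simp: Units_def)
qed

text \<open>
  For a sufficiently high power of \<open>e\<close> the images and the kernels are stationary, and then \<open>M\<close> is the
  direct sum of the image and the kernel of that power. One of them is zero.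
\<close>

lemma indecomposable_endo_unit_or_nilpotent:
  assumes ind: "indecomposable R M" and e: "e \<in> carrier End"
  shows "e \<in> Units End \<or> (\<exists>n::nat. e [^]\<^bsub>End\<^esub> n = \<zero>\<^bsub>End\<^esub>)"
proof -
  let ?p = "\<lambda>n::nat. e [^]\<^bsub>End\<^esub> n"
  let ?im = "\<lambda>n. ?p n ` carrier M" and ?ker = "\<lambda>n. {x \<in> carrier M. ?p n x = \<zero>\<^bsub>M\<^esub>}"
  have pc: "?p n \<in> carrier End" for n using e by simp
  note ph = endo_module_hom[OF pc]
  have pcl: "?p n x \<in> carrier M" if "x \<in> carrier M" for n x using MM.hom_closed[OF ph that] .
  have padd: "?p (m + n) x = ?p m (?p n x)" if "x \<in> carrier M" for m n x
    using that endo_apply(2)[of x "?p m" "?p n"] e by (simp add: E.nat_pow_mult)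
  have sub: "Module.submodule (?im n) R M" "Module.submodule (?ker n) R M" for n
    using MM.image_submodule[OF ph carrier_submodule] MM.kernel_submodule[OF ph] by auto
  note sb = sub[THEN subsp_submodule]
  have im_anti: "?im (n + m) \<subseteq> ?im n" for n m
    by (rule image_subsetI) (simp add: padd pcl)
  have ker_mono: "?ker n \<subseteq> ?ker (m + n)" for n m using padd MM.hom_zero[OF ph] by auto
  \<comment> \<open>From \<open>n\<close> on the images are stationary. The exponent is positive so that injectivity of the power
    carries over to \<open>e\<close>.\<close>
  obtain n where n: "1 \<le> n" and nmin: "\<And>m. 1 \<le> m \<Longrightarrow> rk (?im n) \<le> rk (?im m)"
    using ex_has_least_nat[of "\<lambda>n. 1 \<le> n" 1 "\<lambda>n. rk (?im n)"] by auto
  have im_eq: "?im (n + m) = ?im n" for m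
  proof (rule rk_strict[OF sb(1) sb(1) im_anti])
    show "rk (?im (n + m)) = rk (?im n)"
    proof (rule antisym)
      show "rk (?im (n + m)) \<le> rk (?im n)" by (rule rk_mono[OF sb(1) sb(1) im_anti])
      show "rk (?im n) \<le> rk (?im (n + m))" by (rule nmin) (use n in simp)
    qed
  qed
  \<comment> \<open>Ranks of kernels are bounded, so some \<open>m \<ge> n\<close> has a kernel of largest rank.\<close>
  have "\<forall>m. n \<le> m \<longrightarrow> rk (?ker m) < Suc (rk (carrier M))"
  proof (intro allI impI)
    fix m show "rk (?ker m) < Suc (rk (carrier M))"
      using rk_mono[OF sb(2) subsp_submodule[OF carrier_submodule], of m] by (simp add: less_Suc_eq_le)
  qed
  from ex_has_greatest_nat[of "\<lambda>m. n \<le> m" n "\<lambda>m. rk (?ker m)", OF order_refl this]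
  obtain m where "n \<le> m \<and> (\<forall>l. n \<le> l \<longrightarrow> rk (?ker l) \<le> rk (?ker m))"
    by (elim exE)
  then have m: "n \<le> m" and mmax: "\<And>l. n \<le> l \<Longrightarrow> rk (?ker l) \<le> rk (?ker m)"
    by simp_all
  have ker_eq: "?ker m = ?ker (m + m)"
  proof (rule rk_strict[OF sb(2) sb(2) ker_mono])
    show "rk (?ker m) = rk (?ker (m + m))"
    proof (rule antisym)
      show "rk (?ker m) \<le> rk (?ker (m + m))" by (rule rk_mono[OF sb(2) sb(2) ker_mono])
      show "rk (?ker (m + m)) \<le> rk (?ker m)" by (rule mmax) (use m in simp)
    qed
  qed
  have im_eq2: "?im (m + m) = ?im m"
    using im_eq[of "m - n"] im_eq[of "m + m - n"] m by simp
  have "?ker m \<inter> ?im m = {\<zero>\<^bsub>M\<^esub>}"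
  proof
    show "?ker m \<inter> ?im m \<subseteq> {\<zero>\<^bsub>M\<^esub>}"
    proof
      fix x assume "x \<in> ?ker m \<inter> ?im m"
      then obtain y where y: "y \<in> carrier M" "x = ?p m y" "?p m x = \<zero>\<^bsub>M\<^esub>" by auto
      then have "y \<in> ?ker (m + m)" using padd[of y m m] by simp
      then have "y \<in> ?ker m" using ker_eq by simp
      then show "x \<in> {\<zero>\<^bsub>M\<^esub>}" using y by simp
    qed
    show "{\<zero>\<^bsub>M\<^esub>} \<subseteq> ?ker m \<inter> ?im m"
      using submoduleD(2)[OF sub(1)[of m]] submoduleD(2)[OF sub(2)[of m]] by simp
  qed
  moreover have "?ker m <+>\<^bsub>M\<^esub> ?im m = carrier M"
  proof
    show "?ker m <+>\<^bsub>M\<^esub> ?im m \<subseteq> carrier M" unfolding set_add_def' using pcl by auto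
    show "carrier M \<subseteq> ?ker m <+>\<^bsub>M\<^esub> ?im m"
    proof
      fix x assume x: "x \<in> carrier M"
      then have "?p m x \<in> ?im (m + m)" by (simp only: im_eq2 imageI)
      then obtain y where y: "y \<in> carrier M" "?p m x = ?p (m + m) y" by (elim imageE)
      have "x \<ominus>\<^bsub>M\<^esub> ?p m y \<in> ?ker m"
        using x y pcl padd[of y m m] by (simp add: MM.hom_diff[OF ph] M.minus_eq_zero_iff)
      moreover have "x = (x \<ominus>\<^bsub>M\<^esub> ?p m y) \<oplus>\<^bsub>M\<^esub> ?p m y"
        using x y pcl[OF y(1)] by (simp add: a_minus_def M.a_assoc M.l_neg)
      moreover have "?p m y \<in> ?im m" using y(1) by (rule imageI)
      ultimately show "x \<in> ?ker m <+>\<^bsub>M\<^esub> ?im m" unfolding set_add_def' UN_iff singleton_iff by (intro bexI)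
    qed
  qed
  ultimately have "?ker m = {\<zero>\<^bsub>M\<^esub>} \<or> ?im m = {\<zero>\<^bsub>M\<^esub>}"
    using ind[unfolded indecomposable_def, THEN conjunct2, rule_format, OF sub(2)[of m] sub(1)[of m]] by simp
  then show ?thesis
  proof
    assume "?im m = {\<zero>\<^bsub>M\<^esub>}"
    have "?p m x = \<zero>\<^bsub>M\<^esub>" if "x \<in> carrier M" for x
      using imageI[OF that, of "?p m"] by (simp only: \<open>?im m = {\<zero>\<^bsub>M\<^esub>}\<close> singleton_iff)
    then have "?p m = \<zero>\<^bsub>End\<^esub>"
      by (intro endo_ext pc E.zero_closed) (simp add: endo_apply)
    then show ?thesis by (intro disjI2 exI)
  next
    assume k0: "?ker m = {\<zero>\<^bsub>M\<^esub>}"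
    have m1: "m = Suc (m - 1)" using m n by simp
    have inj_p: "inj_on (?p m) (carrier M)"
    proof (rule inj_onI)
      fix x y assume xy: "x \<in> carrier M" "y \<in> carrier M" "?p m x = ?p m y"
      then have "x \<ominus>\<^bsub>M\<^esub> y \<in> ?ker m" using pcl by (simp add: MM.hom_diff[OF ph] M.minus_eq_zero_iff)
      then have "x \<ominus>\<^bsub>M\<^esub> y = \<zero>\<^bsub>M\<^esub>" by (simp only: k0 singleton_iff)
      then show "x = y" using xy by (simp add: M.minus_eq_zero_iff)
    qed
    have onto_p: "?im m = carrier M"
    proof -
      have "x \<in> ?im m" if x: "x \<in> carrier M" for x
      proof -
        have "?p m x \<in> ?im (m + m)" using x by (simp only: im_eq2 imageI)
        then obtain y where y: "y \<in> carrier M" "?p m x = ?p (m + m) y" by (elim imageE)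
        then have "x = ?p m y" using inj_onD[OF inj_p] padd[of y m m] x pcl by simp
        then show ?thesis using imageI[OF y(1), of "?p m"] by simp
      qed
      moreover have "?im m \<subseteq> carrier M" using pcl by (rule image_subsetI)
      ultimately show ?thesis by (intro equalityI subsetI) (rule subsetD)
    qed
    have e1: "?p 1 = e" using e by simp
    have fst: "?p m x = ?p (m - 1) (e x)" and snd: "?p m x = e (?p (m - 1) x)" if "x \<in> carrier M" for x
      using padd[OF that, of "m - 1" 1] padd[OF that, of 1 "m - 1"] m1 e1 by simp_all
    have "inj_on e (carrier M)"
    proof (rule inj_onI)
      fix x y assume xy: "x \<in> carrier M" "y \<in> carrier M" "e x = e y"
      have "?p m x = ?p m y" by (simp only: fst[OF xy(1)] fst[OF xy(2)] xy(3))
      then show "x = y" using xy(1,2) by (rule inj_onD[OF inj_p])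
    qed
    moreover have "e ` carrier M = carrier M"
    proof
      show "e ` carrier M \<subseteq> carrier M" using MM.hom_closed[OF endo_module_hom[OF e]] by (rule image_subsetI)
      have "?im m \<subseteq> e ` carrier M"
      proof (rule image_subsetI)
        fix x assume x: "x \<in> carrier M"
        show "?p m x \<in> e ` carrier M" unfolding snd[OF x] by (rule imageI[OF pcl[OF x]])
      qed
      then show "carrier M \<subseteq> e ` carrier M" by (simp only: onto_p)
    qed
    ultimately show ?thesis using bij_endo_unit[OF e] by (simp add: bij_betw_def)
  qed
qed

lemma indecomposable_fitting_ring:
  assumes ind: "indecomposable R M"
  shows "fitting_ring (endo_ring R M)"
proof
  have "\<exists>x\<in>carrier M. x \<noteq> \<zero>\<^bsub>M\<^esub>" using ind unfolding indecomposable_def by auto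
  then show "\<one>\<^bsub>endo_ring R M\<^esub> \<noteq> \<zero>\<^bsub>endo_ring R M\<^esub>"
    using endo_apply(3,4) by metis
qed (rule indecomposable_endo_unit_or_nilpotent[OF ind])

end

section \<open>Maps out of a copower that split locally\<close>

lemma module_hom_restrict_carrier:
  "f \<in> module_hom R (S\<lparr>carrier := Y\<rparr>) N \<Longrightarrow> X \<subseteq> Y \<Longrightarrow> f \<in> module_hom R (S\<lparr>carrier := X\<rparr>) N"
  by (simp add: module_hom_def subset_iff Pi_iff)

context left_module
begin

lemma copower_component_hom: "i \<in> I \<Longrightarrow> (\<lambda>v. v i) \<in> module_hom R (copower M I) M"
  by (rule module_homI) (simp_all add: copower_apply copower_closed)

lemma copower_family_hom:
  assumes "left_module R X"
    and f: "\<And>i. i \<in> I \<Longrightarrow> f i \<in> module_hom R X M"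
    and J: "finite J" "\<And>i x. i \<in> I \<Longrightarrow> i \<notin> J \<Longrightarrow> x \<in> carrier X \<Longrightarrow> f i x = \<zero>\<^bsub>M\<^esub>"
  shows "(\<lambda>x. \<lambda>i\<in>I. f i x) \<in> module_hom R X (copower M I)"
proof -
  interpret X: left_module R X by fact
  interpret N: left_module R "copower M I" by (rule copower_left_module)
  have mem: "(\<lambda>i\<in>I. f i x) \<in> carrier (copower M I)" if x: "x \<in> carrier X" for x
  proof -
    have "{i \<in> I. (\<lambda>i\<in>I. f i x) i \<noteq> \<zero>\<^bsub>M\<^esub>} \<subseteq> J" using J(2) x by auto
    then have "finite {i \<in> I. (\<lambda>i\<in>I. f i x) i \<noteq> \<zero>\<^bsub>M\<^esub>}" using J(1) by (rule finite_subset)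
    then show ?thesis using module_hom_mem[OF f x] unfolding copower_mem_iff by simp
  qed
  show ?thesis
  proof (rule module_homI)
    fix x y assume xy: "x \<in> carrier X" "y \<in> carrier X"
    show "(\<lambda>i\<in>I. f i (x \<oplus>\<^bsub>X\<^esub> y)) = (\<lambda>i\<in>I. f i x) \<oplus>\<^bsub>copower M I\<^esub> (\<lambda>i\<in>I. f i y)"
      using xy mem
      by (intro copower_ext[where I = I]) (simp_all add: copower_apply module_hom_add[OF f])
  next
    fix a x assume ax: "a \<in> carrier R" "x \<in> carrier X"
    show "(\<lambda>i\<in>I. f i (a \<odot>\<^bsub>X\<^esub> x)) = a \<odot>\<^bsub>copower M I\<^esub> (\<lambda>i\<in>I. f i x)"
      using ax mem
      by (intro copower_ext[where I = I])
         (simp_all add: copower_apply module_hom_smult[OF f] X.smult_closed N.smult_closed)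
  qed (rule mem)
qed

end

text \<open>
  \<open>fd\<close> stands for the submodules of \<open>S\<close> that are finite dimensional over \<open>k\<close>. They form a directed
  cover of \<open>S\<close>, and by \<open>fd_noetherian\<close> every subset \<open>P\<close> of one of them is contained in the submodule
  generated by finitely many elements of \<open>P\<close>.
\<close>

locale locally_noetherian_pair =
  M: finite_rank_module R M subsp rk + S: left_module R S
  for R :: "('r, 'a) ring_scheme" and M :: "('r, 'm, 'c) module_scheme"
    and S :: "('r, 's, 'd) module_scheme" and subsp rk +
  fixes fd :: "'s set \<Rightarrow> bool"
  assumes fd_submodule: "fd X \<Longrightarrow> Module.submodule X R S"
    and fd_directed: "fd X \<Longrightarrow> fd Y \<Longrightarrow> \<exists>Z. fd Z \<and> X \<union> Y \<subseteq> Z"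
    and fd_cover: "s \<in> carrier S \<Longrightarrow> \<exists>X. fd X \<and> s \<in> X"
    and fd_noetherian: "fd X \<Longrightarrow> P \<subseteq> X \<Longrightarrow>
      \<exists>T. finite T \<and> T \<subseteq> P \<and> (\<forall>W. Module.submodule W R S \<longrightarrow> T \<subseteq> W \<longrightarrow> P \<subseteq> W)"
begin

abbreviation "sub X \<equiv> S\<lparr>carrier := X\<rparr>"

lemma fd_module_pair:
  assumes "fd X" shows "module_pair R (sub X) M"
  by (intro module_pair.intro S.submodule_left_module fd_submodule assms M.left_module_axioms)

text \<open>
  A set \<open>\<Gamma>\<close> of prescribed values \<open>(a, n)\<close> that can be met by a homomorphism on any given finite
  dimensional submodule, though perhaps by different ones on different submodules. As every element
  lies in a finite dimensional submodule, \<open>\<Gamma>\<close> is single-valued; it need not be closed under the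
  module operations.
\<close>

definition partial_hom :: "'i set \<Rightarrow> ('s \<times> ('i \<Rightarrow> 'm)) set \<Rightarrow> bool" where
  "partial_hom I \<Gamma> \<longleftrightarrow> \<Gamma> \<subseteq> carrier S \<times> carrier (copower M I) \<and>
    (\<forall>X. fd X \<longrightarrow> (\<exists>q. q \<in> module_hom R (sub X) (copower M I) \<and>
      (\<forall>a n. (a, n) \<in> \<Gamma> \<longrightarrow> a \<in> X \<longrightarrow> q a = n)))"

lemma partial_homD:
  assumes "partial_hom I \<Gamma>" "fd X"
  shows "\<exists>q. q \<in> module_hom R (sub X) (copower M I) \<and> (\<forall>a n. (a, n) \<in> \<Gamma> \<longrightarrow> a \<in> X \<longrightarrow> q a = n)"
  using assms by (simp add: partial_hom_def)

lemma equalizer_submodule: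
  assumes X: "fd X" and N: "left_module R N"
    and p: "p \<in> module_hom R (sub X) N" and q: "q \<in> module_hom R (sub X) N"
  shows "Module.submodule {x \<in> X. p x = q x} R S"
proof -
  note X' = S.submoduleD[OF fd_submodule[OF X]]
  interpret XN: module_pair R "sub X" N
    by (intro module_pair.intro S.submodule_left_module fd_submodule X N)
  show ?thesis
    using X' XN.hom_zero[OF p] XN.hom_zero[OF q] module_hom_add[OF p] module_hom_add[OF q]
      module_hom_smult[OF p] module_hom_smult[OF q]
    by (intro S.submoduleI) auto
qed

text \<open>
  On a finite dimensional submodule \<open>X\<close> the values prescribed by the union are determined by finitely
  many of them, and these belong to a single member of the chain.
\<close>

lemma partial_hom_Union:
  assumes ch: "subset.chain {\<Gamma>. partial_hom I \<Gamma>} \<C>" and ne: "\<C> \<noteq> {}"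
  shows "partial_hom I (\<Union>\<C>)"
proof -
  have mem: "partial_hom I \<Gamma>" if "\<Gamma> \<in> \<C>" for \<Gamma>
    using ch that unfolding subset.chain_def by auto
  have "\<exists>q. q \<in> module_hom R (sub X) (copower M I) \<and>
      (\<forall>a n. (a, n) \<in> \<Union>\<C> \<longrightarrow> a \<in> X \<longrightarrow> q a = n)"
    if X: "fd X" for X
  proof -
    let ?P = "Domain (\<Union>\<C>) \<inter> X"
    obtain T where T: "finite T" "T \<subseteq> ?P"
      and gen: "\<And>W. Module.submodule W R S \<Longrightarrow> T \<subseteq> W \<Longrightarrow> ?P \<subseteq> W"
      using fd_noetherian[OF X, of ?P] by auto
    have "\<forall>t\<in>T. \<exists>n. (t, n) \<in> \<Union>\<C>" using T(2) by blast
    then obtain g where g: "\<forall>t\<in>T. (t, g t) \<in> \<Union>\<C>" by metis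
    have "(\<lambda>t. (t, g t)) ` T \<subseteq> \<Union>\<C>" using g by auto
    then obtain \<Gamma>0 where \<Gamma>0: "\<Gamma>0 \<in> \<C>" "(\<lambda>t. (t, g t)) ` T \<subseteq> \<Gamma>0"
      using finite_subset_Union_chain[OF finite_imageI[OF T(1)] _ ne ch] by metis
    obtain q0 where q0: "q0 \<in> module_hom R (sub X) (copower M I)"
      and q0a: "\<And>a n. (a, n) \<in> \<Gamma>0 \<Longrightarrow> a \<in> X \<Longrightarrow> q0 a = n"
      using partial_homD[OF mem[OF \<Gamma>0(1)] X] by metis
    have "q0 a = n" if an: "(a, n) \<in> \<Union>\<C>" "a \<in> X" for a n
    proof -
      obtain \<Gamma>1 where \<Gamma>1: "\<Gamma>1 \<in> \<C>" "(a, n) \<in> \<Gamma>1" using an by auto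
      \<comment> \<open>\<open>q0\<close> and a homomorphism for a larger member agree on the generators \<open>T\<close>, hence at \<open>a\<close>.\<close>
      have "\<Gamma>0 \<subseteq> \<Gamma>1 \<or> \<Gamma>1 \<subseteq> \<Gamma>0" using ch \<Gamma>0(1) \<Gamma>1(1) unfolding subset.chain_def by blast
      then obtain \<Gamma>2 where \<Gamma>2: "\<Gamma>2 \<in> \<C>" "\<Gamma>0 \<subseteq> \<Gamma>2" "(a, n) \<in> \<Gamma>2"
        using \<Gamma>0(1) \<Gamma>1 by blast
      obtain q2 where q2: "q2 \<in> module_hom R (sub X) (copower M I)"
        and q2a: "\<And>a n. (a, n) \<in> \<Gamma>2 \<Longrightarrow> a \<in> X \<Longrightarrow> q2 a = n"
        using partial_homD[OF mem[OF \<Gamma>2(1)] X] by metis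
      have "?P \<subseteq> {x \<in> X. q0 x = q2 x}"
      proof (rule gen)
        show "Module.submodule {x \<in> X. q0 x = q2 x} R S"
          by (rule equalizer_submodule[OF X M.copower_left_module q0 q2])
        show "T \<subseteq> {x \<in> X. q0 x = q2 x}"
        proof
          fix t assume t: "t \<in> T"
          then have "(t, g t) \<in> \<Gamma>0" "t \<in> X" using \<Gamma>0(2) T(2) by auto
          then show "t \<in> {x \<in> X. q0 x = q2 x}" using q0a[of t "g t"] q2a[of t "g t"] \<Gamma>2(2) by auto
        qed
      qed
      then have "q0 a = q2 a" using an by blast
      then show ?thesis using q2a[OF \<Gamma>2(3) an(2)] by simp
    qed
    then show ?thesis using q0 by (intro exI[of _ q0] conjI allI impI)
  qed
  moreover have "\<Union>\<C> \<subseteq> carrier S \<times> carrier (copower M I)"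
    using mem unfolding partial_hom_def by blast
  ultimately show ?thesis by (simp add: partial_hom_def)
qed

text \<open>
  On a finite dimensional submodule \<open>X\<close> containing \<open>a\<close>, the coordinates of the possible values at \<open>a\<close> are
  determined up to the set \<open>H X\<close> of values at \<open>a\<close> of homomorphisms \<open>X \<rightarrow> M\<close> that vanish wherever \<open>\<Gamma>\<close>
  prescribes a value. It is stable under endomorphisms of \<open>M\<close> and decreases as \<open>X\<close> grows. If \<open>H X0\<close> has
  least rank, then a value at \<open>a\<close> that is possible on \<open>X0\<close> is possible on every larger \<open>Z\<close>: a solution
  on \<open>Z\<close> differs from it, in each coordinate, by an element of \<open>H X0 = H Z\<close>, and only finitely many
  coordinates have to be corrected.
\<close>

lemma partial_hom_extend:
  assumes \<Gamma>: "partial_hom I \<Gamma>" and a: "a \<in> carrier S"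
  shows "\<exists>v. partial_hom I (insert (a, v) \<Gamma>)"
proof -
  let ?N = "copower M I"
  interpret N: left_module R ?N by (rule M.copower_left_module)
  define H where "H X = {q a | q. q \<in> module_hom R (sub X) M \<and>
    (\<forall>b\<in>Domain \<Gamma> \<inter> X. q b = \<zero>\<^bsub>M\<^esub>)}" for X
  have HI: "q a \<in> H X" if "q \<in> module_hom R (sub X) M" "\<And>b. b \<in> Domain \<Gamma> \<Longrightarrow> b \<in> X \<Longrightarrow> q b = \<zero>\<^bsub>M\<^esub>"
    for q X using that unfolding H_def by blast
  have HE: "\<exists>q\<in>module_hom R (sub X) M. y = q a \<and> (\<forall>b\<in>Domain \<Gamma> \<inter> X. q b = \<zero>\<^bsub>M\<^esub>)"
    if "y \<in> H X" for y X using that unfolding H_def by blast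
  have Hsubsp: "subsp (H X)" if X: "fd X" "a \<in> X" for X
  proof -
    interpret XM: module_pair R "sub X" M by (rule fd_module_pair[OF X(1)])
    show ?thesis
    proof (rule M.subsp_endo)
      show "H X \<subseteq> carrier M"
        using HE XM.hom_closed X(2) by fastforce
      show "\<zero>\<^bsub>M\<^esub> \<in> H X" using HI[OF XM.module_hom_zero_map] by simp
      fix x y assume "x \<in> H X" "y \<in> H X"
      then obtain p q where pq: "p \<in> module_hom R (sub X) M" "q \<in> module_hom R (sub X) M"
        "x = p a" "y = q a" "\<forall>b\<in>Domain \<Gamma> \<inter> X. p b = \<zero>\<^bsub>M\<^esub>" "\<forall>b\<in>Domain \<Gamma> \<inter> X. q b = \<zero>\<^bsub>M\<^esub>"
        using HE by metis
      then show "x \<oplus>\<^bsub>M\<^esub> y \<in> H X" using HI[OF XM.module_hom_add_map[OF pq(1,2)]] by simp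
    next
      fix e x assume e: "e \<in> module_hom R M M" and "x \<in> H X"
      then obtain q where q: "q \<in> module_hom R (sub X) M" "x = q a" "\<forall>b\<in>Domain \<Gamma> \<inter> X. q b = \<zero>\<^bsub>M\<^esub>"
        using HE by metis
      then show "e x \<in> H X" using HI[OF module_hom_comp[OF q(1) e]] M.MM.hom_zero[OF e] by simp
    qed
  qed
  obtain X1 where X1: "fd X1" "a \<in> X1" using fd_cover[OF a] by auto
  obtain X0 where X0: "fd X0" "a \<in> X0" and min: "\<And>Y. fd Y \<Longrightarrow> a \<in> Y \<Longrightarrow> rk (H X0) \<le> rk (H Y)"
    using ex_has_least_nat[of "\<lambda>X. fd X \<and> a \<in> X" X1 "\<lambda>X. rk (H X)"] X1 by auto
  have H_eq: "H Z = H X0" if Z: "fd Z" "X0 \<subseteq> Z" for Z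
  proof (rule M.rk_strict)
    have aZ: "a \<in> Z" using X0 Z by auto
    show "subsp (H Z)" "subsp (H X0)" using Hsubsp Z X0 aZ by auto
    show sub: "H Z \<subseteq> H X0"
    proof
      fix y assume "y \<in> H Z"
      then obtain q where q: "q \<in> module_hom R (sub Z) M" "y = q a" "\<forall>b\<in>Domain \<Gamma> \<inter> Z. q b = \<zero>\<^bsub>M\<^esub>"
        using HE by metis
      then show "y \<in> H X0" using HI[OF module_hom_restrict_carrier[OF q(1) Z(2)]] Z(2) by auto
    qed
    show "rk (H Z) = rk (H X0)"
      using M.rk_mono[OF Hsubsp[OF Z(1) aZ] Hsubsp[OF X0] sub] min[OF Z(1) aZ] by simp
  qed
  obtain q0 where q0: "q0 \<in> module_hom R (sub X0) ?N"
    and q0a: "\<And>b n. (b, n) \<in> \<Gamma> \<Longrightarrow> b \<in> X0 \<Longrightarrow> q0 b = n"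
    using partial_homD[OF \<Gamma> X0(1)] by metis
  have vN: "q0 a \<in> carrier ?N" using module_hom_mem[OF q0] X0(2) by simp
  have step: "\<exists>q. q \<in> module_hom R (sub X) ?N \<and>
      (\<forall>b n. (b, n) \<in> insert (a, q0 a) \<Gamma> \<longrightarrow> b \<in> X \<longrightarrow> q b = n)"
    if X: "fd X" for X
  proof -
    obtain Z where Z: "fd Z" "X0 \<subseteq> Z" "X \<subseteq> Z" using fd_directed[OF X0(1) X] by auto
    have aZ: "a \<in> Z" using Z X0 by auto
    interpret XM: module_pair R "sub X0" M by (rule fd_module_pair[OF X0(1)])
    interpret ZM: module_pair R "sub Z" M by (rule fd_module_pair[OF Z(1)])
    interpret ZN: module_pair R "sub Z" ?N by unfold_locales
    obtain q1 where q1: "q1 \<in> module_hom R (sub Z) ?N"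
      and q1a: "\<And>b n. (b, n) \<in> \<Gamma> \<Longrightarrow> b \<in> Z \<Longrightarrow> q1 b = n"
      using partial_homD[OF \<Gamma> Z(1)] by metis
    have q1N: "q1 a \<in> carrier ?N" using module_hom_mem[OF q1] aZ by simp
    note q1' = module_hom_restrict_carrier[OF q1 Z(2)]
    \<comment> \<open>the correction needed in coordinate \<open>i\<close>\<close>
    define d where "d i x = q0 x i \<ominus>\<^bsub>M\<^esub> q1 x i" for i x
    \<comment> \<open>\<open>e\<close> realises on \<open>Z\<close> the correction needed in coordinate \<open>i\<close>; it is zero where none is
      needed, so that the corrections combine to a map into the direct sum.\<close>
    define P where "P i e \<longleftrightarrow> e \<in> module_hom R (sub Z) M \<and> e a = d i a \<and>
      (\<forall>b\<in>Domain \<Gamma> \<inter> Z. e b = \<zero>\<^bsub>M\<^esub>) \<and> (d i a = \<zero>\<^bsub>M\<^esub> \<longrightarrow> (\<forall>x. e x = \<zero>\<^bsub>M\<^esub>))" for i e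
    have "\<exists>e. P i e"
      if i: "i \<in> I" for i
    proof (cases "d i a = \<zero>\<^bsub>M\<^esub>")
      case True
      then show ?thesis by (intro exI[of _ "\<lambda>x. \<zero>\<^bsub>M\<^esub>"]) (simp add: P_def ZM.module_hom_zero_map)
    next
      case False
      have "d i \<in> module_hom R (sub X0) M"
        unfolding d_def by (intro XM.module_hom_diff_map module_hom_comp[OF _ M.copower_component_hom[OF i]] q0 q1')
      then have "d i a \<in> H X0"
      proof (rule HI)
        fix b assume b: "b \<in> Domain \<Gamma>" "b \<in> X0"
        then obtain n where bn: "(b, n) \<in> \<Gamma>" by auto
        then have "n \<in> carrier ?N" using \<Gamma> unfolding partial_hom_def by auto
        then show "d i b = \<zero>\<^bsub>M\<^esub>"
          using q0a[OF bn b(2)] q1a[OF bn] b(2) Z(2) M.copower_closed[of n I i] i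
          by (auto simp: d_def M.M.minus_eq_zero_iff)
      qed
      then have "d i a \<in> H Z" using H_eq[OF Z(1,2)] by simp
      then show ?thesis using HE[of "d i a" Z] False unfolding P_def by auto
    qed
    then have "\<forall>i\<in>I. \<exists>e. P i e" by simp
    from bchoice[OF this] obtain e where "\<forall>i\<in>I. P i (e i)" by (elim exE)
    then have e: "\<And>i. i \<in> I \<Longrightarrow> e i \<in> module_hom R (sub Z) M"
      and ea: "\<And>i. i \<in> I \<Longrightarrow> e i a = d i a"
      and e0: "\<And>i b. i \<in> I \<Longrightarrow> b \<in> Domain \<Gamma> \<Longrightarrow> b \<in> Z \<Longrightarrow> e i b = \<zero>\<^bsub>M\<^esub>"
      and efin: "\<And>i x. i \<in> I \<Longrightarrow> d i a = \<zero>\<^bsub>M\<^esub> \<Longrightarrow> e i x = \<zero>\<^bsub>M\<^esub>"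
      by (simp_all add: P_def)
    have fin: "finite {i \<in> I. d i a \<noteq> \<zero>\<^bsub>M\<^esub>}"
    proof (rule finite_subset)
      show "{i \<in> I. d i a \<noteq> \<zero>\<^bsub>M\<^esub>} \<subseteq> {i \<in> I. q0 a i \<noteq> \<zero>\<^bsub>M\<^esub>} \<union> {i \<in> I. q1 a i \<noteq> \<zero>\<^bsub>M\<^esub>}"
        by (auto simp: d_def a_minus_def)
      show "finite ({i \<in> I. q0 a i \<noteq> \<zero>\<^bsub>M\<^esub>} \<union> {i \<in> I. q1 a i \<noteq> \<zero>\<^bsub>M\<^esub>})"
        using vN q1N by (simp add: M.copower_mem_iff)
    qed
    let ?e = "\<lambda>x. \<lambda>i\<in>I. e i x"
    have eh: "?e \<in> module_hom R (sub Z) ?N"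
      by (rule M.copower_family_hom[OF ZM.M.left_module_axioms e fin]) (use efin in auto)
    let ?q = "\<lambda>x. q1 x \<oplus>\<^bsub>?N\<^esub> ?e x"
    have qh: "?q \<in> module_hom R (sub Z) ?N" by (rule ZN.module_hom_add_map[OF q1 eh])
    have qcl: "?q x \<in> carrier ?N" if "x \<in> Z" for x using module_hom_mem[OF qh, of x] that by simp
    have "?q a = q0 a"
    proof (rule M.copower_ext[where I = I, OF qcl[OF aZ] vN])
      fix i assume i: "i \<in> I"
      have "q1 a i \<oplus>\<^bsub>M\<^esub> (q0 a i \<ominus>\<^bsub>M\<^esub> q1 a i) = q0 a i"
        using M.copower_closed[OF vN i] M.copower_closed[OF q1N i]
        by (simp add: a_minus_def M.M.a_lcomm M.M.r_neg)
      then show "?q a i = q0 a i" using i ea[OF i] by (simp add: M.copower_apply d_def)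
    qed
    moreover have "?q b = n" if bn: "(b, n) \<in> \<Gamma>" "b \<in> Z" for b n
    proof -
      have nN: "n \<in> carrier ?N" using \<Gamma> bn unfolding partial_hom_def by auto
      have b: "b \<in> Domain \<Gamma>" using bn by auto
      show ?thesis
        by (rule M.copower_ext[where I = I, OF qcl[OF bn(2)] nN])
           (use q1a[OF bn] e0[OF _ b bn(2)] M.copower_closed[OF nN] in \<open>simp add: M.copower_apply\<close>)
    qed
    ultimately show ?thesis
      using module_hom_restrict_carrier[OF qh Z(3)] Z(3) by (intro exI[of _ ?q]) auto
  qed
  show ?thesis
    using \<Gamma> a vN step by (intro exI[of _ "q0 a"]) (simp add: partial_hom_def)
qed

lemma partial_hom_total:
  assumes \<Gamma>: "partial_hom I \<Gamma>"
  shows "\<exists>\<rho>\<in>module_hom R S (copower M I). \<forall>a n. (a, n) \<in> \<Gamma> \<longrightarrow> \<rho> a = n"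
proof -
  let ?N = "copower M I" and ?A = "{\<Delta>. partial_hom I \<Delta> \<and> \<Gamma> \<subseteq> \<Delta>}"
  have "\<exists>\<Delta>\<in>?A. \<forall>X\<in>?A. \<Delta> \<subseteq> X \<longrightarrow> X = \<Delta>"
  proof (rule subset_Zorn_nonempty)
    show "?A \<noteq> {}" using \<Gamma> by blast
    fix \<C> assume ne: "\<C> \<noteq> {}" and ch: "subset.chain ?A \<C>"
    then have "subset.chain {\<Delta>. partial_hom I \<Delta>} \<C>" by (auto simp: subset.chain_def)
    then have "partial_hom I (\<Union>\<C>)" using ne by (rule partial_hom_Union)
    moreover have "\<Gamma> \<subseteq> \<Union>\<C>" using ne ch unfolding subset.chain_def by blast
    ultimately show "\<Union>\<C> \<in> ?A" by simp
  qed
  then obtain \<Delta> where "\<Delta> \<in> ?A" and "\<forall>X\<in>?A. \<Delta> \<subseteq> X \<longrightarrow> X = \<Delta>" by (elim bexE)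
  then have \<Delta>: "partial_hom I \<Delta>" "\<Gamma> \<subseteq> \<Delta>"
    and max: "\<And>X. partial_hom I X \<Longrightarrow> \<Gamma> \<subseteq> X \<Longrightarrow> \<Delta> \<subseteq> X \<Longrightarrow> X = \<Delta>" by simp_all
  have total: "\<exists>n. (a, n) \<in> \<Delta>" if a: "a \<in> carrier S" for a
  proof -
    obtain v where "partial_hom I (insert (a, v) \<Delta>)" using partial_hom_extend[OF \<Delta>(1) a] by auto
    then have "insert (a, v) \<Delta> = \<Delta>" by (rule max) (use \<Delta>(2) in auto)
    then show ?thesis by auto
  qed
  then have "\<forall>a\<in>carrier S. \<exists>n. (a, n) \<in> \<Delta>" by blast
  then obtain p where p: "\<forall>a\<in>carrier S. (a, p a) \<in> \<Delta>" by metis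
  have pN: "p a \<in> carrier ?N" if "a \<in> carrier S" for a
    using p \<Delta>(1) that unfolding partial_hom_def by auto
  have loc: "\<exists>q. q \<in> module_hom R (sub X) ?N \<and> (\<forall>x\<in>X. q x = p x)" if X: "fd X" for X
  proof -
    have XS: "X \<subseteq> carrier S" using S.submoduleD(1)[OF fd_submodule[OF X]] .
    obtain q where q: "q \<in> module_hom R (sub X) ?N"
      and "\<And>a n. (a, n) \<in> \<Delta> \<Longrightarrow> a \<in> X \<Longrightarrow> q a = n"
      using partial_homD[OF \<Delta>(1) X] by metis
    then have "\<forall>x\<in>X. q x = p x" using p XS by blast
    then show ?thesis using q by blast
  qed
  have "p \<in> module_hom R S ?N"
  proof (rule module_homI)
    fix x y assume xy: "x \<in> carrier S" "y \<in> carrier S"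
    obtain X Y where "fd X" "x \<in> X" "fd Y" "y \<in> Y" using fd_cover xy by metis
    then obtain Z where Z: "fd Z" "x \<in> Z" "y \<in> Z" using fd_directed[of X Y] by auto
    note Z' = S.submoduleD[OF fd_submodule[OF Z(1)]]
    obtain q where "q \<in> module_hom R (sub Z) ?N" "\<forall>x\<in>Z. q x = p x" using loc[OF Z(1)] by auto
    then show "p (x \<oplus>\<^bsub>S\<^esub> y) = p x \<oplus>\<^bsub>?N\<^esub> p y"
      using module_hom_add[of q R "sub Z" ?N x y] Z Z'(3) by simp
  next
    fix a x assume ax: "a \<in> carrier R" "x \<in> carrier S"
    obtain Z where Z: "fd Z" "x \<in> Z" using fd_cover ax by metis
    note Z' = S.submoduleD[OF fd_submodule[OF Z(1)]]
    obtain q where "q \<in> module_hom R (sub Z) ?N" "\<forall>x\<in>Z. q x = p x" using loc[OF Z(1)] by auto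
    then show "p (a \<odot>\<^bsub>S\<^esub> x) = a \<odot>\<^bsub>?N\<^esub> p x"
      using module_hom_smult[of q R "sub Z" ?N a x] Z Z'(4) ax by simp
  qed (rule pN)
  moreover have "p a = n" if an: "(a, n) \<in> \<Gamma>" for a n
  proof -
    have a: "a \<in> carrier S" using \<Gamma> an unfolding partial_hom_def by auto
    obtain X where X: "fd X" "a \<in> X" using fd_cover[OF a] by auto
    obtain q where "\<And>a n. (a, n) \<in> \<Delta> \<Longrightarrow> a \<in> X \<Longrightarrow> q a = n"
      using partial_homD[OF \<Delta>(1) X(1)] by metis
    then have "q a = p a" "q a = n" using an p a X(2) \<Delta>(2) by blast+
    then show ?thesis by simp
  qed
  ultimately show ?thesis by blast
qed

text \<open>
  The inverse of \<open>\<phi>\<close> on its image is a partial homomorphism: the intersection of the image with a finite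
  dimensional submodule lies in the image of a finite subsum, where a retraction is given.
\<close>

lemma locally_split_imp_split:
  assumes \<phi>: "\<phi> \<in> module_hom R (copower M I) S"
    and loc: "\<And>F. finite F \<Longrightarrow> F \<subseteq> I \<Longrightarrow> \<exists>\<rho>\<in>module_hom R S (copower M I).
      \<forall>v\<in>carrier (copower M I). (\<forall>i\<in>I - F. v i = \<zero>\<^bsub>M\<^esub>) \<longrightarrow> \<rho> (\<phi> v) = v"
  shows "\<exists>\<rho>\<in>module_hom R S (copower M I). \<forall>v\<in>carrier (copower M I). \<rho> (\<phi> v) = v"
proof -
  let ?N = "copower M I" and ?\<Gamma> = "{(\<phi> v, v) | v. v \<in> carrier (copower M I)}"
  interpret N: left_module R ?N by (rule M.copower_left_module)
  interpret NS: module_pair R ?N S by unfold_locales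
  define supp where "supp v = {i \<in> I. v i \<noteq> \<zero>\<^bsub>M\<^esub>}" for v
  have fin: "finite (supp v)" if "v \<in> carrier ?N" for v
    using that by (simp add: supp_def M.copower_mem_iff)
  have "\<exists>q. q \<in> module_hom R (sub X) ?N \<and> (\<forall>a n. (a, n) \<in> ?\<Gamma> \<longrightarrow> a \<in> X \<longrightarrow> q a = n)"
    if X: "fd X" for X
  proof -
    let ?P = "X \<inter> \<phi> ` carrier ?N"
    obtain T where T: "finite T" "T \<subseteq> ?P"
      and gen: "\<And>W. Module.submodule W R S \<Longrightarrow> T \<subseteq> W \<Longrightarrow> ?P \<subseteq> W"
      using fd_noetherian[OF X, of ?P] by auto
    have "\<forall>t\<in>T. \<exists>v. v \<in> carrier ?N \<and> t = \<phi> v" using T(2) by auto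
    from bchoice[OF this] obtain w where w: "\<And>t. t \<in> T \<Longrightarrow> w t \<in> carrier ?N \<and> t = \<phi> (w t)" by auto
    define F where "F = (\<Union>t\<in>T. supp (w t))"
    have F: "finite F" "F \<subseteq> I" using T(1) w fin by (auto simp: F_def supp_def)
    let ?W = "{v \<in> carrier ?N. \<forall>i\<in>I - F. v i = \<zero>\<^bsub>M\<^esub>}"
    have W: "Module.submodule ?W R ?N"
      by (rule N.submoduleI) (auto simp: M.copower_apply N.smult_closed)
    have PW: "?P \<subseteq> \<phi> ` ?W"
    proof (rule gen[OF NS.image_submodule[OF \<phi> W]])
      show "T \<subseteq> \<phi> ` ?W"
      proof
        fix t assume t: "t \<in> T"
        then have "w t \<in> ?W" using w by (auto simp: F_def supp_def)
        moreover have "t = \<phi> (w t)" using w[OF t] by simp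
        ultimately show "t \<in> \<phi> ` ?W" by (intro image_eqI[where x = "w t"])
      qed
    qed
    obtain \<rho> where \<rho>: "\<rho> \<in> module_hom R S ?N" "\<And>v. v \<in> ?W \<Longrightarrow> \<rho> (\<phi> v) = v"
      using loc[OF F] by (elim bexE) simp
    have ret: "\<rho> (\<phi> v) = v" if v: "v \<in> carrier ?N" "\<phi> v \<in> X" for v
    proof -
      have "\<phi> v \<in> \<phi> ` ?W" using v by (intro subsetD[OF PW] IntI imageI)
      then obtain u where u: "u \<in> ?W" "\<phi> v = \<phi> u" by auto
      have "finite (F \<union> supp v)" "F \<union> supp v \<subseteq> I" using F fin[OF v(1)] by (auto simp: supp_def)
      \<comment> \<open>\<open>\<phi>\<close> is injective on the finite subsum containing both \<open>u\<close> and \<open>v\<close>.\<close>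
      then obtain \<rho>' where \<rho>': "\<And>v'. v' \<in> carrier ?N \<Longrightarrow> (\<forall>i\<in>I - (F \<union> supp v). v' i = \<zero>\<^bsub>M\<^esub>) \<Longrightarrow> \<rho>' (\<phi> v') = v'"
        using loc[of "F \<union> supp v"] by auto
      have "v = \<rho>' (\<phi> v)" by (rule \<rho>'[symmetric]) (use v(1) in \<open>auto simp: supp_def\<close>)
      also have "\<dots> = \<rho>' (\<phi> u)" by (rule arg_cong[OF u(2)])
      also have "\<dots> = u" by (rule \<rho>') (use u(1) in auto)
      finally have "v = u" .
      then show ?thesis using \<rho>(2)[OF u(1)] by (rule ssubst[where P = "\<lambda>x. \<rho> (\<phi> x) = x"])
    qed
    show ?thesis
    proof (intro exI[of _ \<rho>] conjI allI impI)
      show "\<rho> \<in> module_hom R (sub X) ?N"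
        using module_hom_restrict_carrier[where f = \<rho> and S = S and Y = "carrier S" and N = ?N] \<rho>(1)
          S.submoduleD(1)[OF fd_submodule[OF X]] by simp
      fix a n assume "(a, n) \<in> ?\<Gamma>" "a \<in> X"
      then show "\<rho> a = n" using ret[of n] by simp
    qed
  qed
  note ext = this
  have "?\<Gamma> \<subseteq> carrier S \<times> carrier ?N" using module_hom_mem[OF \<phi>] by auto
  then have "partial_hom I ?\<Gamma>" unfolding partial_hom_def by (intro conjI allI impI ext)
  from partial_hom_total[OF this] obtain \<rho> where \<rho>: "\<rho> \<in> module_hom R S ?N"
    and r: "\<forall>a n. (a, n) \<in> ?\<Gamma> \<longrightarrow> \<rho> a = n" by (elim bexE)
  show ?thesis
  proof (intro bexI[of _ \<rho>] ballI \<rho>)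
    fix v assume "v \<in> carrier ?N"
    then have "(\<phi> v, v) \<in> ?\<Gamma>" by (intro CollectI exI[of _ v] conjI refl)
    then show "\<rho> (\<phi> v) = v" by (rule r[rule_format])
  qed
qed

end

section \<open>Homomorphisms modulo those that are not split injective\<close>

text \<open>
  Right vector spaces over a division ring are treated as left vector spaces over its opposite.
\<close>

definition opposite_ring :: "('d, 'a) ring_scheme \<Rightarrow> ('d, 'a) ring_scheme" where
  "opposite_ring D = D\<lparr>mult := \<lambda>a b. b \<otimes>\<^bsub>D\<^esub> a\<rparr>"

lemma opposite_ring_simps [simp]:
  "carrier (opposite_ring D) = carrier D" "\<zero>\<^bsub>opposite_ring D\<^esub> = \<zero>\<^bsub>D\<^esub>" "\<one>\<^bsub>opposite_ring D\<^esub> = \<one>\<^bsub>D\<^esub>"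
  "a \<oplus>\<^bsub>opposite_ring D\<^esub> b = a \<oplus>\<^bsub>D\<^esub> b" "a \<otimes>\<^bsub>opposite_ring D\<^esub> b = b \<otimes>\<^bsub>D\<^esub> a"
  by (simp_all add: opposite_ring_def)

lemma ring_opposite_ring:
  assumes "ring D" shows "ring (opposite_ring D)"
proof -
  interpret D: ring D by fact
  have "abelian_group (opposite_ring D)"
  proof (rule abelian_groupI)
    fix x assume "x \<in> carrier (opposite_ring D)"
    then show "\<exists>y\<in>carrier (opposite_ring D). y \<oplus>\<^bsub>opposite_ring D\<^esub> x = \<zero>\<^bsub>opposite_ring D\<^esub>"
      using D.l_neg D.a_inv_closed by auto
  qed (simp_all add: D.a_ac)
  moreover have "Group.monoid (opposite_ring D)"
    by (rule monoidI) (simp_all add: D.m_assoc)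
  ultimately show ?thesis by (intro ringI) (simp_all add: D.l_distr D.r_distr)
qed

lemma right_basis_opposite_ring: "right_basis (opposite_ring D) V B = right_basis D V B"
  by (simp add: right_basis_def)

locale local_endo_pair = module_pair R M N + E: fitting_ring "endo_ring R M"
  for R :: "('r, 'a) ring_scheme"
    and M :: "('r, 'm, 'c) module_scheme" and N :: "('r, 'n, 'd) module_scheme"
begin

abbreviation "Hom \<equiv> hom_group R M N"
abbreviation "End \<equiv> endo_ring R M"
abbreviation "J \<equiv> non_split_homs R M N"
abbreviation "V \<equiv> split_hom R M N"
abbreviation "D \<equiv> residue_ring_End R M"
abbreviation "rcomp f e \<equiv> compose (carrier M) f e"
abbreviation "cls f \<equiv> J +>\<^bsub>Hom\<^esub> f"

lemma restrict_End: "e \<in> module_hom R M M \<Longrightarrow> (\<lambda>x\<in>carrier M. e x) \<in> carrier End"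
  unfolding M.carrier_endo_ring
  by (rule module_pair.restrict_module_hom) (unfold_locales)

lemma comp_closed: "f \<in> carrier Hom \<Longrightarrow> e \<in> carrier End \<Longrightarrow> rcomp f e \<in> carrier Hom"
  using restrict_module_hom[OF module_hom_comp[OF M.endo_module_hom hom_groupD], of e f]
  by (simp add: compose_def)

lemma comp_apply: "x \<in> carrier M \<Longrightarrow> rcomp f e x = f (e x)"
  by (simp add: compose_def)

lemma comp_add_left:
  assumes "f \<in> carrier Hom" "f' \<in> carrier Hom" "e \<in> carrier End"
  shows "rcomp (f \<oplus>\<^bsub>Hom\<^esub> f') e = rcomp f e \<oplus>\<^bsub>Hom\<^esub> rcomp f' e"
  using assms by (intro hom_group_ext[of _ R M N] comp_closed H.a_closed)
    (simp_all add: comp_apply hom_group_add_apply M.endo_closed)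

lemma comp_add_right:
  assumes "f \<in> carrier Hom" "e \<in> carrier End" "e' \<in> carrier End"
  shows "rcomp f (e \<oplus>\<^bsub>End\<^esub> e') = rcomp f e \<oplus>\<^bsub>Hom\<^esub> rcomp f e'"
  using assms by (intro hom_group_ext[of _ R M N] comp_closed H.a_closed E.a_closed)
    (simp_all add: comp_apply hom_group_add_apply M.endo_closed M.endo_apply module_hom_add[OF hom_groupD])

lemma comp_assoc:
  assumes "f \<in> carrier Hom" "e \<in> carrier End" "e' \<in> carrier End"
  shows "rcomp (rcomp f e) e' = rcomp f (e \<otimes>\<^bsub>End\<^esub> e')"
  using assms by (intro hom_group_ext[of _ R M N] comp_closed E.m_closed)
    (simp_all add: comp_apply M.endo_closed M.endo_apply)

lemma comp_one: "f \<in> carrier Hom \<Longrightarrow> rcomp f \<one>\<^bsub>End\<^esub> = f"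
  by (intro hom_group_ext[of _ R M N] comp_closed E.one_closed) (simp_all add: comp_apply M.endo_apply)

text \<open>
  The composition \<open>g \<circ> f\<close> as an element of the endomorphism ring. Modulo the radical it is a pairing of
  \<open>Hom(N, M)\<close> with \<open>Hom(M, N)\<close>, and \<open>J\<close> is the part of \<open>Hom(M, N)\<close> orthogonal to everything.
\<close>

definition pairing :: "('n \<Rightarrow> 'm) \<Rightarrow> ('m \<Rightarrow> 'n) \<Rightarrow> 'm \<Rightarrow> 'm" where
  "pairing g f = (\<lambda>x\<in>carrier M. g (f x))"

lemma pairing_closed: "g \<in> module_hom R N M \<Longrightarrow> f \<in> carrier Hom \<Longrightarrow> pairing g f \<in> carrier End"
  unfolding pairing_def by (rule restrict_End[OF module_hom_comp[OF hom_groupD]])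

lemma pairing_apply: "x \<in> carrier M \<Longrightarrow> pairing g f x = g (f x)"
  by (simp add: pairing_def)

lemma pairing_add:
  assumes "g \<in> module_hom R N M" "f \<in> carrier Hom" "f' \<in> carrier Hom"
  shows "pairing g (f \<oplus>\<^bsub>Hom\<^esub> f') = pairing g f \<oplus>\<^bsub>End\<^esub> pairing g f'"
  using assms by (intro M.endo_ext pairing_closed H.a_closed E.a_closed)
    (simp_all add: pairing_apply M.endo_apply hom_group_add_apply module_hom_add[OF assms(1)] hom_group_closed)

lemma pairing_comp:
  assumes "g \<in> module_hom R N M" "f \<in> carrier Hom" "e \<in> carrier End"
  shows "pairing g (rcomp f e) = pairing g f \<otimes>\<^bsub>End\<^esub> e"
  using assms by (intro M.endo_ext pairing_closed comp_closed E.m_closed)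
    (simp_all add: pairing_apply M.endo_apply comp_apply M.endo_closed)

text \<open>
  If \<open>g \<circ> f\<close> is a unit \<open>u\<close>, then \<open>inv u \<circ> g\<close> is a left inverse of \<open>f\<close>.
\<close>

lemma non_split_iff:
  assumes f: "f \<in> carrier Hom"
  shows "f \<in> J \<longleftrightarrow> (\<forall>g\<in>module_hom R N M. pairing g f \<in> E.nonunits)"
proof
  assume fJ: "f \<in> J"
  show "\<forall>g\<in>module_hom R N M. pairing g f \<in> E.nonunits"
  proof
    fix g assume g: "g \<in> module_hom R N M"
    note u = pairing_closed[OF g f]
    have False if un: "pairing g f \<in> Units End"
    proof -
      let ?u = "inv\<^bsub>End\<^esub> (pairing g f)"
      have uc: "?u \<in> carrier End" using E.Units_inv_closed[OF un] .
      let ?g = "\<lambda>x\<in>carrier N. ?u (g x)"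
      have NM: "module_pair R N M" by unfold_locales
      have "?g \<in> carrier (hom_group R N M)"
        by (rule module_pair.restrict_module_hom[OF NM module_hom_comp[OF g M.endo_module_hom[OF uc]]])
      moreover have "compose (carrier M) ?g f = (\<lambda>x\<in>carrier M. x)"
      proof
        fix x
        show "compose (carrier M) ?g f x = (\<lambda>x\<in>carrier M. x) x"
        proof (cases "x \<in> carrier M")
          case True
          have "(?u \<otimes>\<^bsub>End\<^esub> pairing g f) x = \<one>\<^bsub>End\<^esub> x" using E.Units_l_inv[OF un] by simp
          then show ?thesis using True hom_group_closed[OF f True]
            by (simp add: compose_def M.endo_apply pairing_apply)
        qed (simp add: compose_def)
      qed
      ultimately show False using fJ unfolding non_split_homs_def by blast
    qed
    then show "pairing g f \<in> E.nonunits" using u by blast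
  qed
next
  assume a: "\<forall>g\<in>module_hom R N M. pairing g f \<in> E.nonunits"
  have False if g: "g \<in> carrier (hom_group R N M)" "compose (carrier M) g f = (\<lambda>x\<in>carrier M. x)" for g
  proof -
    have "pairing g f = \<one>\<^bsub>End\<^esub>" using g(2) by (simp add: pairing_def endo_ring_def compose_def)
    then show False using a hom_groupD[OF g(1)] E.Units_one_closed by auto
  qed
  then show "f \<in> J" using f unfolding non_split_homs_def by blast
qed

lemma J_subset: "J \<subseteq> carrier Hom"
  by (auto simp: non_split_homs_def)

lemma J_pairing: "f \<in> J \<Longrightarrow> g \<in> module_hom R N M \<Longrightarrow> pairing g f \<in> E.nonunits"
  using J_subset non_split_iff by blast

lemma J_add:
  assumes "f \<in> J" "f' \<in> J" shows "f \<oplus>\<^bsub>Hom\<^esub> f' \<in> J"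
proof -
  have c: "f \<in> carrier Hom" "f' \<in> carrier Hom" using assms J_subset by auto
  have "pairing g (f \<oplus>\<^bsub>Hom\<^esub> f') \<in> E.nonunits" if g: "g \<in> module_hom R N M" for g
    unfolding pairing_add[OF g c] using assms g by (intro E.add_nonunit J_pairing)
  then show ?thesis using c by (simp add: non_split_iff)
qed

lemma J_comp:
  assumes "f \<in> J" "e \<in> carrier End" shows "rcomp f e \<in> J"
proof -
  have c: "f \<in> carrier Hom" using assms J_subset by auto
  have "pairing g (rcomp f e) \<in> E.nonunits" if g: "g \<in> module_hom R N M" for g
    unfolding pairing_comp[OF g c assms(2)] using assms g by (intro E.mult_nonunit(1) J_pairing)
  then show ?thesis using c assms(2) by (simp add: non_split_iff comp_closed)
qed

lemma comp_nonunit: "f \<in> carrier Hom \<Longrightarrow> e \<in> E.nonunits \<Longrightarrow> rcomp f e \<in> J"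
  using E.mult_nonunit(2) by (simp add: non_split_iff pairing_comp comp_closed pairing_closed)

lemma pairing_zero:
  assumes "g \<in> module_hom R N M"
  shows "pairing g \<zero>\<^bsub>Hom\<^esub> = \<zero>\<^bsub>End\<^esub>"
proof -
  interpret NM: module_pair R N M by unfold_locales
  show ?thesis
    using assms by (intro M.endo_ext pairing_closed H.zero_closed E.zero_closed)
      (simp_all add: pairing_apply M.endo_apply hom_group_zero_apply NM.hom_zero)
qed

lemma J_zero: "\<zero>\<^bsub>Hom\<^esub> \<in> J"
  using E.zero_nonunit by (simp add: non_split_iff pairing_zero)

lemma J_minus:
  assumes f: "f \<in> J" shows "\<ominus>\<^bsub>Hom\<^esub> f \<in> J"
proof -
  have c: "f \<in> carrier Hom" "\<ominus>\<^bsub>Hom\<^esub> f \<in> carrier Hom" using f J_subset by auto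
  have "pairing g (\<ominus>\<^bsub>Hom\<^esub> f) \<in> E.nonunits" if g: "g \<in> module_hom R N M" for g
  proof -
    have "pairing g (\<ominus>\<^bsub>Hom\<^esub> f) \<oplus>\<^bsub>End\<^esub> pairing g f = \<zero>\<^bsub>End\<^esub>"
      using pairing_add[OF g c(2,1)] pairing_zero[OF g] c by (simp add: H.l_neg)
    then have "\<ominus>\<^bsub>End\<^esub> pairing g f = pairing g (\<ominus>\<^bsub>Hom\<^esub> f)"
      by (rule E.minus_equality[OF _ pairing_closed[OF g c(1)] pairing_closed[OF g c(2)]])
    then show ?thesis using E.minus_nonunit[OF J_pairing[OF f g]] by simp
  qed
  then show ?thesis using c by (simp add: non_split_iff)
qed

lemma J_abelian_subgroup: "abelian_subgroup J Hom"
proof (rule abelian_subgroupI3)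
  show "additive_subgroup J Hom"
  proof (intro additive_subgroup.intro subgroup.intro)
    fix f assume "f \<in> J"
    moreover have "inv\<^bsub>add_monoid Hom\<^esub> f = \<ominus>\<^bsub>Hom\<^esub> f" by (simp add: a_inv_def)
    ultimately show "inv\<^bsub>add_monoid Hom\<^esub> f \<in> J" using J_minus by simp
  qed (use J_subset J_add J_zero in auto)
qed (rule hom_group_abelian)

sublocale J: abelian_subgroup J Hom
  by (rule J_abelian_subgroup)

lemma carrier_V: "carrier V = cls ` carrier Hom"
  by (auto simp: split_hom_def Let_def A_RCOSETS_def')

lemma cls_closed: "f \<in> carrier Hom \<Longrightarrow> cls f \<in> carrier V"
  by (simp add: carrier_V)

lemma cls_add:
  "f \<in> carrier Hom \<Longrightarrow> f' \<in> carrier Hom \<Longrightarrow> cls f \<oplus>\<^bsub>V\<^esub> cls f' = cls (f \<oplus>\<^bsub>Hom\<^esub> f')"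
  by (simp add: split_hom_def Let_def J.a_rcos_sum)

lemma cls_eq_zero_iff:
  assumes "f \<in> carrier Hom"
  shows "cls f = \<zero>\<^bsub>V\<^esub> \<longleftrightarrow> f \<in> J"
  using J.a_rcos_const[of f] J.a_rcos_self[OF assms] by (auto simp: split_hom_def Let_def)

lemma D_eq: "D = End Quot E.nonunits"
  by (simp add: residue_ring_End_def E.jacobson_radical_eq_nonunits)

lemma carrier_D: "carrier D = (\<lambda>e. E.nonunits +>\<^bsub>End\<^esub> e) ` carrier End"
  by (auto simp: D_eq FactRing_def A_RCOSETS_def')

text \<open>
  Changing \<open>f\<close> by an element of \<open>J\<close>, or \<open>e\<close> by a non-unit, changes \<open>f \<circ> e\<close> by an element of
  \<open>J\<close>, so the union in the definition of the scalar multiplication is a single coset.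
\<close>

lemma cls_smult:
  assumes f: "f \<in> carrier Hom" and e: "e \<in> carrier End"
  shows "(E.nonunits +>\<^bsub>End\<^esub> e) \<odot>\<^bsub>V\<^esub> cls f = cls (rcomp f e)"
proof -
  have key: "cls (rcomp f' e') = cls (rcomp f e)"
    if f': "f' \<in> cls f" and e': "e' \<in> E.nonunits +>\<^bsub>End\<^esub> e" for f' e'
  proof -
    obtain j where j: "j \<in> J" "f' = j \<oplus>\<^bsub>Hom\<^esub> f" using f' unfolding a_r_coset_def' by blast
    obtain n where n: "n \<in> E.nonunits" "e' = n \<oplus>\<^bsub>End\<^esub> e" using e' unfolding a_r_coset_def' by blast
    have jc: "j \<in> carrier Hom" and nc: "n \<in> carrier End" using j n J_subset by auto
    have e'c: "e' \<in> carrier End" using n nc e by simp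
    have "rcomp f' e' = rcomp j e' \<oplus>\<^bsub>Hom\<^esub> rcomp f e'" unfolding j(2) by (rule comp_add_left[OF jc f e'c])
    also have "rcomp f e' = rcomp f n \<oplus>\<^bsub>Hom\<^esub> rcomp f e" unfolding n(2) by (rule comp_add_right[OF f nc e])
    finally have "rcomp f' e' = (rcomp j e' \<oplus>\<^bsub>Hom\<^esub> rcomp f n) \<oplus>\<^bsub>Hom\<^esub> rcomp f e"
      using comp_closed f e jc nc e'c by (simp add: H.a_assoc)
    moreover have "rcomp j e' \<oplus>\<^bsub>Hom\<^esub> rcomp f n \<in> J"
      by (intro J_add J_comp[OF j(1) e'c] comp_nonunit[OF f n(1)])
    ultimately have "rcomp f' e' \<in> cls (rcomp f e)" unfolding a_r_coset_def' by blast
    then show ?thesis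
      using H.a_repr_independence[OF _ comp_closed[OF f e] J.a_subgroup] by simp
  qed
  have "f \<in> cls f" "e \<in> E.nonunits +>\<^bsub>End\<^esub> e"
    using J.a_rcos_self[OF f] E.nonunits.a_rcos_self[OF e] by auto
  then have "(\<Union>f'\<in>cls f. \<Union>e'\<in>E.nonunits +>\<^bsub>End\<^esub> e. cls (rcomp f' e')) = cls (rcomp f e)"
    using key by blast
  then show ?thesis by (simp add: split_hom_def Let_def)
qed

lemma V_abelian_group: "abelian_group V"
proof (rule abelian_groupI)
  have zero: "\<zero>\<^bsub>V\<^esub> = cls \<zero>\<^bsub>Hom\<^esub>"
    using cls_eq_zero_iff[OF H.zero_closed] J_zero by simp
  then show "\<zero>\<^bsub>V\<^esub> \<in> carrier V" by (simp add: cls_closed)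
  fix x assume "x \<in> carrier V"
  then obtain f where f: "f \<in> carrier Hom" "x = cls f" by (auto simp: carrier_V)
  show "\<zero>\<^bsub>V\<^esub> \<oplus>\<^bsub>V\<^esub> x = x" using f by (simp add: zero cls_add)
  show "\<exists>y\<in>carrier V. y \<oplus>\<^bsub>V\<^esub> x = \<zero>\<^bsub>V\<^esub>"
    using f by (intro bexI[of _ "cls (\<ominus>\<^bsub>Hom\<^esub> f)"]) (simp_all add: zero cls_add cls_closed H.l_neg)
  fix y assume "y \<in> carrier V"
  then obtain g where g: "g \<in> carrier Hom" "y = cls g" by (auto simp: carrier_V)
  show "x \<oplus>\<^bsub>V\<^esub> y \<in> carrier V" using f g by (simp add: cls_add cls_closed)
  show "x \<oplus>\<^bsub>V\<^esub> y = y \<oplus>\<^bsub>V\<^esub> x" using f g by (simp add: cls_add H.a_comm)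
  fix z assume "z \<in> carrier V"
  then obtain h where h: "h \<in> carrier Hom" "z = cls h" by (auto simp: carrier_V)
  show "x \<oplus>\<^bsub>V\<^esub> y \<oplus>\<^bsub>V\<^esub> z = x \<oplus>\<^bsub>V\<^esub> (y \<oplus>\<^bsub>V\<^esub> z)" using f g h by (simp add: cls_add H.a_assoc)
qed

lemma D_ring: "ring D"
  unfolding D_eq by (rule E.nonunits.quotient_is_ring)

lemma D_ops:
  assumes "e \<in> carrier End" "e' \<in> carrier End"
  shows "(E.nonunits +>\<^bsub>End\<^esub> e) \<oplus>\<^bsub>D\<^esub> (E.nonunits +>\<^bsub>End\<^esub> e') = E.nonunits +>\<^bsub>End\<^esub> (e \<oplus>\<^bsub>End\<^esub> e')"
    and "(E.nonunits +>\<^bsub>End\<^esub> e) \<otimes>\<^bsub>D\<^esub> (E.nonunits +>\<^bsub>End\<^esub> e') = E.nonunits +>\<^bsub>End\<^esub> (e \<otimes>\<^bsub>End\<^esub> e')"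
  using assms E.nonunits.a_rcos_sum E.nonunits.rcoset_mult_add by (simp_all add: D_eq FactRing_def)

lemma split_hom_vector_space: "left_vector_space (opposite_ring D) V"
proof (intro left_vector_space.intro left_module.intro left_vector_space_axioms.intro
    left_module_axioms.intro ring_opposite_ring D_ring V_abelian_group)
  let ?O = "opposite_ring D"
  have one: "\<one>\<^bsub>?O\<^esub> = E.nonunits +>\<^bsub>End\<^esub> \<one>\<^bsub>End\<^esub>" by (simp add: D_eq FactRing_def)
  show "\<one>\<^bsub>?O\<^esub> \<noteq> \<zero>\<^bsub>?O\<^esub>" using E.quotient_one_neq_zero by (simp add: D_eq)
  show "\<exists>d\<in>carrier ?O. d \<otimes>\<^bsub>?O\<^esub> c = \<one>\<^bsub>?O\<^esub>" if "c \<in> carrier ?O" "c \<noteq> \<zero>\<^bsub>?O\<^esub>" for c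
    using E.quotient_inverse[of c] that by (simp add: D_eq)
  note ops = cls_smult cls_add D_ops comp_closed
  fix a x assume "a \<in> carrier ?O" "x \<in> carrier V"
  then obtain e f where e: "e \<in> carrier End" "a = E.nonunits +>\<^bsub>End\<^esub> e" and f: "f \<in> carrier Hom" "x = cls f"
    by (auto simp: carrier_V carrier_D)
  show "a \<odot>\<^bsub>V\<^esub> x \<in> carrier V" using e f by (simp add: ops cls_closed)
  {
    fix y assume "y \<in> carrier V"
    then obtain f' where "f' \<in> carrier Hom" "y = cls f'" by (auto simp: carrier_V)
    then show "a \<odot>\<^bsub>V\<^esub> (x \<oplus>\<^bsub>V\<^esub> y) = a \<odot>\<^bsub>V\<^esub> x \<oplus>\<^bsub>V\<^esub> a \<odot>\<^bsub>V\<^esub> y"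
      using e f by (simp add: ops comp_add_left)
  }
next
  fix a b x assume "a \<in> carrier (opposite_ring D)" "b \<in> carrier (opposite_ring D)" "x \<in> carrier V"
  then obtain e e' f where e: "e \<in> carrier End" "a = E.nonunits +>\<^bsub>End\<^esub> e"
    and e': "e' \<in> carrier End" "b = E.nonunits +>\<^bsub>End\<^esub> e'" and f: "f \<in> carrier Hom" "x = cls f"
    by (auto simp: carrier_V carrier_D)
  note ops = cls_smult cls_add D_ops comp_closed
  show "(a \<oplus>\<^bsub>opposite_ring D\<^esub> b) \<odot>\<^bsub>V\<^esub> x = a \<odot>\<^bsub>V\<^esub> x \<oplus>\<^bsub>V\<^esub> b \<odot>\<^bsub>V\<^esub> x"
    using e e' f by (simp add: ops comp_add_right)
  show "(a \<otimes>\<^bsub>opposite_ring D\<^esub> b) \<odot>\<^bsub>V\<^esub> x = a \<odot>\<^bsub>V\<^esub> (b \<odot>\<^bsub>V\<^esub> x)"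
    using e e' f by (simp add: ops comp_assoc)
next
  fix x assume "x \<in> carrier V"
  then obtain f where f: "f \<in> carrier Hom" "x = cls f" by (auto simp: carrier_V)
  show "\<one>\<^bsub>opposite_ring D\<^esub> \<odot>\<^bsub>V\<^esub> x = x"
    using f cls_smult[OF f(1) E.one_closed] by (simp add: D_eq FactRing_def comp_one)
qed

sublocale V: left_vector_space "opposite_ring D" V
  by (rule split_hom_vector_space)

end

context module_pair
begin

lemma hom_finsum:
  assumes f: "f \<in> module_hom R M N" and "finite A" "\<And>a. a \<in> A \<Longrightarrow> u a \<in> carrier M"
  shows "f (\<Oplus>\<^bsub>M\<^esub>a\<in>A. u a) = (\<Oplus>\<^bsub>N\<^esub>a\<in>A. f (u a))"
  using assms(2,3)
proof (induction A)
  case empty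
  then show ?case by (simp add: hom_zero[OF f])
next
  case (insert a A)
  have uM: "u \<in> A \<rightarrow> carrier M" "u a \<in> carrier M" using insert by auto
  have fN: "(\<lambda>a. f (u a)) \<in> A \<rightarrow> carrier N" "f (u a) \<in> carrier N"
    using uM hom_closed[OF f] by auto
  have "f (\<Oplus>\<^bsub>M\<^esub>a\<in>insert a A. u a) = f (u a) \<oplus>\<^bsub>N\<^esub> f (\<Oplus>\<^bsub>M\<^esub>a\<in>A. u a)"
    using insert.hyps uM by (simp add: M.finsum_insert module_hom_add[OF f])
  also have "f (\<Oplus>\<^bsub>M\<^esub>a\<in>A. u a) = (\<Oplus>\<^bsub>N\<^esub>a\<in>A. f (u a))" using insert by simp
  finally show ?case using insert.hyps fN by (simp add: N.finsum_insert)
qed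

text \<open>
  The universal property of the direct sum. The sum may be taken over any finite set that contains the
  support of \<open>v\<close>.
\<close>

lemma copower_sum_hom:
  assumes fam: "\<forall>i\<in>I. f i \<in> module_hom R M N"
  shows "\<exists>\<phi>. \<phi> \<in> module_hom R (copower M I) N \<and>
    (\<forall>v F. v \<in> carrier (copower M I) \<longrightarrow> finite F \<longrightarrow> F \<subseteq> I \<longrightarrow> (\<forall>i\<in>I - F. v i = \<zero>\<^bsub>M\<^esub>) \<longrightarrow>
      \<phi> v = (\<Oplus>\<^bsub>N\<^esub>i\<in>F. f i (v i)))"
proof -
  let ?C = "copower M I"
  interpret C: left_module R ?C by (rule M.copower_left_module)
  interpret NN: module_pair R N N by unfold_locales
  have f: "f i \<in> module_hom R M N" if "i \<in> I" for i using fam that by simp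
  define supp where "supp v = {i \<in> I. v i \<noteq> \<zero>\<^bsub>M\<^esub>}" for v
  define \<phi> where "\<phi> v = (\<Oplus>\<^bsub>N\<^esub>i\<in>supp v. f i (v i))" for v
  have fin: "finite (supp v)" if "v \<in> carrier ?C" for v using that by (simp add: supp_def M.copower_mem_iff)
  have cl: "f i (v i) \<in> carrier N" if "v \<in> carrier ?C" "i \<in> I" for v i
    using hom_closed[OF f[OF that(2)] M.copower_closed[OF that]] .
  have eq: "\<phi> v = (\<Oplus>\<^bsub>N\<^esub>i\<in>F. f i (v i))"
    if v: "v \<in> carrier ?C" and F: "finite F" "F \<subseteq> I" "\<And>i. i \<in> I - F \<Longrightarrow> v i = \<zero>\<^bsub>M\<^esub>" for v F
    unfolding \<phi>_def
  proof (rule N.add.finprod_mono_neutral_cong_left)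
    show "supp v \<subseteq> F" using F(3) by (auto simp: supp_def)
    fix i assume "i \<in> F - supp v"
    then show "f i (v i) = \<zero>\<^bsub>N\<^esub>" using F(2) hom_zero[OF f] by (auto simp: supp_def)
  qed (use F cl[OF v] in auto)
  have "\<phi> \<in> module_hom R ?C N"
  proof (rule module_homI)
    fix v assume v: "v \<in> carrier ?C"
    show "\<phi> v \<in> carrier N" unfolding \<phi>_def using cl[OF v] by (intro N.finsum_closed) (auto simp: supp_def)
    fix w assume w: "w \<in> carrier ?C"
    let ?F = "supp v \<union> supp w"
    have F: "finite ?F" "?F \<subseteq> I" using fin v w by (auto simp: supp_def)
    have z: "v i = \<zero>\<^bsub>M\<^esub>" "w i = \<zero>\<^bsub>M\<^esub>" if "i \<in> I - ?F" for i using that by (auto simp: supp_def)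
    have "\<phi> (v \<oplus>\<^bsub>?C\<^esub> w) = (\<Oplus>\<^bsub>N\<^esub>i\<in>?F. f i ((v \<oplus>\<^bsub>?C\<^esub> w) i))"
      using z by (intro eq C.a_closed v w F) (simp add: M.copower_apply)
    also have "\<dots> = (\<Oplus>\<^bsub>N\<^esub>i\<in>?F. f i (v i) \<oplus>\<^bsub>N\<^esub> f i (w i))"
    proof (rule N.finsum_cong')
      fix i assume "i \<in> ?F"
      then have i: "i \<in> I" using F by auto
      then show "f i ((v \<oplus>\<^bsub>?C\<^esub> w) i) = f i (v i) \<oplus>\<^bsub>N\<^esub> f i (w i)"
        using M.copower_closed[OF v i] M.copower_closed[OF w i]
        by (simp add: M.copower_apply module_hom_add[OF f])
    qed (use cl v w F in auto)
    also have "\<dots> = (\<Oplus>\<^bsub>N\<^esub>i\<in>?F. f i (v i)) \<oplus>\<^bsub>N\<^esub> (\<Oplus>\<^bsub>N\<^esub>i\<in>?F. f i (w i))"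
      by (rule N.finsum_addf) (use cl v w F in auto)
    also have "\<dots> = \<phi> v \<oplus>\<^bsub>N\<^esub> \<phi> w" using eq[OF v F z(1)] eq[OF w F z(2)] by simp
    finally show "\<phi> (v \<oplus>\<^bsub>?C\<^esub> w) = \<phi> v \<oplus>\<^bsub>N\<^esub> \<phi> w" .
  next
    fix a v assume a: "a \<in> carrier R" and v: "v \<in> carrier ?C"
    have F: "finite (supp v)" "supp v \<subseteq> I" using fin v by (auto simp: supp_def)
    have scale: "finite A \<Longrightarrow> A \<subseteq> I \<Longrightarrow>
      a \<odot>\<^bsub>N\<^esub> (\<Oplus>\<^bsub>N\<^esub>i\<in>A. f i (v i)) = (\<Oplus>\<^bsub>N\<^esub>i\<in>A. a \<odot>\<^bsub>N\<^esub> f i (v i))" for A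
    proof (induction A rule: finite_induct)
      case empty
      then show ?case using a by simp
    next
      case (insert j A)
      have "(\<lambda>i. f i (v i)) \<in> A \<rightarrow> carrier N" "f j (v j) \<in> carrier N" using insert cl[OF v] by auto
      moreover from this have "(\<lambda>i. a \<odot>\<^bsub>N\<^esub> f i (v i)) \<in> A \<rightarrow> carrier N" using a by (auto intro: N.smult_closed)
      ultimately show ?case
        using insert a by (simp add: N.finsum_insert N.smult_r_distr N.smult_closed N.finsum_closed)
    qed
    have "\<phi> (a \<odot>\<^bsub>?C\<^esub> v) = (\<Oplus>\<^bsub>N\<^esub>i\<in>supp v. f i ((a \<odot>\<^bsub>?C\<^esub> v) i))"
      using a by (intro eq C.smult_closed v F) (auto simp: M.copower_apply supp_def)
    also have "\<dots> = (\<Oplus>\<^bsub>N\<^esub>i\<in>supp v. a \<odot>\<^bsub>N\<^esub> f i (v i))"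
    proof (rule N.finsum_cong')
      fix i assume "i \<in> supp v"
      then have i: "i \<in> I" using F by auto
      then show "f i ((a \<odot>\<^bsub>?C\<^esub> v) i) = a \<odot>\<^bsub>N\<^esub> f i (v i)"
        using M.copower_closed[OF v i] a by (simp add: M.copower_apply module_hom_smult[OF f])
    qed (use cl[OF v] F a in \<open>auto intro: N.smult_closed\<close>)
    also have "\<dots> = a \<odot>\<^bsub>N\<^esub> \<phi> v" using scale[OF F] by (simp add: \<phi>_def)
    finally show "\<phi> (a \<odot>\<^bsub>?C\<^esub> v) = a \<odot>\<^bsub>N\<^esub> \<phi> v" .
  qed
  then show ?thesis by (intro exI[of _ \<phi>] conjI allI impI eq) auto
qed

end

context local_endo_pair
begin

lemma split_hom_basis_iff: "right_basis D V B \<longleftrightarrow> V.indep B \<and> V.lin_span B = carrier V"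
  using V.right_basis_iff[of B] by (simp only: right_basis_opposite_ring)

text \<open>
  The maps \<open>h b\<close> are coordinates dual to the \<open>f b\<close>, and \<open>\<pi>\<close> is the projection \<open>\<Sum>b\<in>F. f b \<circ> h b\<close> of \<open>N\<close>
  onto the sum of the images of the \<open>f b\<close>. To add \<open>a\<close>, subtract from \<open>f a\<close> its projection. The
  difference \<open>f'\<close> is not in \<open>J\<close>, because the class of the projection is in the span of \<open>F\<close> and \<open>a\<close> is
  not; so \<open>f'\<close> has a left inverse \<open>g\<close>, and the coordinates are corrected as in the Gram-Schmidt process.
\<close>

lemma independent_finite_retraction:
  assumes ind: "V.indep B" and f: "\<And>b. b \<in> B \<Longrightarrow> f b \<in> carrier Hom" "\<And>b. b \<in> B \<Longrightarrow> cls (f b) = b"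
    and F: "finite F" "F \<subseteq> B"
  shows "\<exists>h \<pi>. (\<forall>b\<in>F. h b \<in> module_hom R N M) \<and> \<pi> \<in> module_hom R N N \<and>
    (\<forall>b\<in>F. \<forall>c\<in>F. \<forall>x\<in>carrier M. h b (f c x) = (if b = c then x else \<zero>\<^bsub>M\<^esub>)) \<and>
    (\<forall>c\<in>F. \<forall>x\<in>carrier M. \<pi> (f c x) = f c x) \<and>
    (\<forall>u\<in>carrier Hom. cls (\<lambda>x\<in>carrier M. \<pi> (u x)) \<in> V.lin_span F)"
  using F
proof (induction F)
  case empty
  have "cls (\<lambda>x\<in>carrier M. \<zero>\<^bsub>N\<^esub>) = \<zero>\<^bsub>V\<^esub>"
    using cls_eq_zero_iff[OF H.zero_closed] J_zero by (simp add: hom_group_def)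
  moreover have "(\<lambda>x. \<zero>\<^bsub>N\<^esub>) \<in> module_hom R N N" by (rule module_homI) auto
  ultimately show ?case
    using V.lin_span.lin_span_zero[of "{}"]
    by (intro exI[of _ "\<lambda>b s. \<zero>\<^bsub>M\<^esub>"] exI[of _ "\<lambda>x. \<zero>\<^bsub>N\<^esub>"] conjI ballI) (simp_all only: empty_iff)
next
  case (insert a F)
  interpret NN: module_pair R N N by unfold_locales
  interpret NM: module_pair R N M by unfold_locales
  have BV: "B \<subseteq> carrier V" using ind by (rule V.indep_subset_carrier)
  have aB: "a \<in> B" and FB: "F \<subseteq> B" and aF: "a \<notin> F" using insert by auto
  from insert.IH[OF FB] obtain h \<pi> where "(\<forall>b\<in>F. h b \<in> module_hom R N M) \<and> \<pi> \<in> module_hom R N N \<and>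
    (\<forall>b\<in>F. \<forall>c\<in>F. \<forall>x\<in>carrier M. h b (f c x) = (if b = c then x else \<zero>\<^bsub>M\<^esub>)) \<and>
    (\<forall>c\<in>F. \<forall>x\<in>carrier M. \<pi> (f c x) = f c x) \<and>
    (\<forall>u\<in>carrier Hom. cls (\<lambda>x\<in>carrier M. \<pi> (u x)) \<in> V.lin_span F)"
    by (elim exE)
  then have h: "\<And>b. b \<in> F \<Longrightarrow> h b \<in> module_hom R N M" and \<pi>: "\<pi> \<in> module_hom R N N"
    and hf: "\<And>b c x. b \<in> F \<Longrightarrow> c \<in> F \<Longrightarrow> x \<in> carrier M \<Longrightarrow> h b (f c x) = (if b = c then x else \<zero>\<^bsub>M\<^esub>)"
    and \<pi>f: "\<And>c x. c \<in> F \<Longrightarrow> x \<in> carrier M \<Longrightarrow> \<pi> (f c x) = f c x"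
    and \<pi>span: "\<And>u. u \<in> carrier Hom \<Longrightarrow> cls (\<lambda>x\<in>carrier M. \<pi> (u x)) \<in> V.lin_span F"
    by simp_all
  have fa: "f a \<in> carrier Hom" "f a \<in> module_hom R M N" using f(1)[OF aB] hom_groupD by auto
  have fcl: "f c x \<in> carrier N" if "c \<in> B" "x \<in> carrier M" for c x
    using hom_group_closed[OF f(1)[OF that(1)] that(2)] .
  let ?p = "\<lambda>u. \<lambda>x\<in>carrier M. \<pi> (u x)"
  have p: "?p u \<in> carrier Hom" if "u \<in> carrier Hom" for u
    by (rule restrict_module_hom[OF module_hom_comp[OF hom_groupD[OF that] \<pi>]])
  define f' where "f' = f a \<ominus>\<^bsub>Hom\<^esub> ?p (f a)"
  have f': "f' \<in> carrier Hom" using fa p unfolding f'_def by blast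
  have f'x: "f' x = f a x \<ominus>\<^bsub>N\<^esub> \<pi> (f a x)" if "x \<in> carrier M" for x
    using that fa p by (simp add: f'_def hom_group_diff_apply)
  have sum: "f' \<oplus>\<^bsub>Hom\<^esub> ?p (f a) = f a"
    using fa p[OF fa(1)] by (simp add: f'_def a_minus_def H.a_assoc H.l_neg)
  have clsa: "cls f' \<oplus>\<^bsub>V\<^esub> cls (?p (f a)) = a"
    using cls_add[OF f' p[OF fa(1)]] sum f(2)[OF aB] by simp
  have FV: "F \<subseteq> carrier V" using FB BV by auto
  have "f' \<notin> J"
  proof
    assume "f' \<in> J"
    then have "cls f' = \<zero>\<^bsub>V\<^esub>" using cls_eq_zero_iff[OF f'] by simp
    then have "a = cls (?p (f a))" using clsa cls_closed[OF p[OF fa(1)]] by simp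
    then have "a \<in> V.lin_span F" using \<pi>span[OF fa(1)] by simp
    moreover have "V.lin_span F \<subseteq> V.lin_span (B - {a})" using FB aF by (intro V.lin_span_mono) auto
    ultimately show False using ind aB unfolding V.indep_def by auto
  qed
  then obtain g where g: "g \<in> carrier (hom_group R N M)" "compose (carrier M) g f' = (\<lambda>x\<in>carrier M. x)"
    using f' unfolding non_split_homs_def by blast
  note gh = hom_groupD[OF g(1)]
  have gf: "g (f' x) = x" if "x \<in> carrier M" for x
    using fun_cong[OF g(2), of x] that by (simp add: compose_def)
  define ha where "ha s = g (s \<ominus>\<^bsub>N\<^esub> \<pi> s)" for s
  have ha: "ha \<in> module_hom R N M"
    unfolding ha_def by (rule module_hom_comp[OF NN.module_hom_diff_map[OF module_hom_id \<pi>] gh])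
  have ha_f: "ha (f c x) = \<zero>\<^bsub>M\<^esub>" if "c \<in> F" "x \<in> carrier M" for c x
  proof -
    have "f c x \<ominus>\<^bsub>N\<^esub> \<pi> (f c x) = \<zero>\<^bsub>N\<^esub>"
      using that \<pi>f[OF that] fcl[of c x] FB by (auto simp: N.minus_eq_zero_iff)
    then show ?thesis by (simp only: ha_def NM.hom_zero[OF gh])
  qed
  have ha_fa: "ha (f a x) = x" if "x \<in> carrier M" for x
    using that gf[OF that] by (simp add: ha_def f'x)
  have hacl: "ha s \<in> carrier M" if "s \<in> carrier N" for s using module_hom_mem[OF ha that] .
  define h' where "h' b = (if b = a then ha else (\<lambda>s. h b s \<ominus>\<^bsub>M\<^esub> h b (f a (ha s))))" for b
  have h': "h' b \<in> module_hom R N M" if "b \<in> insert a F" for b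
  proof (cases "b = a")
    case False
    then have b: "h b \<in> module_hom R N M" using that h by auto
    have "(\<lambda>s. h b (f a (ha s))) \<in> module_hom R N M"
      by (rule module_hom_comp[OF module_hom_comp[OF ha fa(2)] b])
    from NM.module_hom_diff_map[OF b this] show ?thesis using False by (simp add: h'_def)
  qed (simp add: h'_def ha)
  define \<pi>' where "\<pi>' s = \<pi> s \<oplus>\<^bsub>N\<^esub> f' (ha s)" for s
  have \<pi>': "\<pi>' \<in> module_hom R N N"
    unfolding \<pi>'_def by (rule NN.module_hom_add_map[OF \<pi> module_hom_comp[OF ha hom_groupD[OF f']]])
  have h'f: "h' b (f c x) = (if b = c then x else \<zero>\<^bsub>M\<^esub>)"
    if bc: "b \<in> insert a F" "c \<in> insert a F" and x: "x \<in> carrier M" for b c x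
  proof (cases "b = a")
    case True
    then show ?thesis using bc x ha_f[of c x] ha_fa[OF x] by (auto simp: h'_def)
  next
    case False
    then have b: "b \<in> F" using bc by simp
    show ?thesis
    proof (cases "c = a")
      case True
      then show ?thesis
        using False x ha_fa[OF x] module_hom_mem[OF h[OF b] fcl[OF aB x]]
        by (simp add: h'_def M.minus_eq_zero_iff)
    next
      case ca: False
      then have c: "c \<in> F" using bc by simp
      have "f a \<zero>\<^bsub>M\<^esub> = \<zero>\<^bsub>N\<^esub>" "h b \<zero>\<^bsub>N\<^esub> = \<zero>\<^bsub>M\<^esub>"
        using hom_zero[OF fa(2)] NM.hom_zero[OF h[OF b]] by auto
      then show ?thesis using False x b c hf[OF b c x] ha_f[OF c x] by (simp add: h'_def a_minus_def)
    qed
  qed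
  have \<pi>'f: "\<pi>' (f c x) = f c x" if c: "c \<in> insert a F" and x: "x \<in> carrier M" for c x
  proof (cases "c = a")
    case True
    have "\<pi> (f a x) \<in> carrier N" using module_hom_mem[OF \<pi> fcl[OF aB x]] .
    then have "\<pi> (f a x) \<oplus>\<^bsub>N\<^esub> (f a x \<ominus>\<^bsub>N\<^esub> \<pi> (f a x)) = f a x"
      using fcl[OF aB x] by (simp add: a_minus_def N.a_lcomm N.r_neg)
    then show ?thesis using True x ha_fa[OF x] by (simp add: \<pi>'_def f'x)
  next
    case False
    then have c: "c \<in> F" using c by simp
    then show ?thesis using x \<pi>f[OF c x] ha_f[OF c x] hom_zero[OF hom_groupD[OF f']] fcl[of c x] FB
      by (auto simp: \<pi>'_def)
  qed
  have span_sub: "V.lin_span F \<subseteq> V.lin_span (insert a F)" by (rule V.lin_span_mono) auto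
  have iV: "insert a F \<subseteq> carrier V" using aB FB BV by auto
  note sp = V.submoduleD[OF V.lin_span_submodule[OF iV]]
  have cf': "cls f' \<in> V.lin_span (insert a F)"
  proof -
    have pc: "cls (?p (f a)) \<in> carrier V" "cls f' \<in> carrier V" using cls_closed[OF p[OF fa(1)]] cls_closed[OF f'] by simp_all
    have "a \<oplus>\<^bsub>V\<^esub> \<ominus>\<^bsub>V\<^esub> cls (?p (f a)) = (cls f' \<oplus>\<^bsub>V\<^esub> cls (?p (f a))) \<oplus>\<^bsub>V\<^esub> \<ominus>\<^bsub>V\<^esub> cls (?p (f a))"
      by (simp only: clsa)
    also have "\<dots> = cls f'" using pc by (simp add: V.M.a_assoc V.M.r_neg)
    finally have "cls f' = a \<oplus>\<^bsub>V\<^esub> \<ominus>\<^bsub>V\<^esub> cls (?p (f a))" by (rule sym)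
    moreover have "a \<in> V.lin_span (insert a F)" using V.lin_span_superset[OF iV] by auto
    moreover have "cls (?p (f a)) \<in> V.lin_span (insert a F)" using \<pi>span[OF fa(1)] span_sub by auto
    ultimately show ?thesis using sp(3,5) by (simp only:)
  qed
  have \<pi>'span: "cls (\<lambda>x\<in>carrier M. \<pi>' (u x)) \<in> V.lin_span (insert a F)" if u: "u \<in> carrier Hom" for u
  proof -
    have pe: "pairing ha u \<in> carrier End" by (rule pairing_closed[OF ha u])
    have "(\<lambda>x\<in>carrier M. \<pi>' (u x)) = ?p u \<oplus>\<^bsub>Hom\<^esub> rcomp f' (pairing ha u)"
    proof (rule hom_group_ext[OF _ H.a_closed[OF p[OF u] comp_closed[OF f' pe]]])
      show "(\<lambda>x\<in>carrier M. \<pi>' (u x)) \<in> carrier Hom"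
        by (rule restrict_module_hom[OF module_hom_comp[OF hom_groupD[OF u] \<pi>']])
    qed (simp add: hom_group_add_apply comp_apply pairing_apply \<pi>'_def)
    then have "cls (\<lambda>x\<in>carrier M. \<pi>' (u x)) = cls (?p u) \<oplus>\<^bsub>V\<^esub> (E.nonunits +>\<^bsub>End\<^esub> pairing ha u) \<odot>\<^bsub>V\<^esub> cls f'"
      using cls_add[OF p[OF u] comp_closed[OF f' pe]] cls_smult[OF f' pe] by simp
    moreover have "cls (?p u) \<in> V.lin_span (insert a F)" using \<pi>span[OF u] span_sub by auto
    moreover have "(E.nonunits +>\<^bsub>End\<^esub> pairing ha u) \<odot>\<^bsub>V\<^esub> cls f' \<in> V.lin_span (insert a F)"
      using pe by (intro sp(4) cf') (simp add: carrier_D)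
    ultimately show ?thesis using sp(3) by simp
  qed
  show ?case
    by (intro exI[of _ h'] exI[of _ \<pi>'] conjI ballI h' \<pi>' h'f \<pi>'f \<pi>'span)
qed

text \<open>
  For the inclusions \<open>f i\<close> and the projections \<open>h i\<close> of the copies of \<open>M\<close>, the subspace \<open>K i\<close> of classes
  \<open>u\<close> such that \<open>h i \<circ> u\<close> is a non-unit contains all \<open>f j\<close> except \<open>f i\<close>. Hence the classes of the
  \<open>f i\<close> are distinct and independent, and there are at most as many as basis elements.
\<close>

lemma copies_le_basis:
  assumes B: "right_basis D V B" and r: "Card_order r" "copies_in_summand R M N r"
  shows "r \<le>o |B|"
proof -
  let ?I = "Field r"
  let ?C = "copower M ?I"
  interpret C: left_module R ?C by (rule M.copower_left_module)
  interpret CN: module_pair R ?C N by unfold_locales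
  obtain \<phi> \<rho> where \<phi>: "\<phi> \<in> module_hom R ?C N" and \<rho>: "\<rho> \<in> module_hom R N ?C"
    and ret: "\<And>v. v \<in> carrier ?C \<Longrightarrow> \<rho> (\<phi> v) = v"
    using r(2) unfolding copies_in_summand_def CN.iso_to_summand_iff_retract by auto
  define \<iota> where "\<iota> i x = (\<lambda>j\<in>?I. if j = i then x else \<zero>\<^bsub>M\<^esub>)" for i x
  have \<iota>: "\<iota> i \<in> module_hom R M ?C" if i: "i \<in> ?I" for i
  proof -
    have "(\<lambda>x. if j = i then x else \<zero>\<^bsub>M\<^esub>) \<in> module_hom R M M" for j
      by (cases "j = i") (auto simp: module_hom_def)
    then show ?thesis unfolding \<iota>_def
      by (intro M.copower_family_hom[of M ?I "\<lambda>j x. if j = i then x else \<zero>\<^bsub>M\<^esub>" "{i}"])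
         (auto simp: M.left_module_axioms)
  qed
  define f where "f i = (\<lambda>x\<in>carrier M. \<phi> (\<iota> i x))" for i
  define h where "h i s = \<rho> s i" for i s
  have f: "f i \<in> carrier Hom" if "i \<in> ?I" for i
    unfolding f_def by (rule restrict_module_hom[OF module_hom_comp[OF \<iota>[OF that] \<phi>]])
  have h: "h i \<in> module_hom R N M" if "i \<in> ?I" for i
    unfolding h_def by (rule module_hom_comp[OF \<rho> M.copower_component_hom[OF that]])
  have hf: "h i (f j x) = (if i = j then x else \<zero>\<^bsub>M\<^esub>)" if "i \<in> ?I" "j \<in> ?I" "x \<in> carrier M" for i j x
    using that ret[OF module_hom_mem[OF \<iota>[OF that(2)] that(3)]] by (simp add: h_def f_def \<iota>_def)
  define K where "K i = {cls u | u. u \<in> carrier Hom \<and> pairing (h i) u \<in> E.nonunits}" for i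
  have K_iff: "cls u \<in> K i \<longleftrightarrow> pairing (h i) u \<in> E.nonunits" if i: "i \<in> ?I" and u: "u \<in> carrier Hom" for i u
  proof
    assume "cls u \<in> K i"
    then obtain w where w: "w \<in> carrier Hom" "pairing (h i) w \<in> E.nonunits" "cls u = cls w"
      unfolding K_def by auto
    then have "u \<in> cls w" using J.a_rcos_self[OF u] by simp
    then obtain j where j: "j \<in> J" "u = j \<oplus>\<^bsub>Hom\<^esub> w" unfolding a_r_coset_def' by blast
    have jc: "j \<in> carrier Hom" using j J_subset by auto
    show "pairing (h i) u \<in> E.nonunits"
      unfolding j(2) pairing_add[OF h[OF i] jc w(1)]
      by (rule E.add_nonunit[OF J_pairing[OF j(1) h[OF i]] w(2)])
  qed (use u in \<open>auto simp: K_def\<close>)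
  have K: "Module.submodule (K i) (opposite_ring D) V" if i: "i \<in> ?I" for i
  proof (rule V.submoduleI)
    show "K i \<subseteq> carrier V" unfolding K_def using cls_closed by auto
    show "\<zero>\<^bsub>V\<^esub> \<in> K i"
      using K_iff[OF i H.zero_closed] J_pairing[OF J_zero h[OF i]] cls_eq_zero_iff[OF H.zero_closed] J_zero by simp
    fix x y assume "x \<in> K i" "y \<in> K i"
    then obtain u w where u: "u \<in> carrier Hom" "pairing (h i) u \<in> E.nonunits" "x = cls u"
      and w: "w \<in> carrier Hom" "pairing (h i) w \<in> E.nonunits" "y = cls w" unfolding K_def by auto
    have "pairing (h i) (u \<oplus>\<^bsub>Hom\<^esub> w) \<in> E.nonunits"
      unfolding pairing_add[OF h[OF i] u(1) w(1)] by (rule E.add_nonunit[OF u(2) w(2)])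
    then show "x \<oplus>\<^bsub>V\<^esub> y \<in> K i"
      using K_iff[OF i H.a_closed[OF u(1) w(1)]] by (simp add: u(3) w(3) cls_add[OF u(1) w(1)])
  next
    fix c x assume "c \<in> carrier (opposite_ring D)" "x \<in> K i"
    then obtain e u where e: "e \<in> carrier End" "c = E.nonunits +>\<^bsub>End\<^esub> e"
      and u: "u \<in> carrier Hom" "pairing (h i) u \<in> E.nonunits" "x = cls u"
      unfolding K_def by (auto simp: carrier_D)
    have "pairing (h i) (rcomp u e) \<in> E.nonunits"
      unfolding pairing_comp[OF h[OF i] u(1) e(1)] by (rule E.mult_nonunit(1)[OF u(2) e(1)])
    then show "c \<odot>\<^bsub>V\<^esub> x \<in> K i"
      using K_iff[OF i comp_closed[OF u(1) e(1)]] by (simp add: u(3) e(2) cls_smult[OF u(1) e(1)])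
  qed
  have fK: "cls (f j) \<in> K i \<longleftrightarrow> i \<noteq> j" if ij: "i \<in> ?I" "j \<in> ?I" for i j
  proof (cases "i = j")
    case True
    have "pairing (h i) (f j) = \<one>\<^bsub>End\<^esub>"
      by (rule M.endo_ext[OF pairing_closed[OF h[OF ij(1)] f[OF ij(2)]] E.one_closed])
         (simp add: pairing_apply M.endo_apply hf[OF ij(2,2)] True)
    then show ?thesis using K_iff[OF ij(1) f[OF ij(2)]] True by simp
  next
    case False
    have "pairing (h i) (f j) = \<zero>\<^bsub>End\<^esub>"
      by (rule M.endo_ext[OF pairing_closed[OF h[OF ij(1)] f[OF ij(2)]] E.zero_closed])
         (simp add: pairing_apply M.endo_apply hf[OF ij] False)
    then show ?thesis using K_iff[OF ij(1) f[OF ij(2)]] False E.zero_nonunit by simp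
  qed
  let ?c = "\<lambda>i. cls (f i)"
  have inj: "inj_on ?c ?I"
  proof (rule inj_onI, rule ccontr)
    fix i j assume ij: "i \<in> ?I" "j \<in> ?I" "cls (f i) = cls (f j)" "i \<noteq> j"
    show False using fK[OF ij(1,2)] fK[OF ij(1,1)] ij(3,4) by simp
  qed
  have "V.indep (?c ` ?I)"
    unfolding V.indep_def
  proof (intro conjI ballI)
    show "?c ` ?I \<subseteq> carrier V" using cls_closed[OF f] by auto
    fix x assume "x \<in> ?c ` ?I"
    then obtain i where i: "i \<in> ?I" "x = cls (f i)" by auto
    have "?c ` ?I - {x} \<subseteq> K i"
    proof
      fix y assume "y \<in> ?c ` ?I - {x}"
      then obtain j where "j \<in> ?I" "y = cls (f j)" "y \<noteq> x" by auto
      then show "y \<in> K i" using fK[OF i(1), of j] i(2) by auto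
    qed
    then have "V.lin_span (?c ` ?I - {x}) \<subseteq> K i" using K[OF i(1)] by (rule V.lin_span_least)
    then show "x \<notin> V.lin_span (?c ` ?I - {x})" using fK[OF i(1) i(1)] i(2) by auto
  qed
  moreover have "B \<subseteq> carrier V" "?c ` ?I \<subseteq> V.lin_span B"
    using B cls_closed[OF f] unfolding split_hom_basis_iff V.indep_def by auto
  ultimately have le: "|?c ` ?I| \<le>o |B|" by (rule V.indep_card_le_spanning)
  have "|?I| =o |?c ` ?I|" by (rule card_of_ordIsoI[OF inj_on_imp_bij_betw[OF inj]])
  with ordIso_symmetric[OF card_of_Field_ordIso[OF r(1)]] have "r =o |?c ` ?I|" by (rule ordIso_transitive)
  then show ?thesis using le by (rule ordIso_ordLeq_trans)
qed

end

section \<open>The multiplicity of an indecomposable module\<close>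

locale multiplicity_pair = locally_noetherian_pair R M S subsp rk fd + E: fitting_ring "endo_ring R M"
  for R :: "('r, 'a) ring_scheme" and M :: "('r, 'm, 'c) module_scheme"
    and S :: "('r, 's, 'd) module_scheme" and subsp rk fd
begin

sublocale L: local_endo_pair R M S
  by unfold_locales

text \<open>
  Representatives of a basis define a map from the direct sum of copies of \<open>M\<close>. It splits on finite
  subsums by orthogonalisation, hence globally.
\<close>

lemma basis_copies_summand:
  assumes "right_basis L.D L.V B"
  shows "iso_to_summand R (copower M B) S"
proof -
  let ?C = "copower M B"
  have B: "L.V.indep B" "B \<subseteq> carrier L.V"
    using assms unfolding L.split_hom_basis_iff L.V.indep_def by auto
  interpret C: left_module R ?C by (rule M.copower_left_module)
  interpret CS: module_pair R ?C S by unfold_locales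
  interpret SM: module_pair R S M by unfold_locales
  have "\<forall>b\<in>B. \<exists>u. u \<in> carrier L.Hom \<and> L.cls u = b" using B(2) unfolding L.carrier_V by blast
  from bchoice[OF this] obtain f where f: "\<And>b. b \<in> B \<Longrightarrow> f b \<in> carrier L.Hom" "\<And>b. b \<in> B \<Longrightarrow> L.cls (f b) = b"
    by auto
  note fh = hom_groupD[OF f(1)]
  have "\<forall>b\<in>B. f b \<in> module_hom R M S" using fh by simp
  from L.copower_sum_hom[OF this] obtain \<phi> where \<phi>: "\<phi> \<in> module_hom R ?C S"
    and \<phi>_eq: "\<forall>v F. v \<in> carrier ?C \<longrightarrow> finite F \<longrightarrow> F \<subseteq> B \<longrightarrow> (\<forall>i\<in>B - F. v i = \<zero>\<^bsub>M\<^esub>) \<longrightarrow>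
      \<phi> v = (\<Oplus>\<^bsub>S\<^esub>i\<in>F. f i (v i))"
    by (elim exE conjE)
  have "\<exists>\<rho>\<in>module_hom R S ?C. \<forall>v\<in>carrier ?C. (\<forall>i\<in>B - F. v i = \<zero>\<^bsub>M\<^esub>) \<longrightarrow> \<rho> (\<phi> v) = v"
    if F: "finite F" "F \<subseteq> B" for F
  proof -
    obtain h where "(\<forall>b\<in>F. h b \<in> module_hom R S M) \<and>
        (\<forall>b\<in>F. \<forall>c\<in>F. \<forall>x\<in>carrier M. h b (f c x) = (if b = c then x else \<zero>\<^bsub>M\<^esub>))"
      using L.independent_finite_retraction[OF B(1) f F] by metis
    then have h: "\<And>b. b \<in> F \<Longrightarrow> h b \<in> module_hom R S M"
      and hf: "\<And>b c x. b \<in> F \<Longrightarrow> c \<in> F \<Longrightarrow> x \<in> carrier M \<Longrightarrow> h b (f c x) = (if b = c then x else \<zero>\<^bsub>M\<^esub>)"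
      by simp_all
    define h' where "h' b = (if b \<in> F then h b else (\<lambda>s. \<zero>\<^bsub>M\<^esub>))" for b
    have h': "h' b \<in> module_hom R S M" for b
      using h SM.module_hom_zero_map by (simp add: h'_def)
    let ?\<rho> = "\<lambda>s. \<lambda>b\<in>B. h' b s"
    have \<rho>: "?\<rho> \<in> module_hom R S ?C"
      by (rule M.copower_family_hom[OF S.left_module_axioms h' F(1)]) (simp add: h'_def)
    have "?\<rho> (\<phi> v) = v" if v: "v \<in> carrier ?C" and z: "\<forall>i\<in>B - F. v i = \<zero>\<^bsub>M\<^esub>" for v
    proof (rule M.copower_ext[where I = B])
      have \<phi>S: "\<phi> v \<in> carrier S" using module_hom_mem[OF \<phi> v] .
      show "?\<rho> (\<phi> v) \<in> carrier ?C" using module_hom_mem[OF \<rho> \<phi>S] .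
      fix b assume b: "b \<in> B"
      show "?\<rho> (\<phi> v) b = v b"
      proof (cases "b \<in> F")
        case True
        have vM: "v i \<in> carrier M" if "i \<in> F" for i using M.copower_closed[OF v] that F(2) by auto
        have fS: "f i (v i) \<in> carrier S" if "i \<in> F" for i
          using module_hom_mem[OF fh vM[OF that]] that F(2) by auto
        have "h b (\<phi> v) = h b (\<Oplus>\<^bsub>S\<^esub>i\<in>F. f i (v i))" using \<phi>_eq v F z by simp
        also have "\<dots> = (\<Oplus>\<^bsub>M\<^esub>i\<in>F. h b (f i (v i)))" by (rule SM.hom_finsum[OF h[OF True] F(1) fS])
        also have "\<dots> = (\<Oplus>\<^bsub>M\<^esub>i\<in>F. if i = b then v i else \<zero>\<^bsub>M\<^esub>)"
          by (rule M.finsum_cong') (use hf[OF True] vM in auto)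
        also have "\<dots> = v b"
          by (rule finsum_delta[where k = M and f = v and x = b, OF _ F(1) True vM[OF True]]) unfold_locales
        finally show ?thesis using b True by (simp add: h'_def)
      next
        case False
        then show ?thesis using b z by (simp add: h'_def)
      qed
    qed (rule v)
    then show ?thesis by (intro bexI[OF _ \<rho>] ballI impI)
  qed
  from locally_split_imp_split[OF \<phi> this] show ?thesis
    unfolding CS.iso_to_summand_iff_retract by (rule bexI[OF _ \<phi>])
qed

theorem multiplicity:
  shows "Card_order (right_dim L.D L.V) \<and> copies_in_summand R M S (right_dim L.D L.V) \<and>
    (\<forall>r :: 'i rel. Card_order r \<longrightarrow> copies_in_summand R M S r \<longrightarrow> r \<le>o right_dim L.D L.V)"
proof -
  define B where "B = (SOME B. right_basis L.D L.V B)"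
  obtain B0 where "L.V.indep B0" "L.V.lin_span B0 = carrier L.V" by (rule L.V.basis_exists)
  then have "right_basis L.D L.V B0"
    unfolding L.split_hom_basis_iff by simp
  then have B: "right_basis L.D L.V B" unfolding B_def by (rule someI)
  have d: "right_dim L.D L.V = |B|" by (simp add: right_dim_def B_def)
  show ?thesis
    unfolding d copies_in_summand_def[of R M S "|B|"] Field_card_of
    by (intro conjI allI impI card_of_card_order_on basis_copies_summand[OF B] L.copies_le_basis[OF B])
qed

end

section \<open>Modules over the group algebra of a finite group\<close>

lemma left_vector_space_restrict_scalars:
  assumes k: "field k" and G: "group G" "finite (carrier G)" and X: "left_module (group_algebra k G) X"
  shows "left_vector_space k (restrict_scalars k G X)"
proof -
  interpret k: field k by fact
  interpret V: vectorspace k "restrict_scalars k G X"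
    using assms by (rule vectorspace_restrict_scalars)
  show ?thesis
  proof (intro left_vector_space.intro left_module.intro left_vector_space_axioms.intro
      left_module_axioms.intro)
    show "ring k" "abelian_group (restrict_scalars k G X)" by unfold_locales
    show "\<exists>d\<in>carrier k. d \<otimes>\<^bsub>k\<^esub> c = \<one>\<^bsub>k\<^esub>" if "c \<in> carrier k" "c \<noteq> \<zero>\<^bsub>k\<^esub>" for c
    proof -
      have "c \<in> Units k" using that k.field_Units by simp
      then show ?thesis using k.Units_l_inv k.Units_inv_closed by blast
    qed
  qed (simp_all add: V.smult_l_distr V.smult_r_distr V.smult_assoc1)
qed

locale group_algebra_module = k: field k + G: group G + X: left_module "group_algebra k G" X
  for k :: "('k, 'a) ring_scheme" and G :: "('g, 'b) monoid_scheme"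
    and X :: "('g \<Rightarrow> 'k, 'x, 'c) module_scheme" +
  assumes finite_group: "finite (carrier G)"
begin

abbreviation "kG \<equiv> group_algebra k G"
abbreviation "scalar \<equiv> group_algebra_of_scalar k G"

sublocale L: left_vector_space k "restrict_scalars k G X"
  by (rule left_vector_space_restrict_scalars) (unfold_locales, rule finite_group)

lemma restrict_scalars_simps [simp]:
  "carrier (restrict_scalars k G X) = carrier X" "\<zero>\<^bsub>restrict_scalars k G X\<^esub> = \<zero>\<^bsub>X\<^esub>"
  "x \<oplus>\<^bsub>restrict_scalars k G X\<^esub> y = x \<oplus>\<^bsub>X\<^esub> y"
  "c \<odot>\<^bsub>restrict_scalars k G X\<^esub> x = scalar c \<odot>\<^bsub>X\<^esub> x"
  by (simp_all add: restrict_scalars_def)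

lemma kG_closed: "a \<in> carrier kG \<Longrightarrow> x \<in> carrier G \<Longrightarrow> a x \<in> carrier k"
  by (auto simp: group_algebra_def)

lemma kG_ext:
  "a \<in> carrier kG \<Longrightarrow> b \<in> carrier kG \<Longrightarrow> (\<And>x. x \<in> carrier G \<Longrightarrow> a x = b x) \<Longrightarrow> a = b"
  by (auto simp: group_algebra_def intro: PiE_ext)

lemma scalar_closed: "c \<in> carrier k \<Longrightarrow> scalar c \<in> carrier kG"
  by (auto simp: group_algebra_def group_algebra_of_scalar_def)

lemma scalar_mult_apply:
  assumes c: "c \<in> carrier k" and a: "a \<in> carrier kG" and x: "x \<in> carrier G"
  shows "(scalar c \<otimes>\<^bsub>kG\<^esub> a) x = c \<otimes>\<^bsub>k\<^esub> a x" "(a \<otimes>\<^bsub>kG\<^esub> scalar c) x = a x \<otimes>\<^bsub>k\<^esub> c"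
proof -
  have am: "abelian_monoid k" by unfold_locales
  note [simp] = kG_closed[OF a]
  have "(scalar c \<otimes>\<^bsub>kG\<^esub> a) x =
      (\<Oplus>\<^bsub>k\<^esub>y\<in>carrier G. if y = \<one>\<^bsub>G\<^esub> then c \<otimes>\<^bsub>k\<^esub> a (inv\<^bsub>G\<^esub> y \<otimes>\<^bsub>G\<^esub> x) else \<zero>\<^bsub>k\<^esub>)"
    using x c by (auto simp: group_algebra_def group_algebra_of_scalar_def intro!: k.finsum_cong')
  then show "(scalar c \<otimes>\<^bsub>kG\<^esub> a) x = c \<otimes>\<^bsub>k\<^esub> a x"
    using finsum_delta[OF am finite_group, of "\<one>\<^bsub>G\<^esub>" "\<lambda>y. c \<otimes>\<^bsub>k\<^esub> a (inv\<^bsub>G\<^esub> y \<otimes>\<^bsub>G\<^esub> x)"] x c by simp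
  have e: "inv\<^bsub>G\<^esub> y \<otimes>\<^bsub>G\<^esub> x = \<one>\<^bsub>G\<^esub> \<longleftrightarrow> y = x" if "y \<in> carrier G" for y
    using x that by (metis G.inv_closed G.inv_equality G.inv_inv G.l_inv)
  have "(a \<otimes>\<^bsub>kG\<^esub> scalar c) x = (\<Oplus>\<^bsub>k\<^esub>y\<in>carrier G. if y = x then a y \<otimes>\<^bsub>k\<^esub> c else \<zero>\<^bsub>k\<^esub>)"
    using x c by (auto simp: group_algebra_def group_algebra_of_scalar_def e intro!: k.finsum_cong')
  then show "(a \<otimes>\<^bsub>kG\<^esub> scalar c) x = a x \<otimes>\<^bsub>k\<^esub> c"
    using finsum_delta[OF am finite_group, of x "\<lambda>y. a y \<otimes>\<^bsub>k\<^esub> c"] x c by simp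
qed

text \<open>
  Scalars from \<open>k\<close> act by module endomorphisms. So submodules, and subgroups stable under all
  endomorphisms, are \<open>k\<close>-subspaces.
\<close>

lemma scalar_central:
  assumes "c \<in> carrier k" "a \<in> carrier kG"
  shows "scalar c \<otimes>\<^bsub>kG\<^esub> a = a \<otimes>\<^bsub>kG\<^esub> scalar c"
  using assms by (intro kG_ext X.R.m_closed scalar_closed)
    (simp_all add: scalar_mult_apply k.m_comm kG_closed)

lemma scalar_module_hom:
  assumes c: "c \<in> carrier k"
  shows "(\<lambda>x. scalar c \<odot>\<^bsub>X\<^esub> x) \<in> module_hom kG X X"
proof (rule module_homI)
  fix a x assume ax: "a \<in> carrier kG" "x \<in> carrier X"
  show "scalar c \<odot>\<^bsub>X\<^esub> (a \<odot>\<^bsub>X\<^esub> x) = a \<odot>\<^bsub>X\<^esub> (scalar c \<odot>\<^bsub>X\<^esub> x)"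
    using scalar_central[OF c ax(1)] ax scalar_closed[OF c] by (simp add: X.smult_assoc[symmetric])
qed (use scalar_closed[OF c] in \<open>simp_all add: X.smult_closed X.smult_r_distr\<close>)

lemma submodule_subspace:
  assumes "Module.submodule W kG X"
  shows "Module.submodule W k (restrict_scalars k G X)"
  using X.submoduleD[OF assms] by (intro L.submoduleI) (simp_all add: scalar_closed)

definition fin_dim_submodule :: "'x set \<Rightarrow> bool" where
  "fin_dim_submodule W \<longleftrightarrow> Module.submodule W kG X \<and>
    (\<exists>T. finite T \<and> T \<subseteq> carrier X \<and> W \<subseteq> L.lin_span T)"

lemma fin_dim_submodule_directed:
  assumes Y: "fin_dim_submodule Y" and Z: "fin_dim_submodule Z"
  shows "\<exists>W. fin_dim_submodule W \<and> Y \<union> Z \<subseteq> W"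
proof -
  obtain T where T: "finite T" "T \<subseteq> carrier X" "Y \<subseteq> L.lin_span T"
    using Y unfolding fin_dim_submodule_def by auto
  obtain U where U: "finite U" "U \<subseteq> carrier X" "Z \<subseteq> L.lin_span U"
    using Z unfolding fin_dim_submodule_def by auto
  have Y': "Module.submodule Y kG X" and Z': "Module.submodule Z kG X"
    using Y Z unfolding fin_dim_submodule_def by auto
  note YD = X.submoduleD[OF Y'] and ZD = X.submoduleD[OF Z']
  let ?W = "{y \<oplus>\<^bsub>X\<^esub> z | y z. y \<in> Y \<and> z \<in> Z}"
  have YX: "y \<in> Y \<Longrightarrow> y \<in> carrier X" and ZX: "z \<in> Z \<Longrightarrow> z \<in> carrier X" for y z using YD(1) ZD(1) by auto
  have "Module.submodule ?W kG X"
  proof (rule X.submoduleI)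
    show "?W \<subseteq> carrier X" using YX ZX by auto
    show "\<zero>\<^bsub>X\<^esub> \<in> ?W" using YD(2) ZD(2) by (intro CollectI exI[of _ "\<zero>\<^bsub>X\<^esub>"]) simp
    fix u v assume "u \<in> ?W" "v \<in> ?W"
    then obtain y z y' z' where e: "u = y \<oplus>\<^bsub>X\<^esub> z" "v = y' \<oplus>\<^bsub>X\<^esub> z'" and m: "y \<in> Y" "z \<in> Z" "y' \<in> Y" "z' \<in> Z" by auto
    have "u \<oplus>\<^bsub>X\<^esub> v = (y \<oplus>\<^bsub>X\<^esub> y') \<oplus>\<^bsub>X\<^esub> (z \<oplus>\<^bsub>X\<^esub> z')"
      using m YX ZX by (simp add: e X.M.a_ac)
    then show "u \<oplus>\<^bsub>X\<^esub> v \<in> ?W" using m YD(3) ZD(3) by blast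
  next
    fix a u assume a: "a \<in> carrier kG" and "u \<in> ?W"
    then obtain y z where e: "u = y \<oplus>\<^bsub>X\<^esub> z" and m: "y \<in> Y" "z \<in> Z" by auto
    have "a \<odot>\<^bsub>X\<^esub> u = a \<odot>\<^bsub>X\<^esub> y \<oplus>\<^bsub>X\<^esub> a \<odot>\<^bsub>X\<^esub> z" using m YX ZX a by (simp add: e X.smult_r_distr)
    then show "a \<odot>\<^bsub>X\<^esub> u \<in> ?W" using m a YD(4) ZD(4) by blast
  qed
  moreover have "?W \<subseteq> L.lin_span (T \<union> U)"
  proof
    fix u assume "u \<in> ?W"
    then obtain y z where e: "u = y \<oplus>\<^bsub>X\<^esub> z" and m: "y \<in> Y" "z \<in> Z" by auto
    have "y \<in> L.lin_span (T \<union> U)" "z \<in> L.lin_span (T \<union> U)"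
      using m T(3) U(3) L.lin_span_mono[of T "T \<union> U"] L.lin_span_mono[of U "T \<union> U"] by auto
    then show "u \<in> L.lin_span (T \<union> U)"
      using L.lin_span_add[of "T \<union> U" y z] T(2) U(2) by (simp add: e)
  qed
  ultimately have "fin_dim_submodule ?W"
    unfolding fin_dim_submodule_def using T U by (intro conjI exI[of _ "T \<union> U"]) auto
  moreover have "Y \<subseteq> ?W"
  proof
    fix y assume "y \<in> Y"
    then show "y \<in> ?W" using ZD(2) YX by (intro CollectI exI[of _ y] exI[of _ "\<zero>\<^bsub>X\<^esub>"]) simp
  qed
  moreover have "Z \<subseteq> ?W"
  proof
    fix z assume "z \<in> Z"
    then show "z \<in> ?W" using YD(2) ZX by (intro CollectI exI[of _ "\<zero>\<^bsub>X\<^esub>"] exI[of _ z]) simp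
  qed
  ultimately show ?thesis by (intro exI[of _ ?W]) simp
qed

text \<open>
  The submodule generated by \<open>s\<close> is spanned over \<open>k\<close> by the finitely many translates of \<open>s\<close> under the
  group.
\<close>

lemma cyclic_fin_dim_submodule:
  assumes s: "s \<in> carrier X"
  shows "\<exists>W. fin_dim_submodule W \<and> s \<in> W"
proof -
  define \<delta> where "\<delta> g = (\<lambda>x\<in>carrier G. if x = g then \<one>\<^bsub>k\<^esub> else \<zero>\<^bsub>k\<^esub>)" for g
  have \<delta>: "\<delta> g \<in> carrier kG" for g by (auto simp: \<delta>_def group_algebra_def)
  let ?T = "(\<lambda>g. \<delta> g \<odot>\<^bsub>X\<^esub> s) ` carrier G" and ?W = "(\<lambda>a. a \<odot>\<^bsub>X\<^esub> s) ` carrier kG"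
  have T: "finite ?T" "?T \<subseteq> carrier X" using finite_group \<delta> s by (auto intro: X.smult_closed)
  have "Module.submodule ?W kG X"
  proof (rule X.submoduleI)
    show "?W \<subseteq> carrier X" using s by (auto intro: X.smult_closed)
    show "\<zero>\<^bsub>X\<^esub> \<in> ?W" using s by (intro image_eqI[of _ _ "\<zero>\<^bsub>kG\<^esub>"]) simp_all
    fix u v assume "u \<in> ?W" "v \<in> ?W"
    then obtain a b where "a \<in> carrier kG" "b \<in> carrier kG" "u = a \<odot>\<^bsub>X\<^esub> s" "v = b \<odot>\<^bsub>X\<^esub> s" by auto
    then show "u \<oplus>\<^bsub>X\<^esub> v \<in> ?W" using s by (intro image_eqI[of _ _ "a \<oplus>\<^bsub>kG\<^esub> b"]) (simp_all add: X.smult_l_distr)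
  next
    fix a u assume a: "a \<in> carrier kG" and "u \<in> ?W"
    then obtain b where "b \<in> carrier kG" "u = b \<odot>\<^bsub>X\<^esub> s" by auto
    then show "a \<odot>\<^bsub>X\<^esub> u \<in> ?W" using s a by (intro image_eqI[of _ _ "a \<otimes>\<^bsub>kG\<^esub> b"]) (simp_all add: X.smult_assoc)
  qed
  moreover have "?W \<subseteq> L.lin_span ?T"
  proof
    fix u assume "u \<in> ?W"
    then obtain a where a: "a \<in> carrier kG" "u = a \<odot>\<^bsub>X\<^esub> s" by auto
    \<comment> \<open>the part of \<open>a\<close> supported in \<open>A\<close>, which is built up one group element at a time\<close>
    define part where "part A = (\<lambda>x\<in>carrier G. if x \<in> A then a x else \<zero>\<^bsub>k\<^esub>)" for A
    have part: "part A \<in> carrier kG" for A using kG_closed[OF a(1)] by (auto simp: part_def group_algebra_def)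
    have "part A \<odot>\<^bsub>X\<^esub> s \<in> L.lin_span ?T" if "finite A" "A \<subseteq> carrier G" for A
      using that
    proof (induction A)
      case empty
      have "part {} = \<zero>\<^bsub>kG\<^esub>" by (simp add: part_def group_algebra_def)
      then show ?case using s L.lin_span.lin_span_zero[of ?T] by simp
    next
      case (insert g A)
      then have g: "g \<in> carrier G" by simp
      have ag: "a g \<in> carrier k" using kG_closed[OF a(1) g] .
      have "part (insert g A) = (scalar (a g) \<otimes>\<^bsub>kG\<^esub> \<delta> g) \<oplus>\<^bsub>kG\<^esub> part A"
      proof (rule kG_ext[OF part X.R.a_closed[OF X.R.m_closed[OF scalar_closed[OF ag] \<delta>] part]])
        fix x assume x: "x \<in> carrier G"
        have "((scalar (a g) \<otimes>\<^bsub>kG\<^esub> \<delta> g) \<oplus>\<^bsub>kG\<^esub> part A) x = (scalar (a g) \<otimes>\<^bsub>kG\<^esub> \<delta> g) x \<oplus>\<^bsub>k\<^esub> part A x"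
          using x by (simp add: group_algebra_def)
        also have "(scalar (a g) \<otimes>\<^bsub>kG\<^esub> \<delta> g) x = a g \<otimes>\<^bsub>k\<^esub> \<delta> g x" by (rule scalar_mult_apply(1)[OF ag \<delta> x])
        also have "a g \<otimes>\<^bsub>k\<^esub> \<delta> g x \<oplus>\<^bsub>k\<^esub> part A x = part (insert g A) x"
          using x insert.hyps(2) ag kG_closed[OF a(1) x] by (auto simp: part_def \<delta>_def)
        finally show "part (insert g A) x = ((scalar (a g) \<otimes>\<^bsub>kG\<^esub> \<delta> g) \<oplus>\<^bsub>kG\<^esub> part A) x"
          by (rule sym)
      qed
      then have "part (insert g A) \<odot>\<^bsub>X\<^esub> s = scalar (a g) \<odot>\<^bsub>X\<^esub> (\<delta> g \<odot>\<^bsub>X\<^esub> s) \<oplus>\<^bsub>X\<^esub> part A \<odot>\<^bsub>X\<^esub> s"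
        using s \<delta> scalar_closed[OF ag] part by (simp add: X.smult_l_distr X.smult_assoc)
      moreover have "scalar (a g) \<odot>\<^bsub>X\<^esub> (\<delta> g \<odot>\<^bsub>X\<^esub> s) \<oplus>\<^bsub>X\<^esub> part A \<odot>\<^bsub>X\<^esub> s \<in> L.lin_span ?T"
        using L.lin_span.lin_span_step[of "\<delta> g \<odot>\<^bsub>X\<^esub> s" ?T "a g" "part A \<odot>\<^bsub>X\<^esub> s"] g ag insert by simp
      ultimately show ?case by simp
    qed
    from this[OF finite_group order_refl] have "part (carrier G) \<odot>\<^bsub>X\<^esub> s \<in> L.lin_span ?T" .
    moreover have "part (carrier G) = a" by (rule kG_ext[OF part a(1)]) (simp add: part_def)
    ultimately show "u \<in> L.lin_span ?T" using a(2) by simp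
  qed
  ultimately have "fin_dim_submodule ?W"
    unfolding fin_dim_submodule_def using T by (intro conjI exI[of _ ?T])
  moreover have "s \<in> ?W" using s by (intro image_eqI[of _ _ "\<one>\<^bsub>kG\<^esub>"]) (simp_all add: X.smult_one)
  ultimately show ?thesis by blast
qed

lemma fin_dim_submodule_noetherian:
  assumes W: "fin_dim_submodule W" and P: "P \<subseteq> W"
  shows "\<exists>F. finite F \<and> F \<subseteq> P \<and> (\<forall>U. Module.submodule U kG X \<longrightarrow> F \<subseteq> U \<longrightarrow> P \<subseteq> U)"
proof -
  obtain T where T: "finite T" "T \<subseteq> carrier X" "W \<subseteq> L.lin_span T"
    using W unfolding fin_dim_submodule_def by auto
  have "T \<subseteq> carrier (restrict_scalars k G X)" "P \<subseteq> L.lin_span T" using T(2,3) P by auto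
  then obtain F where F: "finite F" "F \<subseteq> P" "P \<subseteq> L.lin_span F"
    by (rule L.finite_subset_spans[OF _ T(1)])
  have "P \<subseteq> U" if "Module.submodule U kG X" "F \<subseteq> U" for U
    using L.lin_span_least[OF that(2) submodule_subspace[OF that(1)]] F(3) by (rule order_trans[rotated])
  with F show ?thesis by (intro exI[of _ F]) simp
qed

text \<open>
  The rank function is the dimension over \<open>k\<close>.
\<close>

lemma fin_dim_finite_rank:
  assumes fd: "vectorspace.fin_dim k (restrict_scalars k G X)"
  shows "\<exists>subsp rk. finite_rank_module kG X subsp rk"
proof -
  interpret V: vectorspace k "restrict_scalars k G X"
    by (rule vectorspace_restrict_scalars) (unfold_locales, rule finite_group)
  obtain T where T: "finite T" "T \<subseteq> carrier X" "V.span T = carrier X"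
    using fd unfolding V.fin_dim_def by auto
  have TX: "T \<subseteq> carrier (restrict_scalars k G X)" using T(2) by simp
  have "V.span T \<subseteq> L.lin_span T"
  proof
    fix x assume "x \<in> V.span T"
    then show "x \<in> L.lin_span T"
      unfolding V.span_def V.lincomb_def L.lin_span_eq_finsum[OF TX] by blast
  qed
  then have span: "L.lin_span T = carrier X"
    using T L.lin_span_closed[of T] by auto
  obtain \<rho> :: "'x set \<Rightarrow> nat" where \<rho>: "\<forall>U W. L.lin_span U = U \<longrightarrow> U \<subseteq> W \<longrightarrow> W \<subseteq> L.lin_span T \<longrightarrow>
      \<rho> U \<le> \<rho> W \<and> (\<rho> U = \<rho> W \<longrightarrow> U = W)"
    using L.rank_function[OF TX T(1)] by (elim exE)
  let ?subsp = "\<lambda>W. Module.submodule W k (restrict_scalars k G X)"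
  have subspD: "L.lin_span W = W" "W \<subseteq> L.lin_span T" if "?subsp W" for W
    using L.lin_span_submodule_eq[OF that] L.submoduleD(1)[OF that] span by auto
  have "finite_rank_module kG X ?subsp \<rho>"
  proof (intro finite_rank_module.intro finite_rank_module_axioms.intro X.left_module_axioms)
    fix W assume W: "W \<subseteq> carrier X" "\<zero>\<^bsub>X\<^esub> \<in> W" "\<And>x y. x \<in> W \<Longrightarrow> y \<in> W \<Longrightarrow> x \<oplus>\<^bsub>X\<^esub> y \<in> W"
      "\<And>e x. e \<in> module_hom kG X X \<Longrightarrow> x \<in> W \<Longrightarrow> e x \<in> W"
    show "?subsp W" using W scalar_module_hom by (intro L.submoduleI) simp_all
  next
    fix U W assume "?subsp U" "?subsp W" "U \<subseteq> W"
    then show "\<rho> U \<le> \<rho> W" using \<rho> subspD by blast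
  next
    fix U W assume "?subsp U" "?subsp W" "U \<subseteq> W" "\<rho> U = \<rho> W"
    then show "U = W" using \<rho> subspD by blast
  qed (rule submodule_subspace)
  then show ?thesis by (intro exI)
qed

end

lemma (in group_algebra_module) locally_noetherian:
  assumes M: "finite_rank_module kG M subsp rk"
  shows "locally_noetherian_pair kG M X subsp rk fin_dim_submodule"
proof (intro locally_noetherian_pair.intro locally_noetherian_pair_axioms.intro M X.left_module_axioms)
  show "Module.submodule W kG X" if "fin_dim_submodule W" for W
    using that by (simp add: fin_dim_submodule_def)
qed (use fin_dim_submodule_directed cyclic_fin_dim_submodule fin_dim_submodule_noetherian in auto)

lemma group_algebra_multiplicity:
  assumes "field k" "group G" "finite (carrier G)"
    and M: "left_module (group_algebra k G) M" "vectorspace.fin_dim k (restrict_scalars k G M)"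
      "indecomposable (group_algebra k G) M"
    and X: "left_module (group_algebra k G) X"
  shows "let d = right_dim (residue_ring_End (group_algebra k G) M) (split_hom (group_algebra k G) M X) in
    Card_order d \<and> copies_in_summand (group_algebra k G) M X d \<and>
    (\<forall>r :: 'i rel. Card_order r \<longrightarrow> copies_in_summand (group_algebra k G) M X r \<longrightarrow> r \<le>o d)"
proof -
  interpret M: group_algebra_module k G M
    using assms by (intro group_algebra_module.intro group_algebra_module_axioms.intro)
  interpret X: group_algebra_module k G X
    using assms by (intro group_algebra_module.intro group_algebra_module_axioms.intro)
  obtain subsp rk where fr: "finite_rank_module (group_algebra k G) M subsp rk"
    using M.fin_dim_finite_rank[OF M(2)] by (elim exE)
  have "multiplicity_pair (group_algebra k G) M X subsp rk X.fin_dim_submodule"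
    by (rule multiplicity_pair.intro[OF X.locally_noetherian[OF fr]
          finite_rank_module.indecomposable_fitting_ring[OF fr M(3)]])
  then show ?thesis unfolding Let_def by (rule multiplicity_pair.multiplicity)
qed

theorem lemma2p3:
  fixes k :: "('k, 'a) ring_scheme"
    and G :: "('g, 'b) monoid_scheme"
    and M :: "('g \<Rightarrow> 'k, 'm, 'c) module_scheme"
    and S :: "('g \<Rightarrow> 'k, 's, 'd) module_scheme"
  defines "kG \<equiv> group_algebra k G"
  assumes "field k"
    and "group G" and "finite (carrier G)"
    and "left_module kG M"
    and "vectorspace.fin_dim k (restrict_scalars k G M)"
    and "indecomposable kG M"
    and "left_module kG S"
  shows "(let d = right_dim (residue_ring_End kG M) (split_hom kG M S) in
           Card_order d \<and> copies_in_summand kG M S d \<and>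
           (\<forall>r :: 'i rel. Card_order r \<longrightarrow> copies_in_summand kG M S r \<longrightarrow> r \<le>o d)) \<and>
         (\<forall>(I :: 'j set) T. internal_direct_sum kG S I T \<longrightarrow> (\<forall>i\<in>I.
           let d = right_dim (residue_ring_End kG M) (split_hom_component kG M S T i) in
           Card_order d \<and> copies_in_summand kG M (S\<lparr>carrier := T i\<rparr>) d \<and>
           (\<forall>r :: 'i rel. Card_order r \<longrightarrow>
             copies_in_summand kG M (S\<lparr>carrier := T i\<rparr>) r \<longrightarrow> r \<le>o d)))"
proof (intro conjI allI impI ballI)
  show "let d = right_dim (residue_ring_End kG M) (split_hom kG M S) in
      Card_order d \<and> copies_in_summand kG M S d \<and>
      (\<forall>r :: 'i rel. Card_order r \<longrightarrow> copies_in_summand kG M S r \<longrightarrow> r \<le>o d)"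
    unfolding kG_def
    by (rule group_algebra_multiplicity) (use assms in \<open>simp_all add: kG_def\<close>)
next
  fix I :: "'j set" and T i
  assume "internal_direct_sum kG S I T" and "i \<in> I"
  then have T: "Module.submodule (T i) kG S" by (simp add: internal_direct_sum_def)
  have "left_module kG (S\<lparr>carrier := T i\<rparr>)"
    by (rule left_module.submodule_left_module[OF \<open>left_module kG S\<close> T])
  then show "let d = right_dim (residue_ring_End kG M) (split_hom_component kG M S T i) in
      Card_order d \<and> copies_in_summand kG M (S\<lparr>carrier := T i\<rparr>) d \<and>
      (\<forall>r :: 'i rel. Card_order r \<longrightarrow>
        copies_in_summand kG M (S\<lparr>carrier := T i\<rparr>) r \<longrightarrow> r \<le>o d)"
    unfolding split_hom_component_def kG_def
    by (intro group_algebra_multiplicity) (use assms in \<open>simp_all add: kG_def\<close>)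
qed

end
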